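(* Let $\mathcal{H}$ be a separable complex Hilbert space with $\dim(\mathcal{H})\ge 2$, let $\mathcal{T}_1(\mathcal{H})_{\mathrm{sa}}$ be the real Banach space of selfadjoint trace class operators on $\mathcal{H}$ (with the trace norm), let $\mathcal{F}(\mathcal{H})_{\mathrm{sa}}\subset\mathcal{T}_1(\mathcal{H})_{\mathrm{sa}}$ be the (dense) linear manifold of selfadjoint finite-rank operators, and let $\mathcal{S}(\mathcal{H})$ be the set of density operators (positive trace class operators of unit trace). Let $\mathcal{L}$ be a linear operator in $\mathcal{T}_1(\mathcal{H})_{\mathrm{sa}}$ with domain $\mathrm{dom}(\mathcal{L})=\mathcal{F}(\mathcal{H})_{\mathrm{sa}}$, which maps the convex set $\mathcal{F}(\mathcal{H})_{\mathrm{sa}}\cap\mathcal{S}(\mathcal{H})$ bijectively onto itself. Then $\mathcal{L}$ is closable, and its closure $\overline{\mathcal{L}}$ is a surjective isometry of $\mathcal{T}_1(\mathcal{H})_{\mathrm{sa}}$ of the form $\overline{\mathcal{L}}(A)=UAU^\ast$ for all $A\in\mathcal{T}_1(\mathcal{H})_{\mathrm{sa}}$, where $U$ is a unitary or antiunitary operator on $\mathcal{H}$. *)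

theory Defs
  imports "HOL-Analysis.Analysis"
begin

class complex_vector = real_vector +
  fixes scaleC :: "complex \<Rightarrow> 'a \<Rightarrow> 'a"
  assumes scaleC_add_right: "scaleC a (x + y) = scaleC a x + scaleC a y"
    and scaleC_add_left: "scaleC (a + b) x = scaleC a x + scaleC b x"
    and scaleC_scaleC: "scaleC a (scaleC b x) = scaleC (a * b) x"
    and scaleC_one: "scaleC 1 x = x"
    and scaleR_scaleC: "scaleR r x = scaleC (complex_of_real r) x"

class complex_inner = complex_vector + real_normed_vector +
  fixes cinner :: "'a \<Rightarrow> 'a \<Rightarrow> complex"
  assumes cinner_commute: "cinner x y = cnj (cinner y x)"
    and cinner_add_left: "cinner (x + y) z = cinner x z + cinner y z"
    and cinner_scaleC_left: "cinner (scaleC r x) y = cnj r * cinner x y"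
    and cinner_ge_zero: "0 \<le> Re (cinner x x)"
    and cinner_eq_zero_iff: "cinner x x = 0 \<longleftrightarrow> x = 0"
    and norm_eq_sqrt_cinner: "norm x = sqrt (Re (cinner x x))"

class chilbert_space = complex_inner + complete_space

definition separable_space :: "'a::topological_space itself \<Rightarrow> bool" where
  "separable_space _ \<longleftrightarrow> (\<exists>D::'a set. countable D \<and> closure D = UNIV)"

definition dim_ge_2 :: "'a::complex_vector itself \<Rightarrow> bool" where
  "dim_ge_2 _ \<longleftrightarrow> (\<exists>x y::'a. \<forall>a b. scaleC a x + scaleC b y = 0 \<longrightarrow> a = 0 \<and> b = 0)"

definition cspan :: "'a::complex_vector set \<Rightarrow> 'a set" where
  "cspan S = {x. \<exists>F c. finite F \<and> F \<subseteq> S \<and> x = (\<Sum>v\<in>F. scaleC (c v) v)}"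

definition clinear :: "('a::complex_vector \<Rightarrow> 'b::complex_vector) \<Rightarrow> bool" where
  "clinear A \<longleftrightarrow> (\<forall>x y. A (x + y) = A x + A y) \<and> (\<forall>c x. A (scaleC c x) = scaleC c (A x))"

definition antilinear :: "('a::complex_vector \<Rightarrow> 'b::complex_vector) \<Rightarrow> bool" where
  "antilinear A \<longleftrightarrow> (\<forall>x y. A (x + y) = A x + A y) \<and> (\<forall>c x. A (scaleC c x) = scaleC (cnj c) (A x))"

definition bounded_clinear_op :: "('a::complex_inner \<Rightarrow> 'a) \<Rightarrow> bool" where
  "bounded_clinear_op A \<longleftrightarrow> clinear A \<and> (\<exists>K. \<forall>x. norm (A x) \<le> norm x * K)"

definition cadjoint :: "('a::complex_inner \<Rightarrow> 'a) \<Rightarrow> ('a \<Rightarrow> 'a)" where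
  "cadjoint U = (THE V. \<forall>x y. cinner (V x) y = cinner x (U y))"

definition antiadjoint :: "('a::complex_inner \<Rightarrow> 'a) \<Rightarrow> ('a \<Rightarrow> 'a)" where
  "antiadjoint U = (THE V. \<forall>x y. cinner (V x) y = cnj (cinner x (U y)))"

definition selfadjoint_op :: "('a::complex_inner \<Rightarrow> 'a) \<Rightarrow> bool" where
  "selfadjoint_op A \<longleftrightarrow> bounded_clinear_op A \<and> (\<forall>x y. cinner (A x) y = cinner x (A y))"

definition positive_op :: "('a::complex_inner \<Rightarrow> 'a) \<Rightarrow> bool" where
  "positive_op A \<longleftrightarrow> bounded_clinear_op A \<and>
     (\<forall>x. Im (cinner x (A x)) = 0 \<and> 0 \<le> Re (cinner x (A x)))"

definition unitary_op :: "('a::complex_inner \<Rightarrow> 'a) \<Rightarrow> bool" where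
  "unitary_op U \<longleftrightarrow> clinear U \<and> surj U \<and> (\<forall>x y. cinner (U x) (U y) = cinner x y)"

definition antiunitary_op :: "('a::complex_inner \<Rightarrow> 'a) \<Rightarrow> bool" where
  "antiunitary_op U \<longleftrightarrow> antilinear U \<and> surj U \<and> (\<forall>x y. cinner (U x) (U y) = cnj (cinner x y))"

definition pos_sqrt :: "('a::complex_inner \<Rightarrow> 'a) \<Rightarrow> ('a \<Rightarrow> 'a)" where
  "pos_sqrt A = (THE B. positive_op B \<and> (\<forall>x. B (B x) = A x))"

definition abs_op :: "('a::complex_inner \<Rightarrow> 'a) \<Rightarrow> ('a \<Rightarrow> 'a)" where
  "abs_op A = pos_sqrt (cadjoint A \<circ> A)"

definition is_onb :: "'a::complex_inner set \<Rightarrow> bool" where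
  "is_onb E \<longleftrightarrow> (\<forall>e\<in>E. cinner e e = 1) \<and> (\<forall>e\<in>E. \<forall>f\<in>E. e \<noteq> f \<longrightarrow> cinner e f = 0)
      \<and> closure (cspan E) = UNIV"

definition trace_class :: "('a::complex_inner \<Rightarrow> 'a) \<Rightarrow> bool" where
  "trace_class A \<longleftrightarrow> bounded_clinear_op A \<and>
     (\<exists>E. is_onb E \<and> (\<lambda>e. Re (cinner e (abs_op A e))) summable_on E)"

definition trace_norm :: "('a::complex_inner \<Rightarrow> 'a) \<Rightarrow> real" where
  "trace_norm A = infsum (\<lambda>e. Re (cinner e (abs_op A e))) (SOME E. is_onb E)"

definition trace_op :: "('a::complex_inner \<Rightarrow> 'a) \<Rightarrow> complex" where
  "trace_op A = infsum (\<lambda>e. cinner e (A e)) (SOME E. is_onb E)"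

definition finite_rank :: "('a::complex_inner \<Rightarrow> 'a) \<Rightarrow> bool" where
  "finite_rank A \<longleftrightarrow> bounded_clinear_op A \<and> (\<exists>F. finite F \<and> range A \<subseteq> cspan F)"

definition trace_class_sa :: "('a::complex_inner \<Rightarrow> 'a) set" where
  "trace_class_sa = {A. selfadjoint_op A \<and> trace_class A}"

definition finite_rank_sa :: "('a::complex_inner \<Rightarrow> 'a) set" where
  "finite_rank_sa = {A. selfadjoint_op A \<and> finite_rank A}"

definition density_ops :: "('a::complex_inner \<Rightarrow> 'a) set" where
  "density_ops = {A. positive_op A \<and> trace_class A \<and> trace_op A = 1}"

text \<open>Closure of the graph {(A, L A) | A in F_sa} in T_sa x T_sa w.r.t. the trace norm
  (sequential closure = closure in a metric space).\<close>
definition closure_graph :: "(('a::complex_inner \<Rightarrow> 'a) \<Rightarrow> ('a \<Rightarrow> 'a)) \<Rightarrow> (('a \<Rightarrow> 'a) \<times> ('a \<Rightarrow> 'a)) set" where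
  "closure_graph L = {(A, B). A \<in> trace_class_sa \<and> B \<in> trace_class_sa \<and>
     (\<exists>X. (\<forall>n. X n \<in> finite_rank_sa) \<and>
          (\<lambda>n. trace_norm (\<lambda>x. X n x - A x)) \<longlonglongrightarrow> 0 \<and>
          (\<lambda>n. trace_norm (\<lambda>x. L (X n) x - B x)) \<longlonglongrightarrow> 0)}"

definition closable :: "(('a::complex_inner \<Rightarrow> 'a) \<Rightarrow> ('a \<Rightarrow> 'a)) \<Rightarrow> bool" where
  "closable L \<longleftrightarrow> (\<forall>A B C. (A, B) \<in> closure_graph L \<and> (A, C) \<in> closure_graph L \<longrightarrow> B = C)"

definition op_closure :: "(('a::complex_inner \<Rightarrow> 'a) \<Rightarrow> ('a \<Rightarrow> 'a)) \<Rightarrow> ('a \<Rightarrow> 'a) \<Rightarrow> ('a \<Rightarrow> 'a)" where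
  "op_closure L A = (THE B. (A, B) \<in> closure_graph L)"

end

theory Submission
  imports Defs
begin

text \<open>
  An affine bijection of the finite-rank states maps extreme points, that is pure states
  \<open>outer x = |x\<rangle>\<langle>x|\<close>, to pure states in both directions. The decomposition
  \<open>outer x - outer y = s (outer v - outer w)\<close> with orthonormal \<open>v, w\<close> and
  \<open>s = sqrt (1 - \<bar>\<langle>x, y\<rangle>\<bar>\<^sup>2)\<close>, where \<open>s\<close> is the least coefficient with which
  \<open>outer x - outer y\<close> is a multiple of a difference of pure states, shows that transition
  probabilities are preserved. Linearity of \<open>L\<close> then produces the Wigner operator \<open>V\<close> directly, so \<open>L A = V A V\<^sup>*\<close> for finite-rank \<open>A\<close> by the spectral theorem.
  Conjugation by \<open>V\<close> is isometric for the trace norm, which dominates the operator norm, and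
  finite-rank operators are dense because truncating the spectral sum of a trace class operator
  leaves a tail of the summable series of its eigenvalues.
\<close>

subsection \<open>Complex inner product spaces\<close>

text \<open>The inverse of \<open>L\<close> is available only on states, since bijectivity is
  assumed only there. An identity can therefore be pulled back through \<open>L\<close> only after
  it has been rewritten between convex combinations, and this shapes the arguments for extreme
  points and for one half of the invariance of transition probabilities. The usual obstacle in
  Wigner's theorem, a free phase for every vector, disappears once a unit vector \<open>e\<close> is
  fixed: for \<open>x\<close> orthogonal to \<open>e\<close> the cross term
  \<open>sym_outer e x\<close> of \<open>outer (e + x)\<close> is real linear in \<open>x\<close>
  and determines \<open>x\<close>, so real linearity of \<open>L\<close> descends to vectors. What
  is left is a single choice between \<open>\<i>\<close> and \<open>- \<i>\<close>. On the analytic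
  side, trace class is certified by one orthonormal basis, trace and trace norm use a basis picked
  by \<open>SOME\<close>, and \<open>abs_op\<close> is a definite description. Existence and
  uniqueness of square roots and independence of the basis come first; statements about the trace
  norm are then read off in an eigenbasis, where it is the sum of the absolute eigenvalues.\<close>

instance chilbert_space \<subseteq> banach ..

lemma scaleC_zero_left [simp]: "scaleC 0 x = 0"
  using scaleC_add_left[of 0 0 x] by simp

lemma scaleC_zero_right [simp]: "scaleC a 0 = 0"
  using scaleC_add_right[of a 0 0] by simp

lemma scaleC_one_left [simp]: "scaleC 1 x = x"
  by (rule scaleC_one)

lemma scaleC_minus_left: "scaleC (- a) x = - scaleC a x"
  using scaleC_add_left[of a "-a" x] by (simp add: eq_neg_iff_add_eq_0 add.commute)

lemma scaleC_minus_right: "scaleC a (- x) = - scaleC a x"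
  using scaleC_add_right[of a x "-x"] by (simp add: eq_neg_iff_add_eq_0 add.commute)

lemma scaleC_diff_left: "scaleC (a - b) x = scaleC a x - scaleC b x"
  using scaleC_add_left[of a "-b" x] by (simp add: scaleC_minus_left)

lemma scaleC_diff_right: "scaleC a (x - y) = scaleC a x - scaleC a y"
  using scaleC_add_right[of a x "-y"] by (simp add: scaleC_minus_right)

lemma scaleC_sum_right: "scaleC a (\<Sum>i\<in>I. f i) = (\<Sum>i\<in>I. scaleC a (f i))"
  by (induction I rule: infinite_finite_induct) (auto simp: scaleC_add_right)

lemma scaleC_sum_left: "scaleC (\<Sum>i\<in>I. f i) x = (\<Sum>i\<in>I. scaleC (f i) x)"
  by (induction I rule: infinite_finite_induct) (auto simp: scaleC_add_left)

lemma scaleC_cancel: "a \<noteq> 0 \<Longrightarrow> scaleC a x = scaleC a y \<longleftrightarrow> x = y"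
  by (metis scaleC_scaleC scaleC_one left_inverse)

lemma scaleC_scaleR: "scaleC a (r *\<^sub>R x) = r *\<^sub>R scaleC a x"
  by (simp add: scaleR_scaleC scaleC_scaleC mult.commute)

lemmas scaleC_simps = scaleC_add_left scaleC_add_right scaleC_diff_left scaleC_diff_right
  scaleC_minus_left scaleC_minus_right scaleC_scaleC

lemma cinner_add_right: "cinner x (y + z) = cinner x y + cinner x z"
  by (metis cinner_commute cinner_add_left complex_cnj_add)

lemma cmod_cinner_commute: "cmod (cinner x y) = cmod (cinner y x)"
  by (metis cinner_commute complex_mod_cnj)

lemma cinner_scaleC_right: "cinner x (scaleC r y) = r * cinner x y"
  by (metis cinner_commute cinner_scaleC_left complex_cnj_mult complex_cnj_cnj)

lemma cinner_zero_left [simp]: "cinner 0 y = 0"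
  using cinner_add_left[of 0 0 y] by simp

lemma cinner_zero_right [simp]: "cinner x 0 = 0"
  using cinner_add_right[of x 0 0] by simp

lemma cinner_minus_left: "cinner (- x) y = - cinner x y"
  using cinner_add_left[of x "-x" y] by (simp add: eq_neg_iff_add_eq_0 add.commute)

lemma cinner_minus_right: "cinner x (- y) = - cinner x y"
  using cinner_add_right[of x y "-y"] by (simp add: eq_neg_iff_add_eq_0 add.commute)

lemma cinner_diff_left: "cinner (x - y) z = cinner x z - cinner y z"
  using cinner_add_left[of x "-y" z] by (simp add: cinner_minus_left)

lemma cinner_diff_right: "cinner x (y - z) = cinner x y - cinner x z"
  using cinner_add_right[of x y "-z"] by (simp add: cinner_minus_right)

lemma cinner_sum_left: "cinner (\<Sum>i\<in>I. f i) y = (\<Sum>i\<in>I. cinner (f i) y)"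
  by (induction I rule: infinite_finite_induct) (auto simp: cinner_add_left)

lemma cinner_sum_right: "cinner x (\<Sum>i\<in>I. f i) = (\<Sum>i\<in>I. cinner x (f i))"
  by (induction I rule: infinite_finite_induct) (auto simp: cinner_add_right)

lemma cinner_scaleR_left: "cinner (r *\<^sub>R x) y = of_real r * cinner x y"
  by (simp add: scaleR_scaleC cinner_scaleC_left)

lemma cinner_scaleR_right: "cinner x (r *\<^sub>R y) = of_real r * cinner x y"
  by (simp add: scaleR_scaleC cinner_scaleC_right)

lemmas cinner_simps = cinner_add_left cinner_add_right cinner_diff_left cinner_diff_right
  cinner_minus_left cinner_minus_right cinner_scaleC_left cinner_scaleC_right
  cinner_scaleR_left cinner_scaleR_right

lemma Re_cinner_self: "Re (cinner x x) = (norm x)\<^sup>2"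
  by (simp add: norm_eq_sqrt_cinner cinner_ge_zero)

lemma Im_cinner_self [simp]: "Im (cinner x x) = 0"
  using arg_cong[OF cinner_commute[of x x], of Im] by simp

lemma cinner_self: "cinner x x = of_real ((norm x)\<^sup>2)"
  by (simp add: complex_eq_iff Re_cinner_self)

lemma cinner_ext: "(\<And>z. cinner z x = cinner z y) \<Longrightarrow> x = y"
  by (metis cinner_diff_right cinner_eq_zero_iff eq_iff_diff_eq_0)

lemma norm_scaleC: "norm (scaleC c (x::'a::complex_inner)) = cmod c * norm x"
proof -
  have "cinner (scaleC c x) (scaleC c x) = c * cnj c * cinner x x"
    by (simp add: cinner_simps)
  also have "\<dots> = of_real ((cmod c * norm x)\<^sup>2)"
    by (simp only: complex_norm_square[symmetric] cinner_self power_mult_distrib of_real_mult)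
  finally have "cinner (scaleC c x) (scaleC c x) = of_real ((cmod c * norm x)\<^sup>2)" .
  then have "(norm (scaleC c x))\<^sup>2 = (cmod c * norm x)\<^sup>2"
    by (metis Re_cinner_self Re_complex_of_real)
  then show ?thesis
    by (simp add: power2_eq_iff_nonneg)
qed

lemma norm_add_sq: "(norm (x + y))\<^sup>2 = (norm x)\<^sup>2 + (norm y)\<^sup>2 + 2 * Re (cinner x y)"
proof -
  have "Re (cinner y x) = Re (cinner x y)"
    by (metis cinner_commute complex_cnj cnj.simps(1))
  then show ?thesis
    by (simp flip: Re_cinner_self add: cinner_simps)
qed

lemma norm_diff_sq: "(norm (x - y))\<^sup>2 = (norm x)\<^sup>2 + (norm y)\<^sup>2 - 2 * Re (cinner x y)"
  using norm_add_sq[of x "-y"] by (simp add: cinner_minus_right)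

lemma unit_phase:
  assumes "z \<noteq> 0"
  shows "cnj (z / of_real (cmod z)) * z = of_real (cmod z)" "cmod (z / of_real (cmod z)) = 1"
proof -
  have "cnj z * z = of_real (cmod z) * of_real (cmod z)"
    using complex_norm_square[of z] by (simp add: power2_eq_square mult.commute[of "cnj z"])
  then show "cnj (z / of_real (cmod z)) * z = of_real (cmod z)"
    using assms by (simp add: field_simps)
  show "cmod (z / of_real (cmod z)) = 1"
    using assms by (simp add: norm_divide)
qed

subsection \<open>Bounded operators\<close>

lemma clinear_simps:
  assumes "clinear A"
  shows "A (x + y) = A x + A y" "A (scaleC c x) = scaleC c (A x)" "A (r *\<^sub>R x) = r *\<^sub>R A x"
    "A 0 = 0" "A (- x) = - A x" "A (x - y) = A x - A y"
proof -
  show a: "\<And>x y. A (x + y) = A x + A y" and s: "\<And>c x. A (scaleC c x) = scaleC c (A x)"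
    using assms by (auto simp: clinear_def)
  show "A (r *\<^sub>R x) = r *\<^sub>R A x" by (simp add: scaleR_scaleC s)
  show "A 0 = 0" using s[of 0 0] by simp
  show m: "\<And>x. A (- x) = - A x" using s[of "-1"] by (simp add: scaleC_minus_left)
  show "A (x - y) = A x - A y" using a[of x "-y"] by (simp add: m)
qed

lemma bounded_clinear_op_clinear: "bounded_clinear_op A \<Longrightarrow> clinear A"
  by (simp add: bounded_clinear_op_def)

lemma bounded_clinear_op_bound:
  assumes "bounded_clinear_op A"
  obtains K where "K > 0" "\<And>x. norm (A x) \<le> K * norm x"
proof -
  obtain K where K: "\<And>x. norm (A x) \<le> norm x * K"
    using assms by (auto simp: bounded_clinear_op_def)
  have "norm (A x) \<le> (\<bar>K\<bar> + 1) * norm x" for x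
  proof -
    have "norm x * K \<le> norm x * (\<bar>K\<bar> + 1)" by (intro mult_left_mono) auto
    then show ?thesis using K[of x] by (simp add: mult.commute)
  qed
  then show thesis by (intro that[of "\<bar>K\<bar> + 1"]) auto
qed

lemma bounded_clinear_opI:
  assumes "\<And>x y. A (x + y) = A x + A y" "\<And>c x. A (scaleC c x) = scaleC c (A x)"
    "\<And>x. norm (A x) \<le> K * norm x"
  shows "bounded_clinear_op A"
  using assms by (auto simp: bounded_clinear_op_def clinear_def mult.commute)

lemma bounded_clinear_op_bounded_linear: "bounded_clinear_op A \<Longrightarrow> bounded_linear A"
  by (auto simp: bounded_clinear_op_def intro!: bounded_linear_intro clinear_simps)

lemma selfadjoint_opD:
  assumes "selfadjoint_op A"
  shows "bounded_clinear_op A" "clinear A" "cinner (A x) y = cinner x (A y)" "Im (cinner x (A x)) = 0"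
proof -
  show "bounded_clinear_op A" "clinear A" and *: "\<And>x y. cinner (A x) y = cinner x (A y)"
    using assms by (auto simp: selfadjoint_op_def bounded_clinear_op_def)
  show "Im (cinner x (A x)) = 0"
    using arg_cong[OF *[of x x], of Im] arg_cong[OF cinner_commute[of x "A x"], of Im] by simp
qed

lemma bounded_clinear_op_add:
  assumes "bounded_clinear_op A" "bounded_clinear_op B"
  shows "bounded_clinear_op (\<lambda>x. A x + B x)"
proof -
  obtain K where K: "\<And>x. norm (A x) \<le> K * norm x" using bounded_clinear_op_bound[OF assms(1)] by metis
  obtain M where M: "\<And>x. norm (B x) \<le> M * norm x" using bounded_clinear_op_bound[OF assms(2)] by metis
  have "norm (A x + B x) \<le> (K + M) * norm x" for x
    using norm_triangle_ineq[of "A x" "B x"] K[of x] M[of x] by (simp add: algebra_simps)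
  then show ?thesis
    using assms by (auto intro!: bounded_clinear_opI[where K="K+M"]
        simp: clinear_simps bounded_clinear_op_clinear scaleC_add_right)
qed

lemma bounded_clinear_op_scaleR:
  assumes "bounded_clinear_op A"
  shows "bounded_clinear_op (\<lambda>x. r *\<^sub>R A x)"
proof -
  obtain K where K: "\<And>x. norm (A x) \<le> K * norm x" using bounded_clinear_op_bound[OF assms(1)] by metis
  have "norm (r *\<^sub>R A x) \<le> (\<bar>r\<bar> * K) * norm x" for x
    using K[of x] by (simp add: mult_left_mono mult.assoc)
  then show ?thesis
    using assms by (auto intro!: bounded_clinear_opI[where K="\<bar>r\<bar> * K"]
        simp: clinear_simps bounded_clinear_op_clinear scaleC_scaleR scaleR_add_right)
qed

lemma bounded_clinear_op_compose:
  assumes "bounded_clinear_op A" "bounded_clinear_op B"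
  shows "bounded_clinear_op (\<lambda>x. A (B x))"
proof -
  obtain K where K: "K > 0" "\<And>x. norm (A x) \<le> K * norm x" using bounded_clinear_op_bound[OF assms(1)] by metis
  obtain M where M: "\<And>x. norm (B x) \<le> M * norm x" using bounded_clinear_op_bound[OF assms(2)] by metis
  have "norm (A (B x)) \<le> (K * M) * norm x" for x
    using order_trans[OF K(2)[of "B x"] mult_left_mono[OF M[of x], of K]] K(1) by (simp add: mult.assoc)
  then show ?thesis
    using assms by (auto intro!: bounded_clinear_opI[where K="K*M"]
        simp: clinear_simps bounded_clinear_op_clinear)
qed

lemma selfadjoint_op_add:
  "selfadjoint_op A \<Longrightarrow> selfadjoint_op B \<Longrightarrow> selfadjoint_op (\<lambda>x. A x + B x)"
  by (simp add: selfadjoint_op_def bounded_clinear_op_add cinner_simps)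

lemma selfadjoint_op_scaleR: "selfadjoint_op A \<Longrightarrow> selfadjoint_op (\<lambda>x. r *\<^sub>R A x)"
  by (simp add: selfadjoint_op_def bounded_clinear_op_scaleR cinner_simps)

lemma selfadjoint_op_diff:
  "selfadjoint_op A \<Longrightarrow> selfadjoint_op B \<Longrightarrow> selfadjoint_op (\<lambda>x. A x - B x)"
  using selfadjoint_op_add[of A "\<lambda>x. (-1) *\<^sub>R B x"] selfadjoint_op_scaleR[of B "-1"] by simp

lemma bounded_clinear_op_id: "bounded_clinear_op (\<lambda>x. x)"
  by (rule bounded_clinear_opI[where K=1]) auto

section \<open>Positive operators and the Cauchy-Schwarz inequality\<close>

lemma positive_op_id: "positive_op (\<lambda>x. x)"
  by (simp add: positive_op_def bounded_clinear_op_id Re_cinner_self)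

lemma positive_op_clinear: "positive_op T \<Longrightarrow> clinear T"
  and positive_op_bounded: "positive_op T \<Longrightarrow> bounded_clinear_op T"
  and positive_op_ge_0: "positive_op T \<Longrightarrow> 0 \<le> Re (cinner x (T x))"
  by (auto simp: positive_op_def bounded_clinear_op_def)

text \<open>Polarisation: reality of the quadratic form at \<open>x + y\<close> makes the imaginary
  parts of \<open>cinner x (T y)\<close> and \<open>cinner y (T x)\<close> opposite, and reality at
  \<open>x + scaleC \<i> y\<close> makes their real parts equal.\<close>

lemma positive_op_selfadjoint:
  assumes "positive_op T"
  shows "selfadjoint_op T"
proof -
  note lin = clinear_simps[OF positive_op_clinear[OF assms]]
  have im: "Im (cinner x (T x)) = 0" for x using assms by (auto simp: positive_op_def)
  have "cinner (T x) y = cinner x (T y)" for x y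
  proof -
    have "Im (cinner x (T y) + cinner y (T x)) = 0"
      using im[of "x + y"] im[of x] im[of y] by (simp add: lin cinner_simps)
    moreover have "Re (cinner x (T y)) - Re (cinner y (T x)) = 0"
      using im[of "x + scaleC \<i> y"] im[of x] im[of y] by (simp add: lin cinner_simps)
    ultimately have "cinner x (T y) = cnj (cinner y (T x))"
      by (simp add: complex_eq_iff)
    then show ?thesis by (metis cinner_commute)
  qed
  then show ?thesis by (simp add: selfadjoint_op_def positive_op_bounded assms)
qed

lemma positive_op_Cauchy_Schwarz:
  assumes "positive_op T"
  shows "(cmod (cinner x (T y)))\<^sup>2 \<le> Re (cinner x (T x)) * Re (cinner y (T y))"
proof -
  note lin = clinear_simps[OF positive_op_clinear[OF assms]]
  define a where "a = Re (cinner x (T x))"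
  define b where "b = Re (cinner y (T y))"
  define c where "c = cinner x (T y)"
  have c': "cinner y (T x) = cnj c"
    unfolding c_def by (metis cinner_commute selfadjoint_opD(3)[OF positive_op_selfadjoint[OF assms]])
  have aa: "cinner x (T x) = of_real a" "cinner y (T y) = of_real b"
    using assms by (auto simp: positive_op_def a_def b_def complex_eq_iff)
  \<comment> \<open>The form is evaluated at \<open>y - t c x\<close>; the factor \<open>c\<close>
    aligns the phases, so that a quadratic polynomial in the real variable \<open>t\<close>
    remains.\<close>
  have ineq: "0 \<le> b - 2 * t * (cmod c)\<^sup>2 + t\<^sup>2 * (cmod c)\<^sup>2 * a" for t :: real
  proof -
    define z where "z = y - scaleC (of_real t * c) x"
    have "cinner z (T z) = of_real b - 2 * of_real t * (c * cnj c) + of_real t^2 * (c * cnj c) * of_real a"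
      by (simp add: z_def lin cinner_simps aa c' c_def[symmetric] algebra_simps power2_eq_square)
    also have "c * cnj c = of_real ((cmod c)\<^sup>2)" by (rule complex_norm_square[symmetric])
    finally have "cinner z (T z) = of_real (b - 2 * t * (cmod c)\<^sup>2 + t\<^sup>2 * (cmod c)\<^sup>2 * a)"
      by simp
    then show ?thesis using positive_op_ge_0[OF assms, of z] by simp
  qed
  have "(cmod c)\<^sup>2 \<le> a * b"
  proof (cases "a = 0")
    case True
    show ?thesis
    proof (cases "(cmod c)\<^sup>2 = 0")
      case True
      then show ?thesis using \<open>a = 0\<close> by simp
    next
      case False
      \<comment> \<open>For \<open>a = 0\<close> the polynomial is affine with slope
        \<open>-2 |c|^2\<close>; this \<open>t\<close> brings it down to \<open>- b - 2\<close>,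
        which is negative.\<close>
      have "0 \<le> b - 2 * ((b + 1) / (cmod c)\<^sup>2) * (cmod c)\<^sup>2" using ineq[of "(b + 1) / (cmod c)\<^sup>2"] \<open>a = 0\<close> by simp
      then have "0 \<le> b - 2 * (b + 1)" using False by simp
      moreover have "0 \<le> b" using positive_op_ge_0[OF assms] b_def by simp
      ultimately show ?thesis by simp
    qed
  next
    case False
    then have "a > 0" using positive_op_ge_0[OF assms, of x] a_def by simp
    \<comment> \<open>\<open>t = 1/a\<close> is the minimiser of the quadratic.\<close>
    have "b - 2 * (1/a) * (cmod c)\<^sup>2 + (1/a)\<^sup>2 * (cmod c)\<^sup>2 * a = b - (cmod c)\<^sup>2 / a"
      using \<open>a > 0\<close> by (simp add: field_simps power2_eq_square)
    then have "(cmod c)\<^sup>2 / a \<le> b" using ineq[of "1/a"] by simp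
    then show ?thesis using \<open>a > 0\<close> by (simp add: field_simps)
  qed
  then show ?thesis by (simp add: a_def b_def c_def)
qed

lemma Cauchy_Schwarz: "cmod (cinner x y) \<le> norm x * norm y"
proof -
  have "(cmod (cinner x y))\<^sup>2 \<le> (norm x * norm y)\<^sup>2"
    using positive_op_Cauchy_Schwarz[OF positive_op_id, of x y]
    by (simp add: Re_cinner_self power_mult_distrib)
  then show ?thesis by (simp add: power2_le_iff_abs_le)
qed

lemma positive_op_eq_0:
  assumes "positive_op T" "Re (cinner x (T x)) = 0"
  shows "T x = 0"
proof -
  have "(cmod (cinner (T x) (T x)))\<^sup>2 \<le> 0"
    using positive_op_Cauchy_Schwarz[OF assms(1), of "T x" x] assms(2) by simp
  then show ?thesis by (simp add: cinner_eq_zero_iff)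
qed

text \<open>Cauchy-Schwarz for the form of \<open>T\<close> at the pair \<open>T x\<close>,
  \<open>x\<close>, divided by the square of \<open>norm (T x)\<close>. It turns control of
  quadratic forms into control of norms.\<close>

lemma positive_op_norm_sq_le:
  assumes "positive_op T" "\<And>x. norm (T x) \<le> K * norm x" "K \<ge> 0"
  shows "(norm (T x))\<^sup>2 \<le> K * Re (cinner x (T x))"
proof (cases "T x = 0")
  case True
  then show ?thesis by simp
next
  case False
  have "((norm (T x))\<^sup>2)\<^sup>2 \<le> Re (cinner (T x) (T (T x))) * Re (cinner x (T x))"
    using positive_op_Cauchy_Schwarz[OF assms(1), of "T x" x]
    by (simp only: cinner_self norm_of_real abs_power2 abs_norm_cancel)
  also have "Re (cinner (T x) (T (T x))) \<le> norm (T x) * norm (T (T x))"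
    using Cauchy_Schwarz complex_Re_le_cmod order_trans by blast
  also have "\<dots> \<le> norm (T x) * (K * norm (T x))"
    using assms(2) by (intro mult_left_mono) auto
  finally have "(norm (T x))\<^sup>2 * (norm (T x))\<^sup>2 \<le> (K * Re (cinner x (T x))) * (norm (T x))\<^sup>2"
    using positive_op_ge_0[OF assms(1), of x]
    by (simp add: mult_right_mono power2_eq_square algebra_simps)
  then show ?thesis
    using mult_right_le_imp_le[of "(norm (T x))\<^sup>2" "(norm (T x))\<^sup>2"] False by simp
qed

lemma bounded_bilinear_cinner: "bounded_bilinear cinner"
  by (rule bounded_bilinear.intro)
    (auto simp: cinner_simps scaleR_conv_of_real Cauchy_Schwarz intro!: exI[of _ 1])

lemmas bounded_linear_cinner_right = bounded_bilinear.bounded_linear_right[OF bounded_bilinear_cinner]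
lemmas bounded_linear_cinner_left = bounded_bilinear.bounded_linear_left[OF bounded_bilinear_cinner]
lemmas tendsto_cinner = bounded_bilinear.tendsto[OF bounded_bilinear_cinner]

lemma bounded_bilinear_scaleC: "bounded_bilinear (scaleC :: complex \<Rightarrow> 'a::complex_inner \<Rightarrow> 'a)"
  by (rule bounded_bilinear.intro)
    (auto simp: scaleC_simps scaleC_scaleR norm_scaleC scaleR_scaleC scaleR_conv_of_real mult.commute intro!: exI[of _ 1])

lemmas tendsto_scaleC = bounded_bilinear.tendsto[OF bounded_bilinear_scaleC]
lemmas bounded_linear_scaleC_left = bounded_bilinear.bounded_linear_left[OF bounded_bilinear_scaleC]

subsection \<open>Orthonormal sets\<close>

definition orthonormal :: "'a::complex_inner set \<Rightarrow> bool" where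
  "orthonormal E \<longleftrightarrow> (\<forall>e\<in>E. cinner e e = 1) \<and> (\<forall>e\<in>E. \<forall>f\<in>E. e \<noteq> f \<longrightarrow> cinner e f = 0)"

lemma orthonormal_cinner:
  "orthonormal E \<Longrightarrow> e \<in> E \<Longrightarrow> f \<in> E \<Longrightarrow> cinner e f = (if e = f then 1 else 0)"
  by (auto simp: orthonormal_def)

lemma orthonormal_norm: "orthonormal E \<Longrightarrow> e \<in> E \<Longrightarrow> norm e = 1"
  by (simp add: orthonormal_def norm_eq_sqrt_cinner)

lemma cinner_orthonormal_sum:
  assumes "orthonormal E" "finite F" "F \<subseteq> E" "e \<in> E"
  shows "cinner e (\<Sum>f\<in>F. scaleC (c f) f) = (if e \<in> F then c e else 0)"
proof -
  have "cinner e (\<Sum>f\<in>F. scaleC (c f) f) = (\<Sum>f\<in>F. if f = e then c f else 0)"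
    unfolding cinner_sum_right
    by (rule sum.cong) (use assms in \<open>auto simp: cinner_scaleC_right orthonormal_cinner[OF assms(1)] subset_iff\<close>)
  then show ?thesis using assms by simp
qed

lemma norm_orthonormal_sum:
  assumes "orthonormal E" "finite F" "F \<subseteq> E"
  shows "(norm (\<Sum>f\<in>F. scaleC (c f) f))\<^sup>2 = (\<Sum>f\<in>F. (cmod (c f))\<^sup>2)"
proof -
  have "cinner (\<Sum>f\<in>F. scaleC (c f) f) (\<Sum>f\<in>F. scaleC (c f) f) = (\<Sum>f\<in>F. cnj (c f) * c f)"
    unfolding cinner_sum_left[of _ F] cinner_scaleC_left
    by (rule sum.cong) (use assms in \<open>auto simp: cinner_orthonormal_sum subset_iff\<close>)
  also have "\<dots> = of_real (\<Sum>f\<in>F. (cmod (c f))\<^sup>2)"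
    unfolding of_real_sum by (intro sum.cong) (auto simp only: complex_norm_square mult.commute)
  finally show ?thesis by (simp flip: Re_cinner_self)
qed

lemma Bessel_finite:
  assumes "orthonormal E" "finite F" "F \<subseteq> E"
  shows "(\<Sum>f\<in>F. (cmod (cinner f x))\<^sup>2) \<le> (norm x)\<^sup>2"
proof -
  let ?p = "\<Sum>f\<in>F. scaleC (cinner f x) f"
  have "cinner ?p x = (\<Sum>f\<in>F. cnj (cinner f x) * cinner f x)"
    by (simp add: cinner_sum_left cinner_scaleC_left)
  also have "\<dots> = of_real (\<Sum>f\<in>F. (cmod (cinner f x))\<^sup>2)"
    unfolding of_real_sum by (intro sum.cong) (auto simp only: complex_norm_square mult.commute)
  finally have "Re (cinner ?p x) = (norm ?p)\<^sup>2"
    using norm_orthonormal_sum[OF assms, of "\<lambda>f. cinner f x"] by simp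
  then have "(norm ?p)\<^sup>2 \<le> (norm x)\<^sup>2"
    using norm_diff_sq[of ?p x] zero_le_power2[of "norm (?p - x)"] by simp
  then show ?thesis using norm_orthonormal_sum[OF assms, of "\<lambda>f. cinner f x"] by simp
qed

section \<open>Unconditional summation and orthonormal expansions\<close>

text \<open>Orthonormal series need not converge absolutely, so completeness is applied to the
  filter of finite partial sums itself.\<close>

lemma summable_on_CauchyI:
  fixes f :: "'i \<Rightarrow> 'b::banach"
  assumes "\<And>e. e > 0 \<Longrightarrow> \<exists>F0. finite F0 \<and> F0 \<subseteq> A \<and> (\<forall>F. finite F \<and> F \<subseteq> A - F0 \<longrightarrow> norm (sum f F) < e)"
  shows "f summable_on A"
proof -
  have "\<exists>P. eventually P (finite_subsets_at_top A) \<and>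
      (\<forall>F F'. P F \<and> P F' \<longrightarrow> dist (sum f F) (sum f F') < e)" if "e > 0" for e
  proof -
    obtain F0 where F0: "finite F0" "F0 \<subseteq> A" "\<And>F. finite F \<Longrightarrow> F \<subseteq> A - F0 \<Longrightarrow> norm (sum f F) < e/2"
      using assms[of "e/2"] \<open>e > 0\<close> by auto
    have near: "dist (sum f F) (sum f F0) < e/2" if "finite F" "F0 \<subseteq> F" "F \<subseteq> A" for F
    proof -
      have "sum f F - sum f F0 = sum f (F - F0)" using sum_diff[OF that(1,2), of f] by (rule sym)
      moreover have "norm (sum f (F - F0)) < e/2" by (rule F0(3)) (use that in auto)
      ultimately show ?thesis by (simp only: dist_norm)
    qed
    have "dist (sum f F) (sum f F') < e"
      if "finite F \<and> F0 \<subseteq> F \<and> F \<subseteq> A" "finite F' \<and> F0 \<subseteq> F' \<and> F' \<subseteq> A" for F F'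
      by (rule dist_triangle_half_l[OF near near]) (use that in simp_all)
    moreover have "eventually (\<lambda>F. finite F \<and> F0 \<subseteq> F \<and> F \<subseteq> A) (finite_subsets_at_top A)"
      unfolding eventually_finite_subsets_at_top using F0(1,2) by blast
    ultimately show ?thesis
      by (intro exI[of _ "\<lambda>F. finite F \<and> F0 \<subseteq> F \<and> F \<subseteq> A"]) simp
  qed
  then have "cauchy_filter (filtermap (sum f) (finite_subsets_at_top A))"
    by (simp add: cauchy_filter_metric_filtermap)
  moreover have "complete (UNIV::'b set)"
    by (meson Cauchy_convergent UNIV_I complete_def convergent_def)
  ultimately obtain L where "(sum f \<longlongrightarrow> L) (finite_subsets_at_top A)"
    using complete_uniform[where S=UNIV] by (force simp add: filterlim_def)
  then show ?thesis using summable_on_def has_sum_def by blast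
qed

lemma summable_on_small_tails:
  fixes g :: "'i \<Rightarrow> real"
  assumes "g summable_on A" "\<And>x. x \<in> A \<Longrightarrow> g x \<ge> 0" "e > 0"
  obtains F0 where "finite F0" "F0 \<subseteq> A" "\<And>F. finite F \<Longrightarrow> F \<subseteq> A - F0 \<Longrightarrow> sum g F < e"
proof -
  obtain S where S: "(g has_sum S) A" using assms(1) by (auto simp: summable_on_def)
  obtain F0 where F0: "finite F0" "F0 \<subseteq> A" "dist (sum g F0) S \<le> e/2"
    using has_sum_finite_approximation[OF S, of "e/2"] \<open>e > 0\<close> by auto
  have "sum g F < e" if "finite F" "F \<subseteq> A - F0" for F
  proof -
    have "sum g (F0 \<union> F) \<le> S"
      by (rule finite_sum_le_has_sum[OF S]) (use that F0 assms in auto)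
    moreover have "sum g (F0 \<union> F) = sum g F0 + sum g F"
      by (rule sum.union_disjoint) (use that F0 in auto)
    ultimately show ?thesis using F0(3) \<open>e > 0\<close> unfolding dist_real_def by linarith
  qed
  then show thesis using F0 that by blast
qed

lemma orthonormal_summable:
  fixes E :: "'a::chilbert_space set"
  assumes "orthonormal E" "(\<lambda>e. (cmod (c e))\<^sup>2) summable_on E"
  shows "(\<lambda>e. scaleC (c e) e) summable_on E"
proof (rule summable_on_CauchyI)
  fix d :: real assume "d > 0"
  then obtain F0 where F0: "finite F0" "F0 \<subseteq> E"
      "\<And>F. finite F \<Longrightarrow> F \<subseteq> E - F0 \<Longrightarrow> (\<Sum>e\<in>F. (cmod (c e))\<^sup>2) < d\<^sup>2"
    using summable_on_small_tails[OF assms(2), of "d\<^sup>2"] by auto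
  have "norm (\<Sum>e\<in>F. scaleC (c e) e) < d" if "finite F" "F \<subseteq> E - F0" for F
  proof -
    have "F \<subseteq> E" using that by auto
    then have "(norm (\<Sum>e\<in>F. scaleC (c e) e))\<^sup>2 < d\<^sup>2"
      using F0(3)[OF that] norm_orthonormal_sum[OF assms(1) that(1), of c] by simp
    then show ?thesis using \<open>d > 0\<close> by (simp add: power2_less_imp_less)
  qed
  then show "\<exists>F0. finite F0 \<and> F0 \<subseteq> E \<and> (\<forall>F. finite F \<and> F \<subseteq> E - F0 \<longrightarrow> norm (\<Sum>e\<in>F. scaleC (c e) e) < d)"
    using F0 by blast
qed

lemma Bessel_summable:
  assumes "orthonormal E"
  shows "(\<lambda>e. (cmod (cinner e x))\<^sup>2) summable_on E"
  by (rule nonneg_bounded_partial_sums_imp_summable_on[where C = "(norm x)\<^sup>2"])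
    (use Bessel_finite[OF assms] in \<open>auto intro!: eventually_finite_subsets_at_top_weakI\<close>)

text \<open>Bessel's inequality yields some sum \<open>s\<close>; since \<open>s - x\<close> is
  orthogonal to all of \<open>E\<close>, totality identifies \<open>s\<close> with
  \<open>x\<close>.\<close>

lemma total_orthonormal_expansion:
  fixes E :: "'a::chilbert_space set"
  assumes "orthonormal E" "\<And>x. (\<And>e. e \<in> E \<Longrightarrow> cinner e x = 0) \<Longrightarrow> x = 0"
  shows "((\<lambda>e. scaleC (cinner e x) e) has_sum x) E"
proof -
  obtain s where s: "((\<lambda>e. scaleC (cinner e x) e) has_sum s) E"
    using orthonormal_summable[OF assms(1) Bessel_summable[OF assms(1)]] by (auto simp: summable_on_def)
  have "cinner e s = cinner e x" if "e \<in> E" for e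
  proof -
    have "((\<lambda>f. cinner e (scaleC (cinner f x) f)) has_sum cinner e s) E"
      by (rule has_sum_bounded_linear[OF bounded_linear_cinner_right s])
    moreover have "((\<lambda>f. cinner e (scaleC (cinner f x) f)) has_sum cinner e x) E"
      by (rule has_sum_finite_neutralI[of "{e}"])
        (use that in \<open>auto simp: cinner_scaleC_right orthonormal_cinner[OF assms(1)]\<close>)
    ultimately show ?thesis by (rule has_sum_unique)
  qed
  then have "s - x = 0" by (intro assms(2)) (simp add: cinner_diff_right)
  then show ?thesis using s by simp
qed

lemma cspan_cinner_0:
  assumes "\<And>e. e \<in> E \<Longrightarrow> cinner e x = 0" "y \<in> cspan E"
  shows "cinner y x = 0"
  using assms by (auto simp: cspan_def cinner_sum_left cinner_scaleC_left subset_iff)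

text \<open>Zorn's lemma produces orthonormal sets with trivial orthogonal complement, whereas
  \<open>is_onb\<close> asks for a dense span. Continuity of the inner product gives one direction,
  the partial sums of the expansion the other.\<close>

lemma is_onb_iff:
  fixes E :: "'a::chilbert_space set"
  shows "is_onb E \<longleftrightarrow> orthonormal E \<and> (\<forall>x. (\<forall>e\<in>E. cinner e x = 0) \<longrightarrow> x = 0)"
proof (intro iffI conjI allI impI)
  assume onb: "is_onb E"
  then show "orthonormal E" by (simp add: is_onb_def orthonormal_def)
  fix x assume x: "\<forall>e\<in>E. cinner e x = 0"
  have "closed {y. cinner y x = 0}"
    by (intro closed_Collect_eq continuous_intros linear_continuous_on bounded_linear_cinner_left)
  moreover have "cspan E \<subseteq> {y. cinner y x = 0}" using cspan_cinner_0 x by blast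
  ultimately have "closure (cspan E) \<subseteq> {y. cinner y x = 0}" by (simp add: closure_minimal)
  then have "cinner x x = 0" using onb by (auto simp: is_onb_def)
  then show "x = 0" by (simp add: cinner_eq_zero_iff)
next
  assume E: "orthonormal E \<and> (\<forall>x. (\<forall>e\<in>E. cinner e x = 0) \<longrightarrow> x = 0)"
  have "x \<in> closure (cspan E)" for x
  proof (rule Lim_in_closed_set[OF closed_closure])
    have "((\<lambda>e. scaleC (cinner e x) e) has_sum x) E"
      using E by (intro total_orthonormal_expansion) auto
    then show "((\<lambda>F. \<Sum>e\<in>F. scaleC (cinner e x) e) \<longlongrightarrow> x) (finite_subsets_at_top E)"
      by (simp add: has_sum_def)
    show "\<forall>\<^sub>F F in finite_subsets_at_top E. (\<Sum>e\<in>F. scaleC (cinner e x) e) \<in> closure (cspan E)"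
      by (intro eventually_finite_subsets_at_top_weakI subsetD[OF closure_subset]) (auto simp: cspan_def)
  qed simp
  then show "is_onb E" using E by (auto simp: is_onb_def orthonormal_def)
qed

lemma is_onb_orthonormal: "is_onb E \<Longrightarrow> orthonormal E"
  by (simp add: is_onb_def orthonormal_def)

lemma onb_expansion:
  fixes E :: "'a::chilbert_space set"
  shows "is_onb E \<Longrightarrow> ((\<lambda>e. scaleC (cinner e x) e) has_sum x) E"
  by (rule total_orthonormal_expansion) (auto simp: is_onb_iff)

lemma onb_Parseval_cinner:
  fixes E :: "'a::chilbert_space set"
  assumes "is_onb E"
  shows "((\<lambda>e. cinner e y * cinner x e) has_sum cinner x y) E"
  using has_sum_bounded_linear[OF bounded_linear_cinner_right onb_expansion[OF assms, of y], of x]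
  by (simp add: cinner_scaleC_right)

lemma onb_Parseval:
  fixes E :: "'a::chilbert_space set"
  assumes "is_onb E"
  shows "((\<lambda>e. (cmod (cinner e x))\<^sup>2) has_sum (norm x)\<^sup>2) E"
proof -
  have "((\<lambda>e. Re (cinner e x * cinner x e)) has_sum Re (cinner x x)) E"
    by (rule has_sum_Re[OF onb_Parseval_cinner[OF assms]])
  moreover have "Re (cinner e x * cinner x e) = (cmod (cinner e x))\<^sup>2" for e
    using arg_cong[OF complex_norm_square[of "cinner e x"], of Re] cinner_commute[of x e] by simp
  ultimately show ?thesis by (simp add: Re_cinner_self)
qed

lemma clinear_ext_onb:
  fixes E :: "'a::chilbert_space set"
  assumes "is_onb E" "bounded_clinear_op A" "bounded_clinear_op B" "\<And>e. e \<in> E \<Longrightarrow> A e = B e"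
  shows "A = B"
proof
  fix x
  have *: "((\<lambda>e. scaleC (cinner e x) (C e)) has_sum C x) E" if "bounded_clinear_op C" for C
    using has_sum_bounded_linear[OF bounded_clinear_op_bounded_linear[OF that] onb_expansion[OF assms(1), of x]]
    by (simp add: clinear_simps[OF bounded_clinear_op_clinear[OF that]])
  have "((\<lambda>e. scaleC (cinner e x) (B e)) has_sum A x) E"
    using *[OF assms(2)] by (rule has_sum_cong[THEN iffD1, rotated]) (simp add: assms(4))
  then show "A x = B x" using *[OF assms(3)] has_sum_unique by blast
qed

lemma selfadjoint_eigenvalue_expansion:
  fixes E :: "'a::chilbert_space set"
  assumes "is_onb E" "selfadjoint_op A" "\<And>e. e \<in> E \<Longrightarrow> A e = l e *\<^sub>R e"
  shows "((\<lambda>e. l e * (cmod (cinner e x))\<^sup>2) has_sum Re (cinner x (A x))) E"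
proof -
  have "((\<lambda>e. Re (cinner e (A x) * cinner x e)) has_sum Re (cinner x (A x))) E"
    by (rule has_sum_Re[OF onb_Parseval_cinner[OF assms(1)]])
  moreover have "Re (cinner e (A x) * cinner x e) = l e * (cmod (cinner e x))\<^sup>2" if "e \<in> E" for e
  proof -
    have "cinner e (A x) = of_real (l e) * cinner e x"
      by (simp flip: selfadjoint_opD(3)[OF assms(2)] add: assms(3) that cinner_simps)
    moreover have "cinner e x * cinner x e = of_real ((cmod (cinner e x))\<^sup>2)"
      using complex_norm_square[of "cinner e x"] cinner_commute[of x e] by simp
    ultimately have "cinner e (A x) * cinner x e = of_real (l e * (cmod (cinner e x))\<^sup>2)"
      by (simp add: mult.assoc)
    then show ?thesis by simp
  qed
  ultimately show ?thesis by (simp cong: has_sum_cong)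
qed

subsection \<open>Compact operators\<close>

text \<open>Relative compactness of the image of the unit ball, phrased as containment in a compact
  set so that differences can be handled without closures.\<close>

definition compact_op :: "('a::complex_inner \<Rightarrow> 'a) \<Rightarrow> bool" where
  "compact_op A \<longleftrightarrow> (\<exists>K. compact K \<and> (\<forall>x. norm x \<le> 1 \<longrightarrow> A x \<in> K))"

lemma compact_op_diff:
  assumes "compact_op A" "compact_op B"
  shows "compact_op (\<lambda>x. A x - B x)"
proof -
  obtain K1 K2 where K: "compact K1" "\<And>x. norm x \<le> 1 \<Longrightarrow> A x \<in> K1"
      "compact K2" "\<And>x. norm x \<le> 1 \<Longrightarrow> B x \<in> K2"
    using assms unfolding compact_op_def by auto
  then show ?thesis
    unfolding compact_op_def
    by (intro exI[of _ "{x - y | x y. x \<in> K1 \<and> y \<in> K2}"] conjI compact_differences) auto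
qed

text \<open>A Minkowski sum of continuous images of the closed unit disc, assembled one vector at a
  time. Such sets serve as the compact sets for truncated and for finite-rank operators.\<close>

lemma compact_coefficient_sums:
  fixes g :: "'i \<Rightarrow> 'a::complex_inner"
  assumes "finite F"
  shows "compact {\<Sum>i\<in>F. scaleC (c i) (g i) | c. \<forall>i\<in>F. cmod (c i) \<le> 1}"
  using assms
proof (induction F)
  case empty
  then show ?case by simp
next
  case (insert a F)
  let ?S = "\<lambda>F. {\<Sum>i\<in>F. scaleC (c i) (g i) | c. \<forall>i\<in>F. cmod (c i) \<le> 1}"
  have "compact ((\<lambda>c. scaleC c (g a)) ` cball 0 1)"
    by (intro compact_continuous_image linear_continuous_on bounded_linear_scaleC_left compact_cball)
  then have "compact {x + y | x y. x \<in> (\<lambda>c. scaleC c (g a)) ` cball 0 1 \<and> y \<in> ?S F}"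
    using insert.IH by (rule compact_sums)
  moreover have "{x + y | x y. x \<in> (\<lambda>c. scaleC c (g a)) ` cball 0 1 \<and> y \<in> ?S F} = ?S (insert a F)"
  proof (intro subset_antisym subsetI)
    fix z assume "z \<in> {x + y | x y. x \<in> (\<lambda>c. scaleC c (g a)) ` cball 0 1 \<and> y \<in> ?S F}"
    then obtain k c where kc: "cmod k \<le> 1" "\<forall>i\<in>F. cmod (c i) \<le> 1"
        "z = scaleC k (g a) + (\<Sum>i\<in>F. scaleC (c i) (g i))"
      by auto
    have "(\<Sum>i\<in>F. scaleC ((c(a := k)) i) (g i)) = (\<Sum>i\<in>F. scaleC (c i) (g i))"
      by (rule sum.cong) (use insert.hyps in auto)
    then have "z = (\<Sum>i\<in>insert a F. scaleC ((c(a := k)) i) (g i))"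
      using insert.hyps kc by simp
    moreover have "\<forall>i\<in>insert a F. cmod ((c(a := k)) i) \<le> 1" using kc by simp
    ultimately show "z \<in> ?S (insert a F)" by blast
  next
    fix z assume "z \<in> ?S (insert a F)"
    then obtain c where c: "\<forall>i\<in>insert a F. cmod (c i) \<le> 1"
        "z = (\<Sum>i\<in>insert a F. scaleC (c i) (g i))" by auto
    then have "z = scaleC (c a) (g a) + (\<Sum>i\<in>F. scaleC (c i) (g i))" using insert.hyps by simp
    moreover have "scaleC (c a) (g a) \<in> (\<lambda>c. scaleC c (g a)) ` cball 0 1" using c by simp
    moreover have "(\<Sum>i\<in>F. scaleC (c i) (g i)) \<in> ?S F" using c by blast
    ultimately show "z \<in> {x + y | x y. x \<in> (\<lambda>c. scaleC c (g a)) ` cball 0 1 \<and> y \<in> ?S F}"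
      by blast
  qed
  ultimately show ?case by simp
qed

text \<open>A finite \<open>d/3\<close>-net of the nearby compact set is a \<open>d\<close>-net of
  the closure: one third is spent on passing from the closure into \<open>S\<close>, one from
  \<open>S\<close> to \<open>C\<close>, and one from \<open>C\<close> to the net.\<close>

lemma compact_closure_if_near_compact:
  fixes S :: "'a::banach set"
  assumes "\<And>d. d > 0 \<Longrightarrow> \<exists>C. compact C \<and> (\<forall>x\<in>S. \<exists>y\<in>C. dist x y < d)"
  shows "compact (closure S)"
  unfolding compact_eq_totally_bounded
proof (intro conjI allI impI)
  show "complete (closure S)" by (simp add: complete_eq_closed)
  fix d :: real assume "d > 0"
  then obtain C where C: "compact C" "\<forall>x\<in>S. \<exists>y\<in>C. dist x y < d/3"
    using assms[of "d/3"] by auto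
  obtain k where k: "finite k" "C \<subseteq> (\<Union>x\<in>k. ball x (d/3))"
    using C(1) \<open>d > 0\<close> unfolding compact_eq_totally_bounded by (meson divide_pos_pos zero_less_numeral)
  have "x \<in> (\<Union>x\<in>k. ball x d)" if xS: "x \<in> closure S" for x
  proof -
    obtain s where s: "s \<in> S" "dist s x < d/3"
      using closure_approachable[THEN iffD1, rule_format, OF xS, of "d/3"] \<open>d > 0\<close> by auto
    obtain y where y: "y \<in> C" "dist s y < d/3" using C s by blast
    then obtain w where w: "w \<in> k" "dist w y < d/3" using k by auto
    have "dist w x < d"
      using dist_triangle[of w x y] dist_triangle[of y x s] s y w by (simp add: dist_commute)
    then show ?thesis using w by auto
  qed
  then show "\<exists>k. finite k \<and> closure S \<subseteq> (\<Union>x\<in>k. ball x d)" using k by blast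
qed

text \<open>On the unit ball \<open>A\<close> is uniformly close to its truncation to finitely many
  basis vectors: Cauchy-Schwarz bounds the error by the Bessel bound for the coefficients times the
  tail of the Hilbert-Schmidt sum.\<close>

lemma Hilbert_Schmidt_compact:
  fixes E :: "'a::chilbert_space set"
  assumes onb: "is_onb E" and A: "bounded_clinear_op A" and sm: "(\<lambda>e. (norm (A e))\<^sup>2) summable_on E"
  shows "compact_op A"
proof -
  have "compact (closure (A ` cball 0 1))"
  proof (rule compact_closure_if_near_compact)
    fix d :: real assume "d > 0"
    then have "(d/2)\<^sup>2 > 0" by simp
    then obtain F0 where F0: "finite F0" "F0 \<subseteq> E"
        "\<And>F. finite F \<Longrightarrow> F \<subseteq> E - F0 \<Longrightarrow> (\<Sum>e\<in>F. (norm (A e))\<^sup>2) < (d/2)\<^sup>2"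
      using summable_on_small_tails[OF sm, of "(d/2)\<^sup>2"] by auto
    \<comment> \<open>Coefficients of a vector in the unit ball have modulus at most 1, so
      \<open>C\<close> contains every truncation \<open>p\<close> below.\<close>
    define C where "C = {\<Sum>e\<in>F0. scaleC (c e) (A e) | c. \<forall>e\<in>F0. cmod (c e) \<le> 1}"
    have "compact C" unfolding C_def by (rule compact_coefficient_sums[OF F0(1)])
    moreover have "\<exists>y\<in>C. dist z y < d" if z: "z \<in> A ` cball 0 1" for z
    proof -
      obtain x where x: "z = A x" "norm x \<le> 1" using z by auto
      define p where "p = (\<Sum>e\<in>F0. scaleC (cinner e x) (A e))"
      have "cmod (cinner e x) \<le> 1" if "e \<in> F0" for e
        using Cauchy_Schwarz[of e x] orthonormal_norm[OF is_onb_orthonormal[OF onb], of e] that F0 x by auto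
      then have "p \<in> C" unfolding C_def p_def
        by (intro CollectI exI[of _ "\<lambda>e. cinner e x"] conjI refl ballI)
      have hs: "((\<lambda>e. scaleC (cinner e x) (A e)) has_sum A x) E"
        using has_sum_bounded_linear[OF bounded_clinear_op_bounded_linear[OF A] onb_expansion[OF onb, of x]]
        by (simp add: clinear_simps[OF bounded_clinear_op_clinear[OF A]])
      have tail: "norm ((\<Sum>e\<in>F. scaleC (cinner e x) (A e)) - p) \<le> d/2"
        if F: "finite F" "F0 \<subseteq> F" "F \<subseteq> E" for F
      proof -
        have "(\<Sum>e\<in>F. scaleC (cinner e x) (A e)) - p = (\<Sum>e\<in>F - F0. scaleC (cinner e x) (A e))"
          unfolding p_def using sum_diff[OF F(1,2), of "\<lambda>e. scaleC (cinner e x) (A e)"] by (rule sym)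
        also have "norm \<dots> \<le> (\<Sum>e\<in>F - F0. \<bar>cmod (cinner e x)\<bar> * \<bar>norm (A e)\<bar>)"
          using norm_sum[of "\<lambda>e. scaleC (cinner e x) (A e)" "F - F0"] by (simp add: norm_scaleC)
        also have "\<dots> \<le> L2_set (\<lambda>e. cmod (cinner e x)) (F - F0) * L2_set (\<lambda>e. norm (A e)) (F - F0)"
          by (rule L2_set_mult_ineq)
        also have "\<dots> \<le> 1 * (d/2)"
        proof (rule mult_mono)
          have "(\<Sum>e\<in>F - F0. (cmod (cinner e x))\<^sup>2) \<le> (norm x)\<^sup>2"
            by (rule Bessel_finite[OF is_onb_orthonormal[OF onb]]) (use F in auto)
          also have "\<dots> \<le> 1" using x by (simp add: power_le_one)
          finally show "L2_set (\<lambda>e. cmod (cinner e x)) (F - F0) \<le> 1"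
            by (simp add: L2_set_def)
          have "(\<Sum>e\<in>F - F0. (norm (A e))\<^sup>2) \<le> (d/2)\<^sup>2"
            by (rule less_imp_le, rule F0(3)) (use F in auto)
          then show "L2_set (\<lambda>e. norm (A e)) (F - F0) \<le> d/2"
            using \<open>d > 0\<close> unfolding L2_set_def by (intro real_le_lsqrt sum_nonneg) auto
        qed (auto simp: L2_set_nonneg)
        finally show ?thesis by simp
      qed
      have "((\<lambda>F. (\<Sum>e\<in>F. scaleC (cinner e x) (A e)) - p) \<longlongrightarrow> A x - p) (finite_subsets_at_top E)"
        using hs unfolding has_sum_def by (intro tendsto_intros)
      moreover have "\<forall>\<^sub>F F in finite_subsets_at_top E. norm ((\<Sum>e\<in>F. scaleC (cinner e x) (A e)) - p) \<le> d/2"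
        unfolding eventually_finite_subsets_at_top using F0(1,2) tail by blast
      ultimately have "norm (A x - p) \<le> d/2"
        by (intro Lim_norm_ubound) auto
      then have "dist z p < d" using x \<open>d > 0\<close> by (simp add: dist_norm)
      then show ?thesis using \<open>p \<in> C\<close> by blast
    qed
    ultimately show "\<exists>C. compact C \<and> (\<forall>x\<in>A ` cball 0 1. \<exists>y\<in>C. dist x y < d)" by blast
  qed
  moreover have "A x \<in> closure (A ` cball 0 1)" if "norm x \<le> 1" for x
    using that closure_subset[of "A ` cball 0 1"] by auto
  ultimately show ?thesis unfolding compact_op_def by blast
qed

subsection \<open>The spectral theorem for compact selfadjoint operators\<close>

text \<open>The invariant subspace \<open>M\<close> is carried along so that the result applies to
  the complement of eigenvectors already found. Vectors of \<open>M\<close> that nearly attain the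
  norm \<open>m\<close> of \<open>A\<close> on \<open>M\<close> are nearly eigenvectors of the
  square of \<open>A\<close> for \<open>m^2\<close>; compactness makes a subsequence converge, and a
  factorisation returns from the square to \<open>A\<close>.\<close>

lemma compact_selfadjoint_eigenvector:
  fixes A :: "'a::chilbert_space \<Rightarrow> 'a"
  assumes sa: "selfadjoint_op A" and cp: "compact_op A"
    and M: "closed M" "\<And>x y. x \<in> M \<Longrightarrow> y \<in> M \<Longrightarrow> x + y \<in> M" "\<And>c x. x \<in> M \<Longrightarrow> scaleC c x \<in> M"
      "\<And>x. x \<in> M \<Longrightarrow> A x \<in> M"
    and z: "z \<in> M" "z \<noteq> 0"
  shows "\<exists>x\<in>M. norm x = 1 \<and> (\<exists>l::real. A x = l *\<^sub>R x)"
proof -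
  note lin = clinear_simps[OF selfadjoint_opD(2)[OF sa]]
  have MR: "r *\<^sub>R x \<in> M" if "x \<in> M" for r :: real and x using M(3) that by (simp add: scaleR_scaleC)
  have normalise: ?thesis if w: "w \<in> M" "w \<noteq> 0" "A w = l *\<^sub>R w" for w and l :: real
    by (rule bexI[of _ "(1 / norm w) *\<^sub>R w"]) (use w in \<open>auto simp: lin MR intro!: exI[of _ l]\<close>)
  obtain K where K: "compact K" "\<And>x. norm x \<le> 1 \<Longrightarrow> A x \<in> K" using cp by (auto simp: compact_op_def)
  define B where "B = {x\<in>M. norm x \<le> 1}"
  define m where "m = (SUP x\<in>B. norm (A x))"
  obtain b where b: "\<And>y. y \<in> K \<Longrightarrow> norm y \<le> b" using compact_imp_bounded[OF K(1)] by (auto simp: bounded_iff)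
  have bdd: "bdd_above ((\<lambda>x. norm (A x)) ` B)"
    by (rule bdd_aboveI[of _ b]) (use b K in \<open>auto simp: B_def\<close>)
  have "0 \<in> B" using MR[OF z(1), of 0] by (simp add: B_def)
  have m0: "m \<ge> 0" unfolding m_def using cSUP_upper[OF \<open>0 \<in> B\<close> bdd] by (simp add: lin)
  have le: "norm (A x) \<le> m * norm x" if "x \<in> M" for x
  proof (cases "x = 0")
    case False
    have "(1 / norm x) *\<^sub>R x \<in> B" using MR[OF that] False by (simp add: B_def)
    then have "norm (A ((1 / norm x) *\<^sub>R x)) \<le> m" unfolding m_def by (rule cSUP_upper[OF _ bdd])
    then show ?thesis using False by (simp add: lin field_simps)
  qed (simp add: lin)
  show ?thesis
  proof (cases "m = 0")
    case True
    then have "A z = 0 *\<^sub>R z" using le[OF z(1)] by simp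
    then show ?thesis by (rule normalise[OF z])
  next
    case False
    then have "m > 0" using m0 by simp
    have "\<exists>x\<in>B. m - 1 / real (Suc n) < norm (A x)" for n
    proof -
      have "m - 1 / real (Suc n) < (SUP x\<in>B. norm (A x))" by (simp flip: m_def)
      moreover have "B \<noteq> {}" using \<open>0 \<in> B\<close> by blast
      ultimately show ?thesis using less_cSUP_iff[OF _ bdd] by blast
    qed
    then obtain x where x: "\<And>n. x n \<in> B" "\<And>n. m - 1 / real (Suc n) < norm (A (x n))" by metis
    have xM: "x n \<in> M" "norm (x n) \<le> 1" for n using x(1) by (auto simp: B_def)
    have "(\<lambda>n. m - 1 / real (Suc n)) \<longlonglongrightarrow> m - 0" 
      by (intro tendsto_diff tendsto_const LIMSEQ_Suc[OF lim_1_over_n])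
    moreover have "norm (A (x n)) \<le> m" for n
      unfolding m_def by (rule cSUP_upper[OF x(1) bdd])
    ultimately have lim: "(\<lambda>n. norm (A (x n))) \<longlonglongrightarrow> m"
      using tendsto_sandwich[of "\<lambda>n. m - 1 / real (Suc n)" "\<lambda>n. norm (A (x n))" sequentially "\<lambda>_. m" m]
        less_imp_le[OF x(2)] by simp
    obtain y and r :: "nat \<Rightarrow> nat" where r: "strict_mono r" "(\<lambda>n. A (x (r n))) \<longlonglongrightarrow> y"
    proof -
      have "\<forall>n. A (x n) \<in> K" using K(2) xM by blast
      from seq_compactE[OF compact_imp_seq_compact[OF K(1)] this] show ?thesis
        using that unfolding o_def by blast
    qed
    have limr: "(\<lambda>n. norm (A (x (r n)))) \<longlonglongrightarrow> m"
      using LIMSEQ_subseq_LIMSEQ[OF lim r(1)] by (simp add: o_def)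
    have ny: "norm y = m" using LIMSEQ_unique[OF tendsto_norm[OF r(2)] limr] .
    have contA: "(\<lambda>n. A (f n)) \<longlonglongrightarrow> A l" if "f \<longlonglongrightarrow> l" for f l
      by (rule bounded_linear.tendsto[OF bounded_clinear_op_bounded_linear[OF selfadjoint_opD(1)[OF sa]] that])
    \<comment> \<open>The square is expanded using
      \<open>norm (A (A x)) \<le> m * norm (A x)\<close> and \<open>norm x \<le> 1\<close>. The
      bound tends to 0 because \<open>norm (A (x n))\<close> tends to \<open>m\<close>.\<close>
    have sq: "(norm (A (A (x n)) - (m^2) *\<^sub>R x n))\<^sup>2 \<le> m^4 - m^2 * (norm (A (x n)))\<^sup>2" for n
    proof -
      have "Re (cinner (A (A (x n))) ((m^2) *\<^sub>R x n)) = m^2 * (norm (A (x n)))\<^sup>2"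
        by (simp add: cinner_scaleR_right selfadjoint_opD(3)[OF sa, of "A (x n)"] Re_cinner_self)
      then have "(norm (A (A (x n)) - (m^2) *\<^sub>R x n))\<^sup>2
          = (norm (A (A (x n))))\<^sup>2 + m^4 * (norm (x n))\<^sup>2 - 2 * (m^2 * (norm (A (x n)))\<^sup>2)"
        by (simp add: norm_diff_sq power_mult_distrib flip: power_mult)
      moreover have "(norm (A (A (x n))))\<^sup>2 \<le> m^2 * (norm (A (x n)))\<^sup>2"
        using power_mono[OF le[OF M(4)[OF xM(1)[of n]]], of 2] by (simp add: power_mult_distrib)
      moreover have "m^4 * (norm (x n))\<^sup>2 \<le> m^4 * 1"
        by (intro mult_left_mono power_le_one) (use xM in auto)
      ultimately show ?thesis by simp
    qed
    have "(\<lambda>n. m^4 - m^2 * (norm (A (x (r n))))\<^sup>2) \<longlonglongrightarrow> m^4 - m^2 * m^2"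
      by (intro tendsto_intros limr)
    then have "(\<lambda>n. m^4 - m^2 * (norm (A (x (r n))))\<^sup>2) \<longlonglongrightarrow> 0" by (simp flip: power_add)
    then have "(\<lambda>n. (norm (A (A (x (r n))) - (m^2) *\<^sub>R x (r n)))\<^sup>2) \<longlonglongrightarrow> 0"
      by (rule tendsto_sandwich[rotated 3]) (use sq in auto)
    then have "(\<lambda>n. norm (A (A (x (r n))) - (m^2) *\<^sub>R x (r n))) \<longlonglongrightarrow> 0"
      using tendsto_real_sqrt by force
    then have "(\<lambda>n. A (A (x (r n))) - (m^2) *\<^sub>R x (r n)) \<longlonglongrightarrow> 0"
      by (rule tendsto_norm_zero_cancel)
    from tendsto_diff[OF contA[OF r(2)] this] have "(\<lambda>n. (m^2) *\<^sub>R x (r n)) \<longlonglongrightarrow> A y" by simp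
    from tendsto_scaleR[OF tendsto_const this, of "1 / m^2"]
    have xl: "(\<lambda>n. x (r n)) \<longlonglongrightarrow> (1 / m^2) *\<^sub>R A y" using \<open>m > 0\<close> by simp
    \<comment> \<open>\<open>u\<close> is the limit of the subsequence itself:
      \<open>A (A (x (r n)))\<close> converges to \<open>A y\<close> and differs from
      \<open>m^2\<close> times \<open>x (r n)\<close> by a null sequence.\<close>
    define u where "u = (1 / m^2) *\<^sub>R A y"
    have uM: "u \<in> M" unfolding u_def by (rule closed_sequentially[OF M(1) _ xl]) (use xM in auto)
    have Au: "A u = y" using LIMSEQ_unique[OF contA[OF xl] r(2)] by (simp add: u_def)
    have AAu: "A (A u) = (m^2) *\<^sub>R u" using \<open>m > 0\<close> by (simp only: Au) (simp add: u_def)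
    have "u \<noteq> 0" using Au ny \<open>m > 0\<close> by (auto simp: lin)
    \<comment> \<open>From \<open>(A - m) (A + m) u = 0\<close>: either \<open>w\<close> is a
      nonzero eigenvector for \<open>m\<close>, or \<open>w = 0\<close> and \<open>u\<close> is one
      for \<open>- m\<close>.\<close>
    define w where "w = A u + m *\<^sub>R u"
    have wM: "w \<in> M" unfolding w_def by (intro M(2) M(4) MR uM)
    show ?thesis
    proof (cases "w = 0")
      case True
      then have "A u = (- m) *\<^sub>R u" by (simp add: w_def add_eq_0_iff2)
      then show ?thesis by (rule normalise[OF uM \<open>u \<noteq> 0\<close>])
    next
      case False
      have "A w = m *\<^sub>R w" by (simp add: w_def lin AAu scaleR_add_right power2_eq_square)
      then show ?thesis by (rule normalise[OF wM False])
    qed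
  qed
qed

text \<open>A maximal orthonormal set of eigenvectors has an \<open>A\<close>-invariant orthogonal
  complement by selfadjointness. A nonzero complement would contain a further eigenvector.\<close>

lemma compact_selfadjoint_eigenbasis:
  fixes A :: "'a::chilbert_space \<Rightarrow> 'a"
  assumes sa: "selfadjoint_op A" and cp: "compact_op A"
  obtains E and l :: "'a \<Rightarrow> real" where "is_onb E" "\<And>e. e \<in> E \<Longrightarrow> A e = l e *\<^sub>R e"
proof -
  define \<A> where "\<A> = {E. orthonormal E \<and> (\<forall>e\<in>E. \<exists>l::real. A e = l *\<^sub>R e)}"
  have "\<exists>E\<in>\<A>. \<forall>X\<in>\<A>. E \<subseteq> X \<longrightarrow> X = E"
  proof (rule subset_Zorn_nonempty)
    show "\<A> \<noteq> {}" by (auto simp: \<A>_def orthonormal_def intro!: exI[of _ "{}"])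
    fix \<C> assume "\<C> \<noteq> {}" and ch: "subset.chain \<A> \<C>"
    have "cinner e f = 0" if ef: "e \<in> \<Union>\<C>" "f \<in> \<Union>\<C>" "e \<noteq> f" for e f
    proof -
      obtain X Y where XY: "e \<in> X" "X \<in> \<C>" "f \<in> Y" "Y \<in> \<C>" using ef by auto
      then have "X \<in> \<A>" "Y \<in> \<A>" "X \<subseteq> Y \<or> Y \<subseteq> X" using ch by (auto simp: subset_chain_def)
      then show ?thesis using XY ef(3) by (auto simp: \<A>_def orthonormal_def)
    qed
    moreover have "cinner e e = 1 \<and> (\<exists>l::real. A e = l *\<^sub>R e)" if "e \<in> \<Union>\<C>" for e
      using that ch by (auto simp: subset_chain_def \<A>_def orthonormal_def)
    ultimately show "\<Union>\<C> \<in> \<A>" by (auto simp: \<A>_def orthonormal_def)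
  qed
  then obtain E where E: "E \<in> \<A>" and mx: "\<And>X. X \<in> \<A> \<Longrightarrow> E \<subseteq> X \<Longrightarrow> X = E" by blast
  have orth: "orthonormal E" using E by (simp add: \<A>_def)
  have "z = 0" if z: "\<forall>e\<in>E. cinner e z = 0" for z
  proof (rule ccontr)
    assume "z \<noteq> 0"
    define M where "M = {x. \<forall>e\<in>E. cinner e x = 0}"
    have "\<exists>x\<in>M. norm x = 1 \<and> (\<exists>l::real. A x = l *\<^sub>R x)"
    proof (rule compact_selfadjoint_eigenvector[OF sa cp])
      have "M = (\<Inter>e\<in>E. {x. cinner e x = 0})" by (auto simp: M_def)
      moreover have "closed {x. cinner e x = 0}" for e :: 'a
        by (intro closed_Collect_eq continuous_intros linear_continuous_on bounded_linear_cinner_right)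
      ultimately show "closed M" by (simp add: closed_INT)
      show "z \<in> M" using z by (simp add: M_def)
      show "z \<noteq> 0" by fact
      fix x assume x: "x \<in> M"
      show "A x \<in> M" unfolding M_def
      proof safe
        fix e assume e: "e \<in> E"
        then obtain l where "A e = l *\<^sub>R e" using E by (auto simp: \<A>_def)
        then show "cinner e (A x) = 0"
          using x e by (simp flip: selfadjoint_opD(3)[OF sa] add: cinner_scaleR_left M_def)
      qed
    qed (auto simp: M_def cinner_simps)
    then obtain x l where x: "\<forall>e\<in>E. cinner e x = 0" "norm x = 1" "A x = l *\<^sub>R x" by (auto simp: M_def)
    have "cinner x x = 1" using x by (simp add: cinner_self)
    moreover have "cinner x e = 0" if "e \<in> E" for e
      using x(1) that cinner_commute[of x e] by simp
    ultimately have "insert x E \<in> \<A>"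
      using E x by (auto simp: \<A>_def orthonormal_def)
    then have "x \<in> E" using mx[of "insert x E"] by auto
    then show False using x \<open>cinner x x = 1\<close> by auto
  qed
  then have onb: "is_onb E" using orth by (simp add: is_onb_iff)
  have "\<exists>l::real. A e = l *\<^sub>R e" if "e \<in> E" for e using E that by (auto simp: \<A>_def)
  then obtain l :: "'a \<Rightarrow> real" where "\<And>e. e \<in> E \<Longrightarrow> A e = l e *\<^sub>R e" by metis
  then show thesis using that[OF onb] by blast
qed

lemma selfadjoint_op_zero: "selfadjoint_op (\<lambda>x. 0)"
  by (auto simp: selfadjoint_op_def intro!: bounded_clinear_opI[where K=0])

text \<open>The zero operator is compact and selfadjoint, and an eigenbasis of it is just an
  orthonormal basis.\<close>

lemma ex_onb: "\<exists>E :: 'a::chilbert_space set. is_onb E"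
proof -
  have "compact_op (\<lambda>x::'a. 0)" unfolding compact_op_def by (rule exI[of _ "{0}"]) simp
  from compact_selfadjoint_eigenbasis[OF selfadjoint_op_zero this] show ?thesis by metis
qed

subsection \<open>Gram--Schmidt and finite-rank spectral decompositions\<close>

text \<open>Phrased as a reproducing formula on the span, since its uses need the coefficients
  \<open>cinner g x\<close> explicitly: once to bound them, once to count dimensions.\<close>

lemma Gram_Schmidt:
  fixes F :: "'a::complex_inner set"
  assumes "finite F"
  shows "\<exists>G. finite G \<and> orthonormal G \<and> (\<forall>x\<in>cspan F. x = (\<Sum>g\<in>G. scaleC (cinner g x) g))"
proof -
  have "\<exists>G. finite G \<and> orthonormal G \<and> (\<forall>x\<in>F. x = (\<Sum>g\<in>G. scaleC (cinner g x) g))"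
    using assms
  proof (induction F)
    case empty
    then show ?case by (auto simp: orthonormal_def intro!: exI[of _ "{}"])
  next
    case (insert a F)
    then obtain G where G: "finite G" "orthonormal G" "\<And>x. x \<in> F \<Longrightarrow> x = (\<Sum>g\<in>G. scaleC (cinner g x) g)" by auto
    define p where "p = (\<Sum>g\<in>G. scaleC (cinner g a) g)"
    show ?case
    \<comment> \<open>\<open>p\<close> is the projection of \<open>a\<close> onto the span of
      \<open>G\<close>; if it equals \<open>a\<close>, the new vector is dependent and
      \<open>G\<close> is kept.\<close>
    proof (cases "a = p")
      case True
      then show ?thesis using G by (auto simp: p_def intro!: exI[of _ G])
    next
      case False
      define u where "u = (1 / norm (a - p)) *\<^sub>R (a - p)"
      have uu: "cinner u u = 1" using False by (simp add: u_def cinner_self)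
      have gp: "cinner g (a - p) = 0" if "g \<in> G" for g
        using cinner_orthonormal_sum[OF G(2,1) subset_refl that, of "\<lambda>g. cinner g a"] that
        by (simp add: p_def cinner_diff_right)
      have gu: "cinner g u = 0" if "g \<in> G" for g using gp[OF that] by (simp add: u_def cinner_scaleR_right)
      have ug: "cinner u g = 0" if "g \<in> G" for g using gu[OF that] cinner_commute[of u g] by simp
      have "u \<notin> G" using gu uu by force
      have orth: "orthonormal (insert u G)" using G(2) uu gu ug by (auto simp: orthonormal_def)
      have up: "cinner u p = 0" by (simp add: p_def cinner_sum_right cinner_scaleC_right ug)
      have au: "a - p = scaleC (norm (a - p)) u" using False by (simp add: u_def flip: scaleR_scaleC)
      have "cinner u (a - p) = of_real (norm (a - p))"
        by (subst au) (simp add: cinner_scaleC_right uu)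
      then have "scaleC (cinner u a) u = a - p" using up au by (simp add: cinner_diff_right)
      then have "a = (\<Sum>g\<in>insert u G. scaleC (cinner g a) g)"
        using G(1) \<open>u \<notin> G\<close> by (simp flip: p_def)
      moreover have "x = (\<Sum>g\<in>insert u G. scaleC (cinner g x) g)" if "x \<in> F" for x
      proof -
        have "cinner u x = 0"
          by (subst G(3)[OF that]) (simp add: cinner_sum_right cinner_scaleC_right ug)
        then show ?thesis using G(1) \<open>u \<notin> G\<close> G(3)[OF that] by simp
      qed
      ultimately show ?thesis using G(1) orth by (intro exI[of _ "insert u G"]) auto
    qed
  qed
  then obtain G where G: "finite G" "orthonormal G" "\<And>x. x \<in> F \<Longrightarrow> x = (\<Sum>g\<in>G. scaleC (cinner g x) g)" by auto
  have "x = (\<Sum>g\<in>G. scaleC (cinner g x) g)" if xF: "x \<in> cspan F" for x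
  proof -
    obtain F' c where x: "F' \<subseteq> F" "x = (\<Sum>v\<in>F'. scaleC (c v) v)" using xF unfolding cspan_def by blast
    have "(\<Sum>g\<in>G. scaleC (cinner g x) g) = (\<Sum>g\<in>G. \<Sum>v\<in>F'. scaleC (c v) (scaleC (cinner g v) g))"
      by (simp add: x cinner_sum_right cinner_scaleC_right scaleC_sum_left scaleC_scaleC)
    also have "\<dots> = (\<Sum>v\<in>F'. scaleC (c v) (\<Sum>g\<in>G. scaleC (cinner g v) g))"
      unfolding scaleC_sum_right by (rule sum.swap)
    also have "\<dots> = (\<Sum>v\<in>F'. scaleC (c v) v)"
    proof (rule sum.cong)
      fix v assume "v \<in> F'"
      then have "v = (\<Sum>g\<in>G. scaleC (cinner g v) g)" using x by (intro G(3)) auto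
      then show "scaleC (c v) (\<Sum>g\<in>G. scaleC (cinner g v) g) = scaleC (c v) v" by simp
    qed simp
    finally show ?thesis using x by simp
  qed
  then show ?thesis using G by blast
qed

lemma finite_rank_eigenbasis:
  fixes A :: "'a::chilbert_space \<Rightarrow> 'a"
  assumes sa: "selfadjoint_op A" and fr: "finite_rank A"
  obtains E and l :: "'a \<Rightarrow> real" where "is_onb E" "\<And>e. e \<in> E \<Longrightarrow> A e = l e *\<^sub>R e" "finite {e\<in>E. l e \<noteq> 0}"
proof -
  obtain F where F: "finite F" "range A \<subseteq> cspan F" using fr by (auto simp: finite_rank_def)
  obtain G where G: "finite G" "orthonormal G" "\<And>x. x \<in> cspan F \<Longrightarrow> x = (\<Sum>g\<in>G. scaleC (cinner g x) g)"
    using Gram_Schmidt[OF F(1)] by blast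
  have AG: "A x = (\<Sum>g\<in>G. scaleC (cinner g (A x)) g)" for x using F G by blast
  obtain K where K: "K > 0" "\<And>x. norm (A x) \<le> K * norm x" using bounded_clinear_op_bound[OF selfadjoint_opD(1)[OF sa]] by metis
  \<comment> \<open>The bound \<open>K\<close> is moved into the vectors, so that the coefficients
    of \<open>A x\<close> land in the unit disc.\<close>
  define S where "S = {\<Sum>g\<in>G. scaleC (c g) (scaleC K g) | c. \<forall>g\<in>G. cmod (c g) \<le> 1}"
  have "A x \<in> S" if "norm x \<le> 1" for x
  proof -
    have "cmod (cinner g (A x) / of_real K) \<le> 1" if "g \<in> G" for g
    proof -
      have "cmod (cinner g (A x)) \<le> norm (A x)" using Cauchy_Schwarz[of g "A x"] orthonormal_norm[OF G(2) that] by simp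
      also have "\<dots> \<le> K" using K(2)[of x] \<open>norm x \<le> 1\<close> K(1) by (smt (verit) mult_left_le)
      finally show ?thesis using K(1) by (simp add: norm_divide)
    qed
    moreover have "A x = (\<Sum>g\<in>G. scaleC (cinner g (A x) / of_real K) (scaleC K g))"
      using K(1) AG[of x] by (simp add: scaleC_scaleC)
    ultimately show ?thesis unfolding S_def
      by (intro CollectI exI[of _ "\<lambda>g. cinner g (A x) / of_real K"] conjI ballI)
  qed
  moreover have "compact S" unfolding S_def by (rule compact_coefficient_sums[OF G(1)])
  ultimately have "compact_op A" unfolding compact_op_def by blast
  then obtain E and l :: "'a \<Rightarrow> real" where E: "is_onb E" "\<And>e. e \<in> E \<Longrightarrow> A e = l e *\<^sub>R e"
    using compact_selfadjoint_eigenbasis[OF sa] by blast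
  have "finite {e\<in>E. l e \<noteq> 0}"
  proof (rule ccontr)
    assume "infinite {e\<in>E. l e \<noteq> 0}"
    then obtain B where B: "finite B" "card B = Suc (card G)" "B \<subseteq> {e\<in>E. l e \<noteq> 0}"
      using infinite_arbitrarily_large by blast
    have orthB: "orthonormal B" using is_onb_orthonormal[OF E(1)] B by (auto simp: orthonormal_def)
    \<comment> \<open>Double counting: an eigenvector with nonzero eigenvalue lies in the range of
      \<open>A\<close>, hence has total weight 1 over \<open>G\<close>, while Bessel allows each
      \<open>g\<close> a total weight of at most 1 over \<open>B\<close>. So \<open>B\<close> cannot
      have more elements than \<open>G\<close>.\<close>
    have "(\<Sum>g\<in>G. (cmod (cinner e g))\<^sup>2) = 1" if "e \<in> B" for e
    proof -
      have le: "l e \<noteq> 0" "A e = l e *\<^sub>R e" using B that E by auto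
      have "e = (1 / l e) *\<^sub>R A e" using le by simp
      also have "\<dots> = (\<Sum>g\<in>G. scaleC (cinner g e) g)"
        by (subst AG) (use le in \<open>simp add: cinner_scaleC_right scaleC_scaleC scaleR_scaleC scaleC_sum_right\<close>)
      finally have "(norm e)\<^sup>2 = (\<Sum>g\<in>G. (cmod (cinner g e))\<^sup>2)"
        using norm_orthonormal_sum[OF G(2,1) subset_refl, of "\<lambda>g. cinner g e"] by simp
      moreover have "norm e = 1" using orthonormal_norm[OF orthB that] .
      moreover have "cmod (cinner g e) = cmod (cinner e g)" for g
        by (rule cmod_cinner_commute)
      ultimately show ?thesis by simp
    qed
    then have "real (card B) = (\<Sum>e\<in>B. \<Sum>g\<in>G. (cmod (cinner e g))\<^sup>2)" by simp
    also have "\<dots> = (\<Sum>g\<in>G. \<Sum>e\<in>B. (cmod (cinner e g))\<^sup>2)" by (rule sum.swap)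
    also have "\<dots> \<le> (\<Sum>g\<in>G. (norm g)\<^sup>2)"
      by (intro sum_mono Bessel_finite[OF orthB B(1) subset_refl])
    also have "\<dots> = card G" using orthonormal_norm[OF G(2)] by simp
    finally show False using B(2) by simp
  qed
  then show thesis using that E by blast
qed

subsection \<open>Square roots of positive operators\<close>

text \<open>
  The square root of a positive contraction \<open>1 - B\<close> is \<open>1 - Y\<close>, where \<open>Y\<close> is the strong limit of the
  increasing iteration \<open>Y\<^sub>n\<^sub>+\<^sub>1 = (B + Y\<^sub>n\<^sup>2) / 2\<close>. Its iterates and their increments are polynomials in
  \<open>B\<close> with nonnegative coefficients, hence positive.
\<close>

inductive_set nonneg_poly_ops :: "('a::complex_inner \<Rightarrow> 'a) \<Rightarrow> ('a \<Rightarrow> 'a) set" for B where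
  id: "(\<lambda>x. x) \<in> nonneg_poly_ops B"
| comp: "Y \<in> nonneg_poly_ops B \<Longrightarrow> (\<lambda>x. B (Y x)) \<in> nonneg_poly_ops B"
| add: "Y \<in> nonneg_poly_ops B \<Longrightarrow> Z \<in> nonneg_poly_ops B \<Longrightarrow> (\<lambda>x. Y x + Z x) \<in> nonneg_poly_ops B"
| scale: "Y \<in> nonneg_poly_ops B \<Longrightarrow> r \<ge> 0 \<Longrightarrow> (\<lambda>x. r *\<^sub>R Y x) \<in> nonneg_poly_ops B"

lemma nonneg_poly_ops_compose:
  assumes "Y \<in> nonneg_poly_ops B" "Z \<in> nonneg_poly_ops B"
  shows "(\<lambda>x. Y (Z x)) \<in> nonneg_poly_ops B"
  using assms(1)
proof induction
  case id
  then show ?case using assms(2) by simp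
qed (auto intro: nonneg_poly_ops.intros)

lemma nonneg_poly_ops_commute:
  assumes "Y \<in> nonneg_poly_ops B" "clinear C" "\<And>x. C (B x) = B (C x)"
  shows "C (Y x) = Y (C x)"
  using assms(1) by (induction arbitrary: x) (simp_all add: clinear_simps[OF assms(2)] assms(3))

lemma nonneg_poly_ops_positive:
  assumes B: "positive_op B" and "Y \<in> nonneg_poly_ops B"
  shows "positive_op Y"
proof -
  note saB = selfadjoint_opD(3)[OF positive_op_selfadjoint[OF B]]
  have com: "B (Z x) = Z (B x)" if "Z \<in> nonneg_poly_ops B" for Z x
    by (rule nonneg_poly_ops_commute[OF that positive_op_clinear[OF B]]) simp
  have "bounded_clinear_op Y"
    using assms(2)
    by induction (simp_all add: bounded_clinear_op_id bounded_clinear_op_compose[OF positive_op_bounded[OF B]]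
        bounded_clinear_op_add bounded_clinear_op_scaleR)
  moreover have "cinner (Y x) y = cinner x (Y y)" for x y
    using assms(2) by (induction arbitrary: x y) (simp_all add: cinner_simps saB com)
  ultimately have sa: "selfadjoint_op Y" by (simp add: selfadjoint_op_def)
  \<comment> \<open>The induction needs the claim for \<open>Y\<close> and for \<open>B\<close>
    after \<open>Y\<close> together: two factors of \<open>B\<close> are absorbed by evaluating the
    form of \<open>Y\<close> at \<open>B x\<close>, one factor is covered by the second
    conjunct.\<close>
  have "0 \<le> Re (cinner x (Y x)) \<and> 0 \<le> Re (cinner x (B (Y x)))" for x
    using assms(2)
  proof (induction arbitrary: x)
    case id
    then show ?case using positive_op_ge_0[OF B] by (simp add: Re_cinner_self)
  next
    case (comp Y)
    have "cinner x (B (B (Y x))) = cinner (B x) (Y (B x))" by (simp add: saB com comp.hyps)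
    then show ?case using comp.IH by simp
  next
    case (add Y Z)
    then show ?case by (simp add: cinner_simps clinear_simps[OF positive_op_clinear[OF B]])
  next
    case (scale Y r)
    then show ?case by (simp add: cinner_simps clinear_simps[OF positive_op_clinear[OF B]])
  qed
  then show ?thesis using sa selfadjoint_opD(4)[OF sa] by (simp add: positive_op_def selfadjoint_op_def)
qed

text \<open>With \<open>A = 1 - B\<close>, the equation \<open>(1 - Y)^2 = 1 - B\<close> reads
  \<open>Y = (B + Y^2) / 2\<close>, which is the fixed point equation of the iteration. The
  commutation clause is recorded because uniqueness of roots depends on it.\<close>

lemma contraction_sqrt:
  fixes A :: "'a::chilbert_space \<Rightarrow> 'a"
  assumes A: "positive_op A" and A1: "\<And>x. Re (cinner x (A x)) \<le> (norm x)\<^sup>2"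
  obtains S where "positive_op S" "\<And>x. S (S x) = A x"
    "\<And>C x. bounded_clinear_op C \<Longrightarrow> (\<And>y. C (A y) = A (C y)) \<Longrightarrow> C (S x) = S (C x)"
proof -
  define B where "B = (\<lambda>x. x - A x)"
  have saA: "selfadjoint_op A" by (rule positive_op_selfadjoint[OF A])
  have "selfadjoint_op B" unfolding B_def
    by (intro selfadjoint_op_diff saA positive_op_selfadjoint positive_op_id)
  then have B: "positive_op B"
    using A1 by (auto simp: positive_op_def selfadjoint_op_def B_def cinner_diff_right selfadjoint_opD(4)[OF saA] Re_cinner_self)
  note linB = clinear_simps[OF positive_op_clinear[OF B]]
  have nB: "norm (B x) \<le> norm x" for x
  proof (cases "B x = 0")
    case False
    have le: "Re (cinner y (B y)) \<le> (norm y)\<^sup>2" for y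
      using positive_op_ge_0[OF A, of y] by (simp add: B_def cinner_diff_right Re_cinner_self)
    have "((norm (B x))\<^sup>2)\<^sup>2 \<le> Re (cinner (B x) (B (B x))) * Re (cinner x (B x))"
      using positive_op_Cauchy_Schwarz[OF B, of "B x" x]
      by (simp only: cinner_self norm_of_real abs_power2 abs_norm_cancel)
    also have "\<dots> \<le> (norm (B x))\<^sup>2 * (norm x)\<^sup>2"
      by (intro mult_mono le positive_op_ge_0[OF B]) auto
    finally have "(norm (B x))\<^sup>2 * (norm (B x))\<^sup>2 \<le> (norm (B x))\<^sup>2 * (norm x)\<^sup>2"
      by (simp only: power2_eq_square[of "(norm (B x))\<^sup>2"])
    then have "(norm (B x))\<^sup>2 \<le> (norm x)\<^sup>2"
      by (rule mult_left_le_imp_le) (use False in simp)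
    then show ?thesis by simp
  qed simp
  define Y where "Y = rec_nat (\<lambda>x::'a. 0::'a) (\<lambda>n Z x. (1/2) *\<^sub>R (B x + Z (Z x)))"
  have Y0: "Y 0 = (\<lambda>x. 0)" and YS: "\<And>n. Y (Suc n) = (\<lambda>x. (1/2) *\<^sub>R (B x + Y n (Y n x)))"
    by (simp_all add: Y_def)
  have Bpoly: "B \<in> nonneg_poly_ops B" using nonneg_poly_ops.comp[OF nonneg_poly_ops.id, of B] by simp
  have zero: "(\<lambda>x. 0) \<in> nonneg_poly_ops B" using nonneg_poly_ops.scale[OF nonneg_poly_ops.id, of 0] by simp
  have Yp: "Y n \<in> nonneg_poly_ops B" for n
  proof (induction n)
    case (Suc n)
    show ?case unfolding YS
      by (rule nonneg_poly_ops.scale[OF nonneg_poly_ops.add[OF Bpoly nonneg_poly_ops_compose[OF Suc Suc]]]) simp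
  qed (simp add: Y0 zero)
  note linY = clinear_simps[OF positive_op_clinear[OF nonneg_poly_ops_positive[OF B Yp]]]
  have step: "(\<lambda>x. Y (Suc n) x - Y n x) \<in> nonneg_poly_ops B" for n
  proof (induction n)
    case 0
    show ?case using nonneg_poly_ops.scale[OF Bpoly, of "1/2"] by (simp add: YS Y0)
  next
    case (Suc n)
    let ?D = "\<lambda>x. Y (Suc n) x - Y n x"
    \<comment> \<open>A difference of squares, split as
      \<open>P P - Q Q = (P - Q) P + Q (P - Q)\<close> with \<open>P = Y (Suc n)\<close> and
      \<open>Q = Y n\<close>; every factor on the right is already known to be a nonnegative
      polynomial in \<open>B\<close>.\<close>
    have "(\<lambda>x. (1/2) *\<^sub>R (?D (Y (Suc n) x) + Y n (?D x))) \<in> nonneg_poly_ops B"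
      by (rule nonneg_poly_ops.scale[OF nonneg_poly_ops.add[OF nonneg_poly_ops_compose[OF Suc Yp] nonneg_poly_ops_compose[OF Yp Suc]]]) simp
    moreover have "(1/2) *\<^sub>R (?D (Y (Suc n) x) + Y n (?D x)) = Y (Suc (Suc n)) x - Y (Suc n) x" for x
    proof -
      have "Y (Suc (Suc n)) x - Y (Suc n) x = (1/2) *\<^sub>R (Y (Suc n) (Y (Suc n) x) - Y n (Y n x))"
      proof -
        define P where "P = Y (Suc n) (Y (Suc n) x)"
        have "Y (Suc (Suc n)) x = (1/2) *\<^sub>R (B x + P)" by (simp only: YS[of "Suc n"] P_def)
        moreover have "Y (Suc n) x = (1/2) *\<^sub>R (B x + Y n (Y n x))" by (simp only: YS[of n])
        ultimately show ?thesis unfolding P_def[symmetric] by (simp add: scaleR_diff_right scaleR_add_right)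
      qed
      also have "Y (Suc n) (Y (Suc n) x) - Y n (Y n x) = ?D (Y (Suc n) x) + Y n (?D x)"
        by (simp add: linY)
      finally show ?thesis by simp
    qed
    ultimately show ?case by simp
  qed
  have incr: "(\<lambda>x. Y (n + k) x - Y n x) \<in> nonneg_poly_ops B" for n k
  proof (induction k)
    case (Suc k)
    from nonneg_poly_ops.add[OF this step[of "n + k"]] show ?case by simp
  qed (simp add: zero)
  have nY: "norm (Y n x) \<le> norm x" for n x
  proof (induction n arbitrary: x)
    case (Suc n)
    have "norm (B x + Y n (Y n x)) \<le> norm x + norm x"
      using norm_triangle_ineq[of "B x" "Y n (Y n x)"] nB[of x] order_trans[OF Suc[of "Y n x"] Suc[of x]] by linarith
    then show ?case by (simp add: YS)
  qed (simp add: Y0)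
  \<comment> \<open>The increments are positive and bounded by 2. Hence the monotone bounded, and so
    convergent, numbers \<open>Re (cinner x (Y n x))\<close> force the vectors \<open>Y n x\<close>
    to be Cauchy.\<close>
  have sq: "(norm (Y (n + k) x - Y n x))\<^sup>2 \<le> 2 * (Re (cinner x (Y (n + k) x)) - Re (cinner x (Y n x)))" for n k x
  proof -
    have "norm (Y (n + k) x - Y n x) \<le> 2 * norm x" for x
      using norm_triangle_ineq4[of "Y (n + k) x" "Y n x"] nY[of "n + k" x] nY[of n x] by linarith
    from positive_op_norm_sq_le[OF nonneg_poly_ops_positive[OF B incr[of n k]] this]
    show ?thesis by (simp add: cinner_diff_right)
  qed
  have "convergent (\<lambda>n. Y n x)" for x
  proof -
    define a where "a = (\<lambda>n. Re (cinner x (Y n x)))"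
    have sq': "(norm (Y m x - Y n x))\<^sup>2 \<le> 2 * (a m - a n)" if "n \<le> m" for m n
      using sq[of n "m - n" x] that by (simp add: a_def)
    have "incseq a"
    proof (rule incseq_SucI)
      fix n show "a n \<le> a (Suc n)" using order_trans[OF zero_le_power2 sq'[of n "Suc n"]] by simp
    qed
    moreover have "a n \<le> norm x * norm x" for n
      using order_trans[OF complex_Re_le_cmod Cauchy_Schwarz, of x "Y n x"] mult_left_mono[OF nY[of n x], of "norm x"]
      by (simp add: a_def)
    ultimately have "convergent a"
      using incseq_convergent[of a "norm x * norm x"] convergentI by blast
    then have cau: "Cauchy a" by (rule convergent_Cauchy)
    have "Cauchy (\<lambda>n. Y n x)"
    proof (rule CauchyI)
      fix e :: real assume "e > 0"
      then obtain N where N: "\<And>m n. m \<ge> N \<Longrightarrow> n \<ge> N \<Longrightarrow> \<bar>a m - a n\<bar> < e\<^sup>2 / 2"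
        using CauchyD[OF cau, of "e\<^sup>2 / 2"] by auto
      have small: "norm (Y m x - Y n x) < e" if "N \<le> n" "n \<le> m" for m n
      proof -
        have "(norm (Y m x - Y n x))\<^sup>2 < e\<^sup>2"
        proof -
          have "\<bar>a m - a n\<bar> < e\<^sup>2 / 2" by (rule N) (use that in auto)
          with abs_ge_self have "a m - a n < e\<^sup>2 / 2" by (rule le_less_trans)
          then have "2 * (a m - a n) < e\<^sup>2" by simp
          with sq'[OF that(2)] show ?thesis by (rule le_less_trans)
        qed
        then show ?thesis using \<open>e > 0\<close> by (simp add: power2_less_imp_less)
      qed
      have "norm (Y m x - Y n x) < e" if "m \<ge> N" "n \<ge> N" for m n
        using small[of n m] small[of m n] that by (cases "n \<le> m") (auto simp: norm_minus_commute)
      then show "\<exists>M. \<forall>m\<ge>M. \<forall>n\<ge>M. norm (Y m x - Y n x) < e" by blast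
    qed
    then show ?thesis by (rule Cauchy_convergent)
  qed
  then obtain T where T: "\<And>x. (\<lambda>n. Y n x) \<longlonglongrightarrow> T x" unfolding convergent_def by metis
  have nT: "norm (T x) \<le> norm x" for x
    by (rule Lim_norm_ubound[OF _ T]) (auto simp: nY)
  have bT: "bounded_clinear_op T"
  proof (rule bounded_clinear_opI[where K=1])
    fix x y show "T (x + y) = T x + T y"
      using LIMSEQ_unique[OF T[of "x + y"]] tendsto_add[OF T[of x] T[of y]] by (simp add: linY)
  next
    fix c x show "T (scaleC c x) = scaleC c (T x)"
      using LIMSEQ_unique[OF T[of "scaleC c x"]] tendsto_scaleC[OF tendsto_const T[of x], of c] by (simp add: linY)
  qed (simp add: nT)
  note linT = clinear_simps[OF bounded_clinear_op_clinear[OF bT]]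
  have sesq: "(\<lambda>n. cinner x (Y n y)) \<longlonglongrightarrow> cinner x (T y)" for x y
    by (intro tendsto_cinner tendsto_const T)
  have "cinner (T x) y = cinner x (T y)" for x y
  proof -
    have "(\<lambda>n. cinner (Y n x) y) \<longlonglongrightarrow> cinner (T x) y" by (intro tendsto_cinner tendsto_const T)
    then show ?thesis
      using LIMSEQ_unique[OF sesq[of x y]]
      by (simp add: selfadjoint_opD(3)[OF positive_op_selfadjoint[OF nonneg_poly_ops_positive[OF B Yp]]])
  qed
  then have saT: "selfadjoint_op T" using bT by (simp add: selfadjoint_op_def)
  define S where "S = (\<lambda>x. x - T x)"
  have saS: "selfadjoint_op S" unfolding S_def
    by (intro selfadjoint_op_diff saT positive_op_selfadjoint positive_op_id)
  have "Re (cinner x (T x)) \<le> (norm x)\<^sup>2" for x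
    using order_trans[OF complex_Re_le_cmod Cauchy_Schwarz, of x "T x"] mult_left_mono[OF nT[of x], of "norm x"]
    by (simp add: power2_eq_square)
  then have "positive_op S"
    using saS selfadjoint_opD(4)[OF saS] by (auto simp: positive_op_def selfadjoint_op_def S_def cinner_diff_right Re_cinner_self)
  moreover have "S (S x) = A x" for x
  proof -
    \<comment> \<open>The iterates are contractions, so \<open>Y n (Y n x)\<close> may be compared
      with \<open>Y n (T x)\<close>, which converges by the definition of \<open>T\<close>.\<close>
    have "(\<lambda>n. Y n (Y n x)) \<longlonglongrightarrow> T (T x)"
    proof -
      have lim: "(\<lambda>n. norm (Y n x - T x)) \<longlonglongrightarrow> 0" using tendsto_norm_zero[OF LIM_zero[OF T[of x]]] .
      have "norm (Y n (Y n x) - Y n (T x)) \<le> norm (Y n x - T x)" for n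
        using nY[of n "Y n x - T x"] by (simp add: linY)
      then have "(\<lambda>n. Y n (Y n x) - Y n (T x)) \<longlonglongrightarrow> 0"
        by (intro Lim_null_comparison[OF always_eventually lim] allI)
      from tendsto_add[OF this T[of "T x"]] show ?thesis by simp
    qed
    then have "(\<lambda>n. Y (Suc n) x) \<longlonglongrightarrow> (1/2) *\<^sub>R (B x + T (T x))"
      unfolding YS by (intro tendsto_intros)
    then have "T x = (1/2) *\<^sub>R (B x + T (T x))" using LIMSEQ_unique[OF LIMSEQ_Suc[OF T[of x]]] by blast
    from arg_cong[OF this, of "\<lambda>v. 2 *\<^sub>R v"] have "2 *\<^sub>R T x = B x + T (T x)" by simp
    then have "T x + T x = x - A x + T (T x)" by (simp add: B_def scaleR_2)
    then show ?thesis by (simp add: S_def linT algebra_simps)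
  qed
  moreover have "C (S x) = S (C x)" if C: "bounded_clinear_op C" "\<And>y. C (A y) = A (C y)" for C x
  proof -
    note linC = clinear_simps[OF bounded_clinear_op_clinear[OF C(1)]]
    have "C (Y n x) = Y n (C x)" for n
      by (rule nonneg_poly_ops_commute[OF Yp bounded_clinear_op_clinear[OF C(1)]]) (simp add: B_def linC C(2))
    then have "(\<lambda>n. Y n (C x)) \<longlonglongrightarrow> C (T x)"
      using bounded_linear.tendsto[OF bounded_clinear_op_bounded_linear[OF C(1)] T[of x]] by simp
    then show ?thesis using LIMSEQ_unique[OF T[of "C x"]] by (simp add: S_def linC)
  qed
  ultimately show thesis using that by blast
qed

lemma positive_op_sqrt_exists:
  fixes A :: "'a::chilbert_space \<Rightarrow> 'a"
  assumes A: "positive_op A"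
  obtains S where "positive_op S" "\<And>x. S (S x) = A x"
    "\<And>C x. bounded_clinear_op C \<Longrightarrow> (\<And>y. C (A y) = A (C y)) \<Longrightarrow> C (S x) = S (C x)"
proof -
  obtain K where K: "K > 0" "\<And>x. norm (A x) \<le> K * norm x"
    using bounded_clinear_op_bound[OF positive_op_bounded[OF A]] by metis
  define A' where "A' = (\<lambda>x. (1/K) *\<^sub>R A x)"
  have posr: "positive_op (\<lambda>x. r *\<^sub>R Z x)" if "positive_op Z" "r \<ge> 0" for r Z
    using that by (auto simp: positive_op_def bounded_clinear_op_scaleR cinner_scaleR_right)
  have "Re (cinner x (A' x)) \<le> (norm x)\<^sup>2" for x
  proof -
    have "Re (cinner x (A x)) \<le> norm x * norm (A x)"
      by (rule order_trans[OF complex_Re_le_cmod Cauchy_Schwarz])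
    also have "\<dots> \<le> norm x * (K * norm x)" by (intro mult_left_mono K) simp
    finally show ?thesis using K(1) by (simp add: A'_def cinner_scaleR_right field_simps power2_eq_square)
  qed
  moreover have "positive_op A'" unfolding A'_def by (rule posr[OF A]) (use K in simp)
  ultimately obtain S where S: "positive_op S" "\<And>x. S (S x) = A' x"
      "\<And>C x. bounded_clinear_op C \<Longrightarrow> (\<And>y. C (A' y) = A' (C y)) \<Longrightarrow> C (S x) = S (C x)"
    using contraction_sqrt by blast
  note linS = clinear_simps[OF positive_op_clinear[OF S(1)]]
  show thesis
  proof (rule that[of "\<lambda>x. sqrt K *\<^sub>R S x"])
    show "positive_op (\<lambda>x. sqrt K *\<^sub>R S x)" by (rule posr[OF S(1)]) (use K in simp)
    show "sqrt K *\<^sub>R S (sqrt K *\<^sub>R S x) = A x" for x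
      using K(1) by (simp add: linS S(2) A'_def)
    fix C x assume C: "bounded_clinear_op C" "\<And>y. C (A y) = A (C y)"
    note linC = clinear_simps[OF bounded_clinear_op_clinear[OF C(1)]]
    have "C (S x) = S (C x)" by (rule S(3)[OF C(1)]) (simp add: A'_def linC C(2))
    then show "C (sqrt K *\<^sub>R S x) = sqrt K *\<^sub>R S (C x)" by (simp add: linC)
  qed
qed

text \<open>Two arbitrary roots are not known to commute with each other, so each is compared with
  the constructed root \<open>S\<close>. Any root \<open>Z\<close> commutes with its square
  \<open>A\<close>, hence with \<open>S\<close>.\<close>

lemma positive_op_sqrt_unique:
  fixes A :: "'a::chilbert_space \<Rightarrow> 'a"
  assumes "positive_op B" "\<And>x. B (B x) = A x" "positive_op C" "\<And>x. C (C x) = A x"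
  shows "B = C"
proof -
  have "positive_op A"
  proof -
    have "bounded_clinear_op (\<lambda>x. B (B x))" by (rule bounded_clinear_op_compose[OF positive_op_bounded positive_op_bounded, OF assms(1,1)])
    then have "bounded_clinear_op A" by (simp add: assms)
    moreover have "cinner x (A x) = cinner (B x) (B x)" for x
      by (simp add: selfadjoint_opD(3)[OF positive_op_selfadjoint[OF assms(1)]] assms(2))
    ultimately show ?thesis by (simp add: positive_op_def Re_cinner_self)
  qed
  then obtain S where S: "positive_op S" "\<And>x. S (S x) = A x"
      "\<And>C x. bounded_clinear_op C \<Longrightarrow> (\<And>y. C (A y) = A (C y)) \<Longrightarrow> C (S x) = S (C x)"
    using positive_op_sqrt_exists by blast
  note linS = clinear_simps[OF positive_op_clinear[OF S(1)]]
  have "Z = S" if Z: "positive_op Z" "\<And>x. Z (Z x) = A x" for Z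
  proof
    fix x
    note linZ = clinear_simps[OF positive_op_clinear[OF Z(1)]]
    have com: "Z (S y) = S (Z y)" for y
      by (rule S(3)[OF positive_op_bounded[OF Z(1)]]) (simp flip: Z(2))
    \<comment> \<open>By commutation \<open>(Z + S) (Z - S) = 0\<close>. The forms of
      \<open>Z\<close> and \<open>S\<close> at \<open>y\<close> are nonnegative with sum 0, so
      \<open>Z\<close> and \<open>S\<close> both annihilate \<open>y\<close>, and \<open>y\<close>
      is orthogonal to itself.\<close>
    define y where "y = Z x - S x"
    have "Z y + S y = 0" by (simp add: y_def linZ linS Z(2) S(2) com)
    then have "Re (cinner y (Z y)) + Re (cinner y (S y)) = 0"
      by (metis cinner_add_right cinner_zero_right plus_complex.sel(1) zero_complex.sel(1))
    then have "Re (cinner y (Z y)) = 0" "Re (cinner y (S y)) = 0"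
      using positive_op_ge_0[OF Z(1), of y] positive_op_ge_0[OF S(1), of y] by linarith+
    then have "Z y = 0" "S y = 0" using positive_op_eq_0 Z(1) S(1) by blast+
    then have "cinner y (Z x) = 0" "cinner y (S x) = 0"
      using selfadjoint_opD(3)[OF positive_op_selfadjoint[OF Z(1)], of y x]
        selfadjoint_opD(3)[OF positive_op_selfadjoint[OF S(1)], of y x] by simp_all
    then have "cinner y (Z x - S x) = 0" by (simp add: cinner_diff_right)
    then have "cinner y y = 0" by (simp only: y_def)
    then show "Z x = S x" by (simp add: cinner_eq_zero_iff y_def)
  qed
  then show ?thesis using assms by blast
qed

lemma pos_sqrt_eqI:
  fixes A :: "'a::chilbert_space \<Rightarrow> 'a"
  assumes "positive_op B" "\<And>x. B (B x) = A x"
  shows "pos_sqrt A = B"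
  unfolding pos_sqrt_def by (rule the_equality) (use assms positive_op_sqrt_unique in blast)+

section \<open>Adjoints and absolute values\<close>

lemma cadjoint_eqI:
  assumes "\<And>x y. cinner (V x) y = cinner x (U y)"
  shows "cadjoint U = V"
  unfolding cadjoint_def
proof (rule the_equality)
  fix W assume "\<forall>x y. cinner (W x) y = cinner x (U y)"
  then have "cinner z (W x) = cinner z (V x)" for x z
    using assms[of x z] by (metis cinner_commute)
  then show "W = V" using cinner_ext by blast
qed (use assms in blast)

lemma antiadjoint_eqI:
  assumes "\<And>x y. cinner (V x) y = cnj (cinner x (U y))"
  shows "antiadjoint U = V"
  unfolding antiadjoint_def
proof (rule the_equality)
  fix W assume "\<forall>x y. cinner (W x) y = cnj (cinner x (U y))"
  then have "cinner z (W x) = cinner z (V x)" for x z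
    using assms[of x z] by (metis cinner_commute)
  then show "W = V" using cinner_ext by blast
qed (use assms in blast)

lemma cadjoint_selfadjoint: "selfadjoint_op A \<Longrightarrow> cadjoint A = A"
  by (rule cadjoint_eqI) (rule selfadjoint_opD)

lemma abs_op_selfadjoint:
  fixes A :: "'a::chilbert_space \<Rightarrow> 'a"
  assumes "selfadjoint_op A"
  shows "positive_op (abs_op A)" "abs_op A (abs_op A x) = A (A x)"
proof -
  have "bounded_clinear_op (\<lambda>x. A (A x))" by (rule bounded_clinear_op_compose[OF selfadjoint_opD(1) selfadjoint_opD(1), OF assms assms])
  moreover have "cinner x (A (A x)) = cinner (A x) (A x)" for x
    by (rule selfadjoint_opD(3)[OF assms, symmetric])
  ultimately have "positive_op (A \<circ> A)"
    by (simp add: positive_op_def Re_cinner_self o_def)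
  then obtain S where S: "positive_op S" "\<And>x. S (S x) = (A \<circ> A) x"
    by (rule positive_op_sqrt_exists) blast
  have "abs_op A = S"
    unfolding abs_op_def cadjoint_selfadjoint[OF assms] by (rule pos_sqrt_eqI) (fact S)+
  then show "positive_op (abs_op A)" "abs_op A (abs_op A x) = A (A x)"
    using S(1) S(2)[of x] by simp_all
qed

text \<open>\<open>z = |A| e - |l| e\<close> is mapped by \<open>|A|\<close> to
  \<open>- |l| z\<close>, which positivity permits only for \<open>z = 0\<close> if \<open>l\<close>
  is nonzero. For \<open>l = 0\<close> the sign carries no information, and the norm of
  \<open>|A| e\<close> is computed directly.\<close>

lemma abs_op_eigenvector:
  fixes A :: "'a::chilbert_space \<Rightarrow> 'a" and l :: real
  assumes sa: "selfadjoint_op A" and e: "A e = l *\<^sub>R e"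
  shows "abs_op A e = \<bar>l\<bar> *\<^sub>R e"
proof -
  note T = abs_op_selfadjoint[OF sa]
  note linT = clinear_simps[OF positive_op_clinear[OF T(1)]]
  have TT: "abs_op A (abs_op A e) = (l^2) *\<^sub>R e"
    using T(2)[of e] e by (simp add: clinear_simps[OF selfadjoint_opD(2)[OF sa]] power2_eq_square)
  define z where "z = abs_op A e - \<bar>l\<bar> *\<^sub>R e"
  have "abs_op A z = - \<bar>l\<bar> *\<^sub>R z"
    by (simp add: z_def linT TT scaleR_diff_right power2_eq_square flip: abs_mult)
  then have zz: "Re (cinner z (abs_op A z)) = - \<bar>l\<bar> * (norm z)\<^sup>2"
    by (simp add: cinner_scaleR_right cinner_minus_right Re_cinner_self)
  have "z = 0"
  proof (cases "l = 0")
    case True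
    have "(norm (abs_op A e))\<^sup>2 = Re (cinner e (abs_op A (abs_op A e)))"
      by (simp flip: selfadjoint_opD(3)[OF positive_op_selfadjoint[OF T(1)]] Re_cinner_self)
    then show ?thesis using True TT by (simp add: z_def)
  next
    case False
    have "0 \<le> - \<bar>l\<bar> * (norm z)\<^sup>2" using positive_op_ge_0[OF T(1), of z] zz by simp
    then show ?thesis using False by (simp add: mult_le_0_iff)
  qed
  then show ?thesis by (simp add: z_def)
qed

subsection \<open>Rank-one operators and their sums\<close>

lemma cspan_add:
  assumes "x \<in> cspan S" "y \<in> cspan S"
  shows "x + y \<in> cspan S"
proof -
  obtain F c G d where F: "finite F" "F \<subseteq> S" "x = (\<Sum>v\<in>F. scaleC (c v) v)"
      and G: "finite G" "G \<subseteq> S" "y = (\<Sum>v\<in>G. scaleC (d v) v)"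
    using assms unfolding cspan_def by blast
  let ?c = "\<lambda>v. if v \<in> F then c v else 0" and ?d = "\<lambda>v. if v \<in> G then d v else 0"
  have "x = (\<Sum>v\<in>F \<union> G. scaleC (?c v) v)"
    unfolding F(3) by (rule sum.mono_neutral_cong_left) (use F G in auto)
  moreover have "y = (\<Sum>v\<in>F \<union> G. scaleC (?d v) v)"
    unfolding G(3) by (rule sum.mono_neutral_cong_left) (use F G in auto)
  ultimately have "x + y = (\<Sum>v\<in>F \<union> G. scaleC (?c v + ?d v) v)"
    by (simp only: scaleC_add_left sum.distrib)
  then show ?thesis
    unfolding cspan_def using F(1,2) G(1,2)
    by (intro CollectI exI[of _ "F \<union> G"] exI[of _ "\<lambda>v. ?c v + ?d v"]) simp
qed

lemma cspan_scaleC: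
  assumes "x \<in> cspan S"
  shows "scaleC a x \<in> cspan S"
proof -
  obtain F c where F: "finite F" "F \<subseteq> S" "x = (\<Sum>v\<in>F. scaleC (c v) v)"
    using assms unfolding cspan_def by blast
  have "scaleC a x = (\<Sum>v\<in>F. scaleC (a * c v) v)"
    by (simp add: F(3) scaleC_sum_right scaleC_scaleC)
  then show ?thesis
    unfolding cspan_def using F(1,2) by (intro CollectI exI[of _ F] exI[of _ "\<lambda>v. a * c v"]) simp
qed

lemma cspan_mono: "S \<subseteq> T \<Longrightarrow> cspan S \<subseteq> cspan T"
  unfolding cspan_def by blast

section \<open>The real vector space of selfadjoint finite-rank operators\<close>

lemma finite_rank_sa_add:
  assumes "A \<in> finite_rank_sa" "B \<in> finite_rank_sa"
  shows "(\<lambda>x. A x + B x) \<in> finite_rank_sa"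
proof -
  obtain F G where F: "finite F" "range A \<subseteq> cspan F" and G: "finite G" "range B \<subseteq> cspan G"
    using assms by (auto simp: finite_rank_sa_def finite_rank_def)
  have "A x + B x \<in> cspan (F \<union> G)" for x
    using F(2) G(2) cspan_mono[of F "F \<union> G"] cspan_mono[of G "F \<union> G"] by (intro cspan_add) auto
  then show ?thesis
    using assms F(1) G(1)
    by (auto simp: finite_rank_sa_def finite_rank_def selfadjoint_op_add bounded_clinear_op_add intro!: exI[of _ "F \<union> G"])
qed

lemma finite_rank_sa_scaleR:
  assumes "A \<in> finite_rank_sa"
  shows "(\<lambda>x. r *\<^sub>R A x) \<in> finite_rank_sa"
proof -
  obtain F where F: "finite F" "range A \<subseteq> cspan F"
    using assms by (auto simp: finite_rank_sa_def finite_rank_def)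
  then have "r *\<^sub>R A x \<in> cspan F" for x
    unfolding scaleR_scaleC by (intro cspan_scaleC) auto
  then show ?thesis
    using assms F(1)
    by (auto simp: finite_rank_sa_def finite_rank_def selfadjoint_op_scaleR bounded_clinear_op_scaleR intro!: exI[of _ F])
qed

lemma finite_rank_sa_diff:
  "A \<in> finite_rank_sa \<Longrightarrow> B \<in> finite_rank_sa \<Longrightarrow> (\<lambda>x. A x - B x) \<in> finite_rank_sa"
  using finite_rank_sa_add[of A "\<lambda>x. (-1) *\<^sub>R B x"] finite_rank_sa_scaleR[of B "-1"] by simp

lemma finite_rank_sa_selfadjoint: "A \<in> finite_rank_sa \<Longrightarrow> selfadjoint_op A"
  by (simp add: finite_rank_sa_def)

lemma finite_rank_sa_zero: "(\<lambda>x. 0) \<in> finite_rank_sa"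
  by (auto simp: finite_rank_sa_def finite_rank_def selfadjoint_op_zero selfadjoint_opD(1)[OF selfadjoint_op_zero]
      cspan_def intro!: exI[of _ "{}"])

definition outer :: "'a::complex_inner \<Rightarrow> 'a \<Rightarrow> 'a" where
  "outer x = (\<lambda>z. scaleC (cinner x z) x)"

lemma bounded_clinear_op_outer: "bounded_clinear_op (outer x)"
proof (rule bounded_clinear_opI[where K="norm x * norm x"])
  fix z show "norm (outer x z) \<le> norm x * norm x * norm z"
    using mult_right_mono[OF Cauchy_Schwarz[of x z], of "norm x"] by (simp add: outer_def norm_scaleC mult_ac)
qed (auto simp: outer_def cinner_simps scaleC_simps)

lemma cinner_outer: "cinner z (outer x w) = cinner x w * cinner z x"
  by (simp add: outer_def cinner_scaleC_right)

lemma cinner_outer_self: "cinner z (outer x z) = of_real ((cmod (cinner x z))\<^sup>2)"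
  using complex_norm_square[of "cinner x z"] cinner_commute[of z x] by (simp add: cinner_outer)

lemma positive_op_outer: "positive_op (outer x)"
  by (simp add: positive_op_def bounded_clinear_op_outer cinner_outer_self del: of_real_power)

lemma outer_finite_rank_sa: "outer x \<in> finite_rank_sa"
proof -
  have "range (outer x) \<subseteq> cspan {x}"
    unfolding outer_def cspan_def by (auto intro!: exI[of _ "{x}"])
  then show ?thesis
    by (auto simp: finite_rank_sa_def finite_rank_def positive_op_selfadjoint[OF positive_op_outer]
        bounded_clinear_op_outer intro!: exI[of _ "{x}"])
qed

lemma outer_scaleC: "outer (scaleC c x) = (\<lambda>z. ((cmod c)\<^sup>2) *\<^sub>R outer x z)"
  by (rule ext) (simp add: outer_def cinner_simps scaleC_simps scaleR_scaleC complex_norm_square mult_ac del: of_real_power)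

lemma outer_phase: "cmod c = 1 \<Longrightarrow> outer (scaleC c x) = outer x"
  by (simp add: outer_scaleC)

lemma finite_rank_sa_sum:
  assumes "finite F" "\<And>i. i \<in> F \<Longrightarrow> A i \<in> finite_rank_sa"
  shows "(\<lambda>x. \<Sum>i\<in>F. A i x) \<in> finite_rank_sa"
  using assms by (induction F) (auto simp: finite_rank_sa_zero intro: finite_rank_sa_add)

subsection \<open>Trace class operators\<close>

lemma has_sum_finite_sum:
  fixes f :: "'i \<Rightarrow> 'j \<Rightarrow> real"
  assumes "finite F" "\<And>g. g \<in> F \<Longrightarrow> (f g has_sum s g) A"
  shows "((\<lambda>e. \<Sum>g\<in>F. f g e) has_sum (\<Sum>g\<in>F. s g)) A"
  using assms by (induction F) (auto intro: has_sum_add)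

text \<open>A spectral certificate for membership in the trace class. Trace and trace norm can be
  read off from it, whichever basis \<open>SOME\<close> selects.\<close>

definition trace_diag :: "('a::complex_inner \<Rightarrow> 'a) \<Rightarrow> 'a set \<Rightarrow> ('a \<Rightarrow> real) \<Rightarrow> bool" where
  "trace_diag A G l \<longleftrightarrow> is_onb G \<and> (\<forall>e\<in>G. A e = l e *\<^sub>R e) \<and> (\<lambda>e. \<bar>l e\<bar>) summable_on G"

text \<open>Fubini for the family \<open>l g * |cinner g e|^2\<close>: summing over \<open>e\<close>
  gives \<open>l g\<close> by Parseval, summing over \<open>g\<close> gives the diagonal entry of
  \<open>A\<close> at \<open>e\<close>. Absolute summability of the eigenvalues justifies the
  exchange, and the value does not depend on \<open>E\<close>.\<close>

lemma trace_diag_has_sum: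
  fixes A :: "'a::chilbert_space \<Rightarrow> 'a"
  assumes sa: "selfadjoint_op A" and diag: "trace_diag A G l" and E: "is_onb E"
  shows "((\<lambda>e. Re (cinner e (A e))) has_sum infsum l G) E"
proof -
  have G: "is_onb G" "\<And>g. g \<in> G \<Longrightarrow> A g = l g *\<^sub>R g" "(\<lambda>g. \<bar>l g\<bar>) summable_on G"
    using diag by (auto simp: trace_diag_def)
  define f where "f = (\<lambda>(g, e). l g * (cmod (cinner g e))\<^sup>2)"
  have row: "((\<lambda>e. (cmod (cinner g e))\<^sup>2) has_sum 1) E" if "g \<in> G" for g
  proof -
    have "cmod (cinner e g) = cmod (cinner g e)" for e by (rule cmod_cinner_commute)
    then show ?thesis
      using onb_Parseval[OF E, of g] orthonormal_norm[OF is_onb_orthonormal[OF G(1)] that] by simp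
  qed
  have rowf: "((\<lambda>e. f (g, e)) has_sum l g) E" if "g \<in> G" for g
    using has_sum_cmult_right[OF row[OF that], of "l g"] by (simp add: f_def)
  have rowa: "((\<lambda>e. norm (f (g, e))) has_sum \<bar>l g\<bar>) E" if "g \<in> G" for g
    using has_sum_cmult_right[OF row[OF that], of "\<bar>l g\<bar>"] by (simp add: f_def abs_mult)
  have "(\<lambda>p. norm (f p)) summable_on (G \<times> E)"
    unfolding Infinite_Sum.abs_summable_on_Sigma_iff
  proof (intro conjI ballI)
    fix g assume "g \<in> G"
    then show "(\<lambda>e. norm (f (g, e))) summable_on E" using rowa has_sum_imp_summable by blast
  next
    have "(\<lambda>g. norm (\<Sum>\<^sub>\<infinity>e\<in>E. norm (f (g, e)))) summable_on G \<longleftrightarrow> (\<lambda>g. \<bar>l g\<bar>) summable_on G"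
      by (rule summable_on_cong) (simp only: infsumI[OF rowa], simp)
    then show "(\<lambda>g. norm (\<Sum>\<^sub>\<infinity>e\<in>E. norm (f (g, e)))) summable_on G" using G(3) by simp
  qed
  then obtain S where S: "(f has_sum S) (G \<times> E)"
    using abs_summable_summable summable_on_def by blast
  have "(l has_sum S) G" by (rule has_sum_SigmaD[OF S rowf])
  then have "infsum l G = S" by (rule infsumI)
  have "((\<lambda>(e, g). f (g, e)) has_sum S) (E \<times> G)" by (rule has_sum_swap[THEN iffD1, OF S])
  then have "((\<lambda>e. Re (cinner e (A e))) has_sum S) E"
    by (rule has_sum_SigmaD) (use selfadjoint_eigenvalue_expansion[OF G(1) sa G(2)] in \<open>simp add: f_def\<close>)
  then show ?thesis using \<open>infsum l G = S\<close> by simp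
qed

text \<open>Truncating the spectral expansion to finitely many eigenvectors only lowers the diagonal
  entries along \<open>E\<close>, so every finite sum of eigenvalues is at most the diagonal sum
  along \<open>E\<close>.\<close>

lemma positive_eigenvalues_summable:
  fixes T :: "'a::chilbert_space \<Rightarrow> 'a"
  assumes T: "positive_op T" and E: "is_onb E" "(\<lambda>e. Re (cinner e (T e))) summable_on E"
    and G: "is_onb G" "\<And>g. g \<in> G \<Longrightarrow> T g = m g *\<^sub>R g"
  shows "m summable_on G"
proof -
  note sa = positive_op_selfadjoint[OF T]
  have m0: "m g \<ge> 0" if "g \<in> G" for g
  proof -
    have "Re (cinner g (T g)) = m g"
      using G(2)[OF that] orthonormal_cinner[OF is_onb_orthonormal[OF G(1)] that that] by (simp add: cinner_scaleR_right)
    then show ?thesis using positive_op_ge_0[OF T, of g] by simp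
  qed
  have "sum m F \<le> infsum (\<lambda>e. Re (cinner e (T e))) E" if F: "finite F" "F \<subseteq> G" for F
  proof -
    have "((\<lambda>e. \<Sum>g\<in>F. m g * (cmod (cinner g e))\<^sup>2) has_sum (\<Sum>g\<in>F. m g)) E"
    proof (rule has_sum_finite_sum[OF F(1)])
      fix g assume g: "g \<in> F"
      have "cmod (cinner e g) = cmod (cinner g e)" for e by (rule cmod_cinner_commute)
      then have "((\<lambda>e. (cmod (cinner g e))\<^sup>2) has_sum 1) E"
        using onb_Parseval[OF E(1), of g] orthonormal_norm[OF is_onb_orthonormal[OF G(1)], of g] g F by auto
      from has_sum_cmult_right[OF this, of "m g"]
      show "((\<lambda>e. m g * (cmod (cinner g e))\<^sup>2) has_sum m g) E" by simp
    qed
    moreover have "(\<Sum>g\<in>F. m g * (cmod (cinner g e))\<^sup>2) \<le> Re (cinner e (T e))" for e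
      by (rule finite_sum_le_has_sum[OF selfadjoint_eigenvalue_expansion[OF G(1) sa G(2)] F]) (auto simp: m0)
    ultimately show ?thesis using has_sum_mono[OF _ has_sum_infsum[OF E(2)]] by blast
  qed
  then show ?thesis
    by (intro nonneg_bounded_partial_sums_imp_summable_on eventually_finite_subsets_at_top_weakI) (auto simp: m0)
qed

text \<open>The definition mentions one basis and no eigenvectors. Summability for
  \<open>abs_op A\<close> makes \<open>A\<close> Hilbert-Schmidt, hence compact, hence
  diagonalisable; the absolute eigenvalues are eigenvalues of \<open>abs_op A\<close> and thus
  summable.\<close>

lemma trace_class_diag:
  fixes A :: "'a::chilbert_space \<Rightarrow> 'a"
  assumes A: "A \<in> trace_class_sa"
  obtains G l where "trace_diag A G l" "compact_op A"
proof -
  have sa: "selfadjoint_op A" using A by (simp add: trace_class_sa_def)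
  note T = abs_op_selfadjoint[OF sa]
  obtain E where E: "is_onb E" "(\<lambda>e. Re (cinner e (abs_op A e))) summable_on E"
    using A by (auto simp: trace_class_sa_def trace_class_def)
  obtain K where K: "K > 0" "\<And>x. norm (abs_op A x) \<le> K * norm x"
    using bounded_clinear_op_bound[OF positive_op_bounded[OF T(1)]] by metis
  \<comment> \<open>\<open>A e\<close> and \<open>abs_op A e\<close> have equal norms, and for the
    positive operator the squared norm is at most \<open>K\<close> times the diagonal entry.\<close>
  have "(\<lambda>e. (norm (A e))\<^sup>2) summable_on E"
  proof (rule summable_on_comparison_test)
    show "(\<lambda>e. K * Re (cinner e (abs_op A e))) summable_on E" by (rule summable_on_cmult_right[OF E(2)])
    fix e
    have "cinner (A e) (A e) = cinner (abs_op A e) (abs_op A e)"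
      by (simp add: selfadjoint_opD(3)[OF sa] selfadjoint_opD(3)[OF positive_op_selfadjoint[OF T(1)]] T(2))
    then have "(norm (A e))\<^sup>2 = (norm (abs_op A e))\<^sup>2" by (simp flip: Re_cinner_self)
    also have "\<dots> \<le> K * Re (cinner e (abs_op A e))"
      using positive_op_norm_sq_le[OF T(1) K(2)] K(1) by simp
    finally show "(norm (A e))\<^sup>2 \<le> K * Re (cinner e (abs_op A e))" .
  qed simp
  then have cp: "compact_op A" by (rule Hilbert_Schmidt_compact[OF E(1) selfadjoint_opD(1)[OF sa]])
  then obtain G and l :: "'a \<Rightarrow> real" where G: "is_onb G" "\<And>g. g \<in> G \<Longrightarrow> A g = l g *\<^sub>R g"
    using compact_selfadjoint_eigenbasis[OF sa] by blast
  have "(\<lambda>g. \<bar>l g\<bar>) summable_on G"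
    by (rule positive_eigenvalues_summable[OF T(1) E G(1)]) (rule abs_op_eigenvector[OF sa G(2)])
  then show thesis using G cp by (intro that[of G l]) (auto simp: trace_diag_def)
qed

lemma some_onb: "is_onb (SOME E :: 'a::chilbert_space set. is_onb E)"
  by (rule someI_ex[OF ex_onb])

lemma trace_diag_trace_class:
  fixes A :: "'a::chilbert_space \<Rightarrow> 'a"
  assumes sa: "selfadjoint_op A" and diag: "trace_diag A G l"
  shows "A \<in> trace_class_sa" "trace_norm A = (\<Sum>\<^sub>\<infinity>g\<in>G. \<bar>l g\<bar>)"
    "trace_op A = of_real (infsum l G)"
proof -
  have G: "is_onb G" "\<And>g. g \<in> G \<Longrightarrow> A g = l g *\<^sub>R g" "(\<lambda>g. \<bar>l g\<bar>) summable_on G"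
    using diag by (auto simp: trace_diag_def)
  note T = abs_op_selfadjoint[OF sa]
  have "trace_diag (abs_op A) G (\<lambda>g. \<bar>l g\<bar>)"
    using G abs_op_eigenvector[OF sa G(2)] by (simp add: trace_diag_def)
  note hs = trace_diag_has_sum[OF positive_op_selfadjoint[OF T(1)] this]
  show "A \<in> trace_class_sa"
    using sa G(1) has_sum_imp_summable[OF hs[OF G(1)]]
    by (auto simp: trace_class_sa_def trace_class_def selfadjoint_opD(1))
  show "trace_norm A = (\<Sum>\<^sub>\<infinity>g\<in>G. \<bar>l g\<bar>)"
    unfolding trace_norm_def by (rule infsumI[OF hs[OF some_onb]])
  have "(\<lambda>e. cinner e (A e)) = (\<lambda>e. of_real (Re (cinner e (A e))))"
    by (rule ext) (simp add: complex_eq_iff selfadjoint_opD(4)[OF sa])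
  then show "trace_op A = of_real (infsum l G)"
    unfolding trace_op_def using infsumI[OF has_sum_of_real[OF trace_diag_has_sum[OF sa diag some_onb]]]
    by simp
qed

lemma trace_class_sa_selfadjoint: "A \<in> trace_class_sa \<Longrightarrow> selfadjoint_op A"
  by (simp add: trace_class_sa_def)

lemma trace_class_has_sum:
  fixes A :: "'a::chilbert_space \<Rightarrow> 'a"
  assumes A: "A \<in> trace_class_sa" and E: "is_onb E"
  shows "((\<lambda>e. Re (cinner e (A e))) has_sum Re (trace_op A)) E"
proof -
  note sa = trace_class_sa_selfadjoint[OF A]
  obtain G l where G: "trace_diag A G l" using trace_class_diag[OF A] by blast
  show ?thesis
    using trace_diag_has_sum[OF sa G E] trace_diag_trace_class(3)[OF sa G] by simp
qed

lemma trace_op_real: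
  fixes A :: "'a::chilbert_space \<Rightarrow> 'a"
  assumes A: "A \<in> trace_class_sa"
  shows "Im (trace_op A) = 0"
proof -
  obtain G l where G: "trace_diag A G l" using trace_class_diag[OF A] by blast
  show ?thesis
    using trace_diag_trace_class(3)[OF trace_class_sa_selfadjoint[OF A] G] by simp
qed

text \<open>In an eigenbasis of the difference, the eigenvalues are differences of diagonal entries
  of \<open>A\<close> and \<open>B\<close>, and each of these two families is summable along every
  basis.\<close>

lemma trace_class_sa_diff:
  fixes A B :: "'a::chilbert_space \<Rightarrow> 'a"
  assumes A: "A \<in> trace_class_sa" and B: "B \<in> trace_class_sa"
  shows "(\<lambda>x. A x - B x) \<in> trace_class_sa"
proof -
  note sa = selfadjoint_op_diff[OF trace_class_sa_selfadjoint[OF A] trace_class_sa_selfadjoint[OF B]]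
  have "compact_op A" "compact_op B" using trace_class_diag A B by blast+
  from compact_op_diff[OF this] obtain G and l :: "'a \<Rightarrow> real"
    where G: "is_onb G" "\<And>g. g \<in> G \<Longrightarrow> A g - B g = l g *\<^sub>R g"
    using compact_selfadjoint_eigenbasis[OF sa] by blast
  have "l summable_on G \<longleftrightarrow> (\<lambda>g. Re (cinner g (A g)) - Re (cinner g (B g))) summable_on G"
  proof (rule summable_on_cong)
    fix g assume g: "g \<in> G"
    have "cinner g (A g) - cinner g (B g) = of_real (l g)"
      using arg_cong[OF G(2)[OF g], of "cinner g"] orthonormal_cinner[OF is_onb_orthonormal[OF G(1)] g g]
      by (simp add: cinner_diff_right cinner_scaleR_right)
    from arg_cong[OF this, of Re] show "l g = Re (cinner g (A g)) - Re (cinner g (B g))" by simp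
  qed
  moreover have "(\<lambda>g. Re (cinner g (A g)) - Re (cinner g (B g))) summable_on G"
    using summable_on_add[OF has_sum_imp_summable[OF trace_class_has_sum[OF A G(1)]]
        summable_on_uminus[THEN iffD2, OF has_sum_imp_summable[OF trace_class_has_sum[OF B G(1)]]]] by simp
  ultimately have "l summable_on G" by blast
  \<comment> \<open>For real families, unconditional and absolute summability coincide.\<close>
  then have "(\<lambda>g. \<bar>l g\<bar>) summable_on G"
    by (simp only: summable_on_iff_abs_summable_on_real[of l] real_norm_def)
  then have "trace_diag (\<lambda>x. A x - B x) G l" using G by (simp add: trace_diag_def)
  then show ?thesis by (rule trace_diag_trace_class(1)[OF sa])
qed

text \<open>No eigenvalue exceeds the sum of all absolute eigenvalues; Parseval in the eigenbasis
  does the rest. This converts trace norm limits into pointwise limits.\<close>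

lemma norm_le_trace_norm:
  fixes A :: "'a::chilbert_space \<Rightarrow> 'a"
  assumes A: "A \<in> trace_class_sa"
  shows "norm (A x) \<le> trace_norm A * norm x"
proof -
  note sa = trace_class_sa_selfadjoint[OF A]
  obtain G l where diag: "trace_diag A G l" using trace_class_diag[OF A] by blast
  then have G: "is_onb G" "\<And>g. g \<in> G \<Longrightarrow> A g = l g *\<^sub>R g" "(\<lambda>g. \<bar>l g\<bar>) summable_on G"
    by (auto simp: trace_diag_def)
  define t where "t = trace_norm A"
  have t: "t = (\<Sum>\<^sub>\<infinity>g\<in>G. \<bar>l g\<bar>)" unfolding t_def by (rule trace_diag_trace_class(2)[OF sa diag])
  have le: "\<bar>l g\<bar> \<le> t" if "g \<in> G" for g
    using finite_sum_le_infsum[OF G(3), of "{g}"] that unfolding t by simp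
  have t0: "t \<ge> 0" unfolding t by (rule infsum_nonneg) simp
  have "(norm (A x))\<^sup>2 \<le> t\<^sup>2 * (norm x)\<^sup>2"
  proof (rule has_sum_mono[OF onb_Parseval[OF G(1)] has_sum_cmult_right[OF onb_Parseval[OF G(1)]]])
    fix g assume g: "g \<in> G"
    have "cinner g (A x) = of_real (l g) * cinner g x"
      by (simp flip: selfadjoint_opD(3)[OF sa] add: G(2)[OF g] cinner_scaleR_left)
    then have "(cmod (cinner g (A x)))\<^sup>2 = (l g)\<^sup>2 * (cmod (cinner g x))\<^sup>2"
      by (simp add: norm_mult power_mult_distrib)
    also have "\<dots> \<le> t\<^sup>2 * (cmod (cinner g x))\<^sup>2"
      using le[OF g] t0 by (intro mult_right_mono) (auto simp: abs_le_square_iff[symmetric])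
    finally show "(cmod (cinner g (A x)))\<^sup>2 \<le> t\<^sup>2 * (cmod (cinner g x))\<^sup>2" .
  qed
  then have "(norm (A x))\<^sup>2 \<le> (t * norm x)\<^sup>2" by (simp add: power_mult_distrib)
  then show ?thesis unfolding t_def[symmetric] by (rule power2_le_imp_le) (simp add: t0)
qed

lemma finite_rank_sa_diag:
  fixes A :: "'a::chilbert_space \<Rightarrow> 'a"
  assumes A: "A \<in> finite_rank_sa"
  obtains E l where "trace_diag A E l" "finite {e\<in>E. l e \<noteq> 0}"
proof -
  have "selfadjoint_op A" "finite_rank A" using A by (simp_all add: finite_rank_sa_def)
  then show thesis
  proof (rule finite_rank_eigenbasis)
    fix E and l :: "'a \<Rightarrow> real"
    assume E: "is_onb E" "\<And>e. e \<in> E \<Longrightarrow> A e = l e *\<^sub>R e" "finite {e\<in>E. l e \<noteq> 0}"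
    from E(3) have "(\<lambda>e. \<bar>l e\<bar>) summable_on E"
      by (intro finite_nonzero_values_imp_summable_on) simp
    then have "trace_diag A E l" using E(1,2) by (simp add: trace_diag_def)
    then show thesis using E(3) by (rule that)
  qed
qed

lemma finite_rank_sa_trace_class:
  fixes A :: "'a::chilbert_space \<Rightarrow> 'a"
  assumes "A \<in> finite_rank_sa"
  shows "A \<in> trace_class_sa"
  using finite_rank_sa_diag[OF assms] trace_diag_trace_class(1)[OF finite_rank_sa_selfadjoint[OF assms]] by metis

lemma diag_finite_sum:
  fixes A :: "'a::chilbert_space \<Rightarrow> 'a"
  assumes sa: "selfadjoint_op A" and E: "is_onb E" "\<And>e. e \<in> E \<Longrightarrow> A e = l e *\<^sub>R e"
    and F: "finite F" "F \<subseteq> E" "\<And>e. e \<in> E - F \<Longrightarrow> l e = 0"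
  shows "A = (\<lambda>x. \<Sum>g\<in>F. l g *\<^sub>R outer g x)"
proof (rule clinear_ext_onb[OF E(1) selfadjoint_opD(1)[OF sa]])
  show "bounded_clinear_op (\<lambda>x. \<Sum>g\<in>F. l g *\<^sub>R outer g x)"
    by (intro selfadjoint_opD finite_rank_sa_selfadjoint finite_rank_sa_sum finite_rank_sa_scaleR outer_finite_rank_sa F)
  fix e assume e: "e \<in> E"
  have "(\<Sum>g\<in>F. l g *\<^sub>R outer g e) = (\<Sum>g\<in>F. if g = e then l e *\<^sub>R e else 0)"
    by (rule sum.cong) (use e F orthonormal_cinner[OF is_onb_orthonormal[OF E(1)]] in \<open>auto simp: outer_def subset_iff\<close>)
  then show "A e = (\<Sum>g\<in>F. l g *\<^sub>R outer g e)" using e F E(2) by auto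
qed

lemma trace_op_add:
  fixes A B :: "'a::chilbert_space \<Rightarrow> 'a"
  assumes "A \<in> finite_rank_sa" "B \<in> finite_rank_sa"
  shows "trace_op (\<lambda>x. A x + B x) = trace_op A + trace_op B"
proof -
  note tc = finite_rank_sa_trace_class[OF assms(1)] finite_rank_sa_trace_class[OF assms(2)]
    finite_rank_sa_trace_class[OF finite_rank_sa_add[OF assms]]
  have "((\<lambda>e. Re (cinner e (A e)) + Re (cinner e (B e))) has_sum Re (trace_op A) + Re (trace_op B)) (SOME E. is_onb E)"
    by (intro has_sum_add trace_class_has_sum tc some_onb)
  then have "Re (trace_op (\<lambda>x. A x + B x)) = Re (trace_op A) + Re (trace_op B)"
    using has_sum_unique[OF trace_class_has_sum[OF tc(3) some_onb]] by (simp add: cinner_add_right)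
  then show ?thesis by (simp add: complex_eq_iff trace_op_real tc)
qed

lemma trace_op_scaleR:
  fixes A :: "'a::chilbert_space \<Rightarrow> 'a"
  assumes "A \<in> finite_rank_sa"
  shows "trace_op (\<lambda>x. r *\<^sub>R A x) = of_real r * trace_op A"
proof -
  note tc = finite_rank_sa_trace_class[OF assms] finite_rank_sa_trace_class[OF finite_rank_sa_scaleR[OF assms, of r]]
  have "((\<lambda>e. r * Re (cinner e (A e))) has_sum r * Re (trace_op A)) (SOME E. is_onb E)"
    by (intro has_sum_cmult_right trace_class_has_sum tc some_onb)
  then have "Re (trace_op (\<lambda>x. r *\<^sub>R A x)) = r * Re (trace_op A)"
    using has_sum_unique[OF trace_class_has_sum[OF tc(2) some_onb]] by (simp add: cinner_scaleR_right)
  then show ?thesis by (simp add: complex_eq_iff trace_op_real tc)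
qed

lemma trace_op_outer:
  fixes x :: "'a::chilbert_space"
  shows "trace_op (outer x) = of_real ((norm x)\<^sup>2)"
  unfolding trace_op_def cinner_outer_self cmod_cinner_commute[of x]
  by (rule infsumI[OF has_sum_of_real[OF onb_Parseval[OF some_onb]]])

section \<open>Finite-rank states and density of the finite-rank operators\<close>

lemma finite_rank_density_iff:
  fixes A :: "'a::chilbert_space \<Rightarrow> 'a"
  shows "A \<in> finite_rank_sa \<inter> density_ops \<longleftrightarrow> A \<in> finite_rank_sa \<and> positive_op A \<and> trace_op A = 1"
  using finite_rank_sa_trace_class[of A] by (auto simp: density_ops_def trace_class_sa_def)

lemma outer_density:
  fixes x :: "'a::chilbert_space"
  shows "norm x = 1 \<Longrightarrow> outer x \<in> finite_rank_sa \<inter> density_ops"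
  by (simp add: finite_rank_density_iff outer_finite_rank_sa positive_op_outer trace_op_outer del: Int_iff)

lemma positive_trace_nonneg:
  fixes A :: "'a::chilbert_space \<Rightarrow> 'a"
  assumes "A \<in> finite_rank_sa" "positive_op A"
  shows "Re (trace_op A) \<ge> 0" "Re (trace_op A) = 0 \<Longrightarrow> A = (\<lambda>x. 0)"
proof -
  obtain E :: "'a set" where E: "is_onb E" using ex_onb by blast
  note hs = trace_class_has_sum[OF finite_rank_sa_trace_class[OF assms(1)] E]
  show "Re (trace_op A) \<ge> 0"
    by (rule has_sum_nonneg[OF hs]) (rule positive_op_ge_0[OF assms(2)])
  assume "Re (trace_op A) = 0"
  then have "Re (cinner e (A e)) = 0" if "e \<in> E" for e
    using nonneg_has_sum_le_0D[OF hs _ positive_op_ge_0[OF assms(2)] that] by simp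
  then have "A e = 0" if "e \<in> E" for e using positive_op_eq_0[OF assms(2)] that by blast
  then show "A = (\<lambda>x. 0)"
    by (intro clinear_ext_onb[OF E positive_op_bounded[OF assms(2)] selfadjoint_opD(1)[OF selfadjoint_op_zero]])
qed

lemma finite_rank_sa_dense:
  fixes A :: "'a::chilbert_space \<Rightarrow> 'a"
  assumes A: "A \<in> trace_class_sa"
  shows "\<exists>X. (\<forall>n. X n \<in> finite_rank_sa) \<and> (\<lambda>n. trace_norm (\<lambda>x. X n x - A x)) \<longlonglongrightarrow> 0"
proof -
  note sa = trace_class_sa_selfadjoint[OF A]
  obtain G l where diag: "trace_diag A G l" using trace_class_diag[OF A] by blast
  then have G: "is_onb G" "\<And>g. g \<in> G \<Longrightarrow> A g = l g *\<^sub>R g" "(\<lambda>g. \<bar>l g\<bar>) summable_on G"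
    by (auto simp: trace_diag_def)
  define S where "S = (\<Sum>\<^sub>\<infinity>g\<in>G. \<bar>l g\<bar>)"
  have hS: "((\<lambda>g. \<bar>l g\<bar>) has_sum S) G" unfolding S_def using G(3) by simp
  define X where "X = (\<lambda>F x. \<Sum>g\<in>F. l g *\<^sub>R outer g x)"
  have XF: "X F \<in> finite_rank_sa" if "finite F" for F
    unfolding X_def by (intro finite_rank_sa_sum finite_rank_sa_scaleR outer_finite_rank_sa that)
  have tn: "trace_norm (\<lambda>x. X F x - A x) = S - (\<Sum>g\<in>F. \<bar>l g\<bar>)" if F: "finite F" "F \<subseteq> G" for F
  proof -
    \<comment> \<open>The error of the truncation is diagonal in the same basis: 0 on
      \<open>F\<close>, the negated eigenvalue elsewhere.\<close>
    let ?m = "\<lambda>g. if g \<in> F then 0 else - l g"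
    have "X F g - A g = ?m g *\<^sub>R g" if g: "g \<in> G" for g
    proof -
      have "X F g = (\<Sum>h\<in>F. if h = g then l g *\<^sub>R g else 0)"
        unfolding X_def
        by (rule sum.cong) (use g F orthonormal_cinner[OF is_onb_orthonormal[OF G(1)]] in \<open>auto simp: outer_def subset_iff\<close>)
      then show ?thesis using F G(2)[OF g] by auto
    qed
    moreover have "((\<lambda>g. \<bar>?m g\<bar>) has_sum (S - (\<Sum>g\<in>F. \<bar>l g\<bar>))) G"
    proof -
      have "((\<lambda>g. \<bar>l g\<bar>) has_sum (S - (\<Sum>g\<in>F. \<bar>l g\<bar>))) (G - F)"
        by (rule has_sum_Diff[OF hS]) (use F in auto)
      then show ?thesis by (rule has_sum_cong_neutral[THEN iffD1, rotated 3]) (use F in auto)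
    qed
    ultimately have "trace_diag (\<lambda>x. X F x - A x) G ?m"
      using G(1) has_sum_imp_summable by (auto simp: trace_diag_def)
    from trace_diag_trace_class(2)[OF selfadjoint_op_diff[OF finite_rank_sa_selfadjoint[OF XF[OF F(1)]] sa] this]
    show ?thesis using infsumI[OF \<open>((\<lambda>g. \<bar>?m g\<bar>) has_sum (S - (\<Sum>g\<in>F. \<bar>l g\<bar>))) G\<close>] by simp
  qed
  have "\<exists>F. finite F \<and> F \<subseteq> G \<and> dist (\<Sum>g\<in>F. \<bar>l g\<bar>) S \<le> 1 / real (Suc n)" for n
    using has_sum_finite_approximation[OF hS, of "1 / real (Suc n)"] by simp
  then obtain F where F: "\<And>n. finite (F n)" "\<And>n. F n \<subseteq> G" "\<And>n. dist (\<Sum>g\<in>F n. \<bar>l g\<bar>) S \<le> 1 / real (Suc n)"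
    by metis
  have "(\<lambda>n. S - (\<Sum>g\<in>F n. \<bar>l g\<bar>)) \<longlonglongrightarrow> 0"
  proof (rule Lim_null_comparison[OF always_eventually[OF allI] LIMSEQ_Suc[OF lim_1_over_n]])
    show "norm (S - (\<Sum>g\<in>F n. \<bar>l g\<bar>)) \<le> 1 / real (Suc n)" for n
      using F(3)[of n] by (simp add: dist_norm norm_minus_commute)
  qed
  then show ?thesis
    using XF[OF F(1)] tn[OF F(1) F(2)] by (intro exI[of _ "\<lambda>n. X (F n)"]) simp
qed

subsection \<open>Pure states and transition probabilities\<close>

lemma density_convex:
  fixes A B :: "'a::chilbert_space \<Rightarrow> 'a"
  assumes A: "A \<in> finite_rank_sa \<inter> density_ops" and B: "B \<in> finite_rank_sa \<inter> density_ops"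
    and t: "0 \<le> t" "t \<le> 1"
  shows "(\<lambda>x. t *\<^sub>R A x + (1 - t) *\<^sub>R B x) \<in> finite_rank_sa \<inter> density_ops"
proof -
  have A': "A \<in> finite_rank_sa" "positive_op A" "trace_op A = 1" using A finite_rank_density_iff by blast+
  have B': "B \<in> finite_rank_sa" "positive_op B" "trace_op B = 1" using B finite_rank_density_iff by blast+
  note mem = finite_rank_sa_scaleR[OF A'(1), of t] finite_rank_sa_scaleR[OF B'(1), of "1 - t"]
  have "trace_op (\<lambda>x. t *\<^sub>R A x + (1 - t) *\<^sub>R B x) = 1"
    by (simp add: trace_op_add[OF mem] trace_op_scaleR A' B')
  moreover have "positive_op (\<lambda>x. t *\<^sub>R A x + (1 - t) *\<^sub>R B x)"
    using A'(2) B'(2) t selfadjoint_opD(1)[OF finite_rank_sa_selfadjoint[OF finite_rank_sa_add[OF mem]]]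
    by (auto simp: positive_op_def cinner_simps)
  ultimately show ?thesis using finite_rank_density_iff finite_rank_sa_add[OF mem] by blast
qed

lemma outer_scaleR: "outer (r *\<^sub>R x) = (\<lambda>z. (r\<^sup>2) *\<^sub>R outer x z)"
  unfolding scaleR_scaleC[of r x] outer_scaleC by simp

text \<open>By Cauchy--Schwarz \<open>\<bar>\<langle>Dw, z\<rangle>\<bar>\<^sup>2 \<le> \<langle>w, Dw\<rangle> \<langle>z, Dz\<rangle>\<close>, so a multiple of the projection onto \<open>Dw\<close> lies below \<open>D\<close>.\<close>

lemma density_split:
  fixes D :: "'a::chilbert_space \<Rightarrow> 'a"
  assumes D: "D \<in> finite_rank_sa \<inter> density_ops"
  obtains y where "norm y = 1" "D = outer y"
  | y t R where "norm y = 1" "0 < t" "t < 1" "R \<in> finite_rank_sa \<inter> density_ops"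
    "D = (\<lambda>x. t *\<^sub>R outer y x + (1 - t) *\<^sub>R R x)"
proof -
  have D': "D \<in> finite_rank_sa" "positive_op D" "trace_op D = 1" using D finite_rank_density_iff by blast+
  have "\<exists>w. D w \<noteq> 0"
  proof (rule ccontr)
    assume "\<nexists>w. D w \<noteq> 0"
    then have "D = (\<lambda>z. 0 *\<^sub>R outer 0 z)" by auto
    then have "trace_op D = 0" using trace_op_scaleR[OF outer_finite_rank_sa[of "0::'a"], of 0] by simp
    then show False using D'(3) by simp
  qed
  then obtain w where w: "D w \<noteq> 0" by blast
  define d where "d = Re (cinner w (D w))"
  have d: "d > 0" using positive_op_ge_0[OF D'(2), of w] positive_op_eq_0[OF D'(2), of w] w by (auto simp: d_def less_le)
  define y where "y = (1 / norm (D w)) *\<^sub>R D w"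
  \<comment> \<open>Chosen so that \<open>t\<close> times the projection onto \<open>D w\<close> is
    \<open>outer (D w)\<close> divided by \<open>d\<close>, the piece that Cauchy-Schwarz places
    below \<open>D\<close>. Its trace is \<open>t\<close>, so the positive remainder
    \<open>R\<close> has trace \<open>1 - t\<close> and vanishes when \<open>t = 1\<close>.\<close>
  define t where "t = (norm (D w))\<^sup>2 / d"
  have y: "norm y = 1" using w by (simp add: y_def)
  have t: "t > 0" using w d by (simp add: t_def)
  define R where "R = (\<lambda>x. D x - t *\<^sub>R outer y x)"
  have ty: "t *\<^sub>R outer y x = (1 / d) *\<^sub>R outer (D w) x" for x
    unfolding y_def t_def outer_scaleR using w by (simp add: power_divide)
  have Rm: "R \<in> finite_rank_sa" unfolding R_def
    by (intro finite_rank_sa_diff finite_rank_sa_scaleR outer_finite_rank_sa D')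
  have "0 \<le> Re (cinner z (R z))" for z
  proof -
    have "(cmod (cinner (D w) z))\<^sup>2 \<le> Re (cinner z (D z)) * d"
      using positive_op_Cauchy_Schwarz[OF D'(2), of z w] by (simp add: d_def cmod_cinner_commute)
    then have "(1 / d) * (cmod (cinner (D w) z))\<^sup>2 \<le> Re (cinner z (D z))" using d by (simp add: field_simps)
    moreover have "cinner z (R z) = cinner z (D z) - of_real ((1 / d) * (cmod (cinner (D w) z))\<^sup>2)"
      by (simp only: R_def ty cinner_diff_right cinner_scaleR_right cinner_outer_self of_real_mult)
    ultimately show ?thesis by simp
  qed
  then have Rp: "positive_op R"
    using selfadjoint_opD(1,4)[OF finite_rank_sa_selfadjoint[OF Rm]] by (simp add: positive_op_def)
  have Dsum: "D = (\<lambda>x. R x + t *\<^sub>R outer y x)" by (simp add: R_def)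
  have "trace_op D = trace_op R + of_real t"
    by (subst Dsum) (simp add: trace_op_add Rm finite_rank_sa_scaleR outer_finite_rank_sa trace_op_scaleR trace_op_outer y)
  then have tr: "trace_op R = of_real (1 - t)" using D'(3) by (simp add: eq_diff_eq)
  show thesis
  proof (cases "t = 1")
    case True
    then have "R = (\<lambda>x. 0)" using positive_trace_nonneg(2)[OF Rm Rp] tr by simp
    then have "D = outer y" using Dsum True by simp
    then show thesis using that(1) y by blast
  next
    case False
    then have t1: "t < 1" using positive_trace_nonneg(1)[OF Rm Rp] tr by simp
    define R' where "R' = (\<lambda>x. (1 / (1 - t)) *\<^sub>R R x)"
    have "R' \<in> finite_rank_sa" unfolding R'_def by (rule finite_rank_sa_scaleR[OF Rm])
    moreover have "positive_op R'"
      using Rp t1 by (simp add: R'_def positive_op_def bounded_clinear_op_scaleR cinner_scaleR_right)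
    moreover have "trace_op R' = 1"
      unfolding R'_def trace_op_scaleR[OF Rm] tr using t1 by (simp flip: of_real_mult)
    ultimately have "R' \<in> finite_rank_sa \<inter> density_ops" using finite_rank_density_iff by blast
    moreover have "D = (\<lambda>x. t *\<^sub>R outer y x + (1 - t) *\<^sub>R R' x)"
      using t1 by (subst Dsum) (simp add: R'_def add.commute)
    ultimately show thesis using that(2) y t t1 by blast
  qed
qed

text \<open>On the complement of \<open>x\<close> the form of \<open>t A\<close> is squeezed between
  0 and that of \<open>outer x\<close>, which is 0; hence \<open>A\<close> vanishes there.
  Selfadjointness then makes \<open>A x\<close> a multiple of \<open>x\<close>, and the trace fixes
  the factor.\<close>

lemma outer_extreme:
  fixes A B :: "'a::chilbert_space \<Rightarrow> 'a"
  assumes x: "norm x = 1" and A: "A \<in> finite_rank_sa \<inter> density_ops" and B: "B \<in> finite_rank_sa \<inter> density_ops"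
    and t: "0 < t" "t < 1" and eq: "outer x = (\<lambda>z. t *\<^sub>R A z + (1 - t) *\<^sub>R B z)"
  shows "A = outer x"
proof -
  have A': "A \<in> finite_rank_sa" "positive_op A" "trace_op A = 1" using A finite_rank_density_iff by blast+
  have B': "positive_op B" using B finite_rank_density_iff by blast
  note sa = positive_op_selfadjoint[OF A'(2)]
  note lin = clinear_simps[OF positive_op_clinear[OF A'(2)]]
  have xx: "cinner x x = 1" using x by (simp add: cinner_self)
  have A0: "A z = 0" if z: "cinner x z = 0" for z
  proof -
    have "cinner z (outer x z) = 0" by (simp add: cinner_outer z)
    then have "t * Re (cinner z (A z)) + (1 - t) * Re (cinner z (B z)) = 0"
      by (simp add: eq cinner_simps complex_eq_iff)
    moreover have "0 \<le> t * Re (cinner z (A z))" "0 \<le> (1 - t) * Re (cinner z (B z))"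
      using t positive_op_ge_0[OF A'(2), of z] positive_op_ge_0[OF B', of z] by simp_all
    ultimately have "t * Re (cinner z (A z)) = 0" by linarith
    then show ?thesis using t positive_op_eq_0[OF A'(2)] by simp
  qed
  define a where "a = Re (cinner x (A x))"
  have ca: "cinner x (A x) = of_real a" by (simp add: a_def complex_eq_iff selfadjoint_opD(4)[OF sa])
  have "cinner u (A x - scaleC a x) = 0" for u
  proof -
    define v where "v = u - scaleC (cinner x u) x"
    have "cinner x v = 0" by (simp add: v_def cinner_simps xx)
    then have "cinner v (A x) = 0" "cinner v x = 0"
      using A0[of v] cinner_commute[of v x] by (simp_all flip: selfadjoint_opD(3)[OF sa])
    moreover have "cinner x (A x - scaleC a x) = 0" by (simp add: cinner_simps ca xx)
    moreover have "u = v + scaleC (cinner x u) x" by (simp add: v_def)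
    ultimately have "cinner v (A x - scaleC a x) = 0" "cinner (scaleC (cinner x u) x) (A x - scaleC a x) = 0"
      by (simp_all add: cinner_diff_right cinner_scaleC_right cinner_scaleC_left)
    then have "cinner (v + scaleC (cinner x u) x) (A x - scaleC a x) = 0" by (simp add: cinner_add_left)
    then show ?thesis by (simp add: v_def)
  qed
  then have "A x - scaleC a x = 0" using cinner_eq_zero_iff by blast
  then have Ax: "A x = scaleC a x" by simp
  have "A z = a *\<^sub>R outer x z" for z
  proof -
    have "A (z - scaleC (cinner x z) x) = 0" by (rule A0) (simp add: cinner_simps xx)
    then show ?thesis by (simp add: lin Ax outer_def scaleR_scaleC scaleC_scaleC mult.commute)
  qed
  then have Aa: "A = (\<lambda>z. a *\<^sub>R outer x z)" by blast
  then have "trace_op A = of_real a" using trace_op_scaleR[OF outer_finite_rank_sa, of a x] by (simp add: trace_op_outer x)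
  then have "a = 1" using A'(3) by simp
  then show ?thesis using Aa by simp
qed

lemma outer_eq_imp_parallel:
  fixes a b :: "'a::complex_inner"
  assumes "outer a = outer b"
  shows "\<exists>c. a = scaleC c b"
proof (cases "a = 0")
  case True
  then show ?thesis by (intro exI[of _ 0]) simp
next
  case False
  then have aa: "cinner a a \<noteq> 0" by (simp add: cinner_eq_zero_iff)
  have "scaleC (cinner a a) a = scaleC (cinner b a) b" using fun_cong[OF assms, of a] by (simp add: outer_def)
  then have "a = scaleC (cinner b a / cinner a a) b"
    using aa by (metis scaleC_cancel scaleC_scaleC nonzero_mult_div_cancel_left times_divide_eq_right)
  then show ?thesis by blast
qed

lemma outer_eq_norm:
  fixes a b :: "'a::chilbert_space"
  assumes "outer a = outer b"
  shows "norm a = norm b"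
  using arg_cong[OF assms, of trace_op] unfolding trace_op_outer of_real_eq_iff
  by (simp add: power2_eq_iff_nonneg)

text \<open>The cross term \<open>|a><b| + |b><a|\<close> in the expansion of
  \<open>outer (a + b)\<close>. It is bilinear over the reals only: a complex scalar moves to the
  other argument with a conjugation.\<close>

definition sym_outer :: "'a::complex_inner \<Rightarrow> 'a \<Rightarrow> 'a \<Rightarrow> 'a" where
  "sym_outer a b = (\<lambda>z. scaleC (cinner a z) b + scaleC (cinner b z) a)"

lemma outer_add: "outer (a + b) z = outer a z + sym_outer a b z + outer b z"
  by (simp add: outer_def sym_outer_def cinner_simps scaleC_simps)

lemma outer_uminus: "outer (- a) = outer a"
  by (rule ext) (simp add: outer_def cinner_simps scaleC_simps)

lemma sym_outer_simps:
  "sym_outer a (b + b') z = sym_outer a b z + sym_outer a b' z"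
  "sym_outer a (- b) z = - sym_outer a b z"
  "sym_outer a (r *\<^sub>R b) z = r *\<^sub>R sym_outer a b z"
  "sym_outer (r *\<^sub>R a) b z = r *\<^sub>R sym_outer a b z"
  "sym_outer (scaleC c a) b = sym_outer a (scaleC (cnj c) b)"
  by (auto simp: sym_outer_def cinner_simps scaleC_simps scaleR_add_right scaleC_scaleR scaleR_scaleC mult_ac)

lemma sym_outer_finite_rank_sa: "sym_outer a b \<in> finite_rank_sa"
proof -
  have "sym_outer a b = (\<lambda>z. (outer (a + b) z - outer a z) - outer b z)"
    by (rule ext) (simp add: outer_add)
  then show ?thesis using outer_finite_rank_sa finite_rank_sa_diff by metis
qed

lemma sym_outer_at:
  "cinner f f = 1 \<Longrightarrow> cinner f u = 0 \<Longrightarrow> sym_outer f u f = u"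
  using cinner_commute[of u f] by (simp add: sym_outer_def)

text \<open>The difference of two pure states has eigenvalues \<open>\<plusminus>sqrt (1 - \<bar>\<langle>x, y\<rangle>\<bar>\<^sup>2)\<close>.\<close>

lemma outer_diff_spectral:
  fixes x y :: "'a::chilbert_space"
  assumes x: "norm x = 1" and y: "norm y = 1"
  defines "s \<equiv> sqrt (1 - (cmod (cinner x y))\<^sup>2)"
  obtains v w where "norm v = 1" "norm w = 1" "s \<noteq> 0 \<Longrightarrow> cinner v w = 0"
    "\<And>z. outer x z - outer y z = s *\<^sub>R (outer v z - outer w z)"
proof -
  define c where "c = cmod (cinner x y)"
  have "c \<le> 1" unfolding c_def using Cauchy_Schwarz[of x y] x y by simp
  have "c \<ge> 0" by (simp add: c_def)
  \<comment> \<open>A phase on \<open>y\<close> leaves \<open>outer y\<close> unchanged and makes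
    the inner product with \<open>x\<close> real, so that the sum and the difference of the two unit
    vectors become orthogonal.\<close>
  obtain p where p: "cmod p = 1" "p * cinner x y = of_real c"
  proof (cases "cinner x y = 0")
    case True
    then show ?thesis using that[of 1] by (simp add: c_def)
  next
    case False
    note ph = unit_phase[OF False]
    show ?thesis
      by (rule that[of "cnj (cinner x y / of_real (cmod (cinner x y)))"]) (use ph in \<open>auto simp: c_def simp del: complex_cnj_divide\<close>)
  qed
  define y' where "y' = scaleC p y"
  have oy: "outer y' = outer y" unfolding y'_def by (rule outer_phase[OF p(1)])
  have y': "norm y' = 1" by (simp add: y'_def norm_scaleC p(1) y)
  have xy: "cinner x y' = of_real c" by (simp add: y'_def cinner_scaleC_right p(2))
  have yx: "cinner y' x = of_real c" using cinner_commute[of y' x] xy by simp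
  define u d where "u = x + y'" and "d = x - y'"
  have ud: "cinner u d = 0" by (simp add: u_def d_def cinner_simps xy yx cinner_self x y')
  have nu: "(norm u)\<^sup>2 = 2 + 2 * c" unfolding u_def norm_add_sq by (simp add: xy x y')
  have nd: "(norm d)\<^sup>2 = 2 - 2 * c" unfolding d_def norm_diff_sq by (simp add: xy x y')
  have s: "s = norm u * norm d / 2"
  proof -
    have "(norm u * norm d / 2)\<^sup>2 = 1 - c\<^sup>2"
      by (simp add: power_mult_distrib power_divide nu nd) (simp add: algebra_simps power2_eq_square)
    then show ?thesis unfolding s_def c_def[symmetric] by (metis real_sqrt_unique mult_nonneg_nonneg norm_ge_zero divide_nonneg_nonneg zero_le_numeral)
  qed
  show thesis
  proof (cases "d = 0")
    case True
    \<comment> \<open>Here the pure states coincide and \<open>v = w = x\<close> is returned, which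
      is why orthogonality is claimed only for nonzero \<open>s\<close>.\<close>
    then have "x = y'" "s = 0" using s by (simp_all add: d_def)
    then show thesis using that[of x x] x oy by simp
  next
    case False
    have "norm u \<noteq> 0" using nu \<open>c \<ge> 0\<close> by auto
    \<comment> \<open>\<open>outer x - outer y\<close> is half of \<open>sym_outer u d\<close>.
      Scaling the orthogonal vectors \<open>u\<close> and \<open>d\<close> to length
      \<open>1 / sqrt 2\<close> makes \<open>a + b\<close> and \<open>a - b\<close> orthonormal, and
      the difference of their projections is again a multiple of
      \<open>sym_outer u d\<close>.\<close>
    define a b where "a = (1 / (sqrt 2 * norm u)) *\<^sub>R u" and "b = (1 / (sqrt 2 * norm d)) *\<^sub>R d"
    have na: "(norm a)\<^sup>2 = 1 / 2" using \<open>norm u \<noteq> 0\<close> by (simp add: a_def power_divide power_mult_distrib)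
    have nb: "(norm b)\<^sup>2 = 1 / 2" using False by (simp add: b_def power_divide power_mult_distrib)
    have ab: "cinner a b = 0" by (simp add: a_def b_def cinner_simps ud)
    have ba: "cinner b a = 0" using cinner_commute[of b a] ab by simp
    have pm: "outer (g + h) z - outer (g - h) z = 2 *\<^sub>R sym_outer g h z" for g h z :: 'a
      using outer_add[of g h z] outer_add[of g "-h" z] by (simp add: outer_uminus sym_outer_simps scaleR_2)
    have x2: "x = (1/2) *\<^sub>R u + (1/2) *\<^sub>R d" "y' = (1/2) *\<^sub>R u - (1/2) *\<^sub>R d"
      by (simp_all add: u_def d_def algebra_simps flip: scaleR_add_left)
    show thesis
    proof (rule that[of "a + b" "a - b"])
      have "(norm (a + b))\<^sup>2 = 1" "(norm (a - b))\<^sup>2 = 1" by (simp_all add: norm_add_sq norm_diff_sq na nb ab)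
      then show "norm (a + b) = 1" "norm (a - b) = 1" using abs_norm_cancel power2_eq_1_iff norm_ge_zero by (metis abs_1 abs_minus_cancel)+
      show "cinner (a + b) (a - b) = 0" by (simp add: cinner_simps ab ba cinner_self na nb del: of_real_power)
      fix z
      have "outer x z - outer y z = 2 *\<^sub>R sym_outer ((1/2) *\<^sub>R u) ((1/2) *\<^sub>R d) z"
        by (simp only: pm[symmetric] x2[symmetric] oy)
      also have "\<dots> = (1/2) *\<^sub>R sym_outer u d z" by (simp add: sym_outer_simps)
      finally have 1: "outer x z - outer y z = (1/2) *\<^sub>R sym_outer u d z" .
      have "sqrt 2 * norm d * (sqrt 2 * norm u) = (sqrt 2 * sqrt 2) * (norm u * norm d)"
        by (simp only: mult_ac)
      then have "2 / (sqrt 2 * norm d * (sqrt 2 * norm u)) = 1 / (norm u * norm d)"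
        by (simp only: real_sqrt_mult_self)
      then have "outer (a + b) z - outer (a - b) z = (1 / (norm u * norm d)) *\<^sub>R sym_outer u d z"
        unfolding pm by (simp add: a_def b_def sym_outer_simps)
      then show "outer x z - outer y z = s *\<^sub>R (outer (a + b) z - outer (a - b) z)"
        using \<open>norm u \<noteq> 0\<close> False by (simp add: 1 s)
    qed
  qed
qed

text \<open>Both representations are evaluated at the eigenvector \<open>a\<close> for
  \<open>s\<close>: this gives \<open>s = r * (|cinner v a|^2 - |cinner w a|^2)\<close>, and the
  bracket is at most 1 because \<open>v\<close> and \<open>a\<close> are unit vectors.\<close>

lemma outer_diff_bound:
  fixes x y v w :: "'a::chilbert_space"
  assumes x: "norm x = 1" and y: "norm y = 1" and v: "norm v = 1" and r: "r \<ge> 0"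
    and eq: "\<And>z. outer x z - outer y z = r *\<^sub>R (outer v z - outer w z)"
  shows "sqrt (1 - (cmod (cinner x y))\<^sup>2) \<le> r"
proof -
  define s where "s = sqrt (1 - (cmod (cinner x y))\<^sup>2)"
  obtain a b where ab: "norm a = 1" "norm b = 1" "s \<noteq> 0 \<Longrightarrow> cinner a b = 0"
      "\<And>z. outer x z - outer y z = s *\<^sub>R (outer a z - outer b z)"
    using outer_diff_spectral[OF x y] unfolding s_def by metis
  have "s \<le> r"
  proof (cases "s = 0")
    case False
    have val: "Re (cinner a (outer g a - outer h a)) = (cmod (cinner g a))\<^sup>2 - (cmod (cinner h a))\<^sup>2" for g h
      by (simp add: cinner_diff_right cinner_outer_self del: of_real_power)
    have "s = Re (cinner a (s *\<^sub>R (outer a a - outer b a)))"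
      using ab(1,3) False cmod_cinner_commute[of b a] by (simp add: cinner_scaleR_right val cinner_self)
    also have "\<dots> = r * ((cmod (cinner v a))\<^sup>2 - (cmod (cinner w a))\<^sup>2)"
    proof -
      have "s *\<^sub>R (outer a a - outer b a) = r *\<^sub>R (outer v a - outer w a)"
        using ab(4)[of a] eq[of a] by simp
      then show ?thesis using val[of v w] by (simp only: cinner_scaleR_right Re_complex_of_real times_complex.sel Im_complex_of_real mult_zero_left diff_zero)
    qed
    also have "\<dots> \<le> r * 1"
    proof (rule mult_left_mono[OF _ r])
      have "(cmod (cinner v a))\<^sup>2 \<le> 1" using Cauchy_Schwarz[of v a] v ab(1) by (simp add: power_le_one)
      then show "(cmod (cinner v a))\<^sup>2 - (cmod (cinner w a))\<^sup>2 \<le> 1"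
        using zero_le_power2[of "cmod (cinner w a)"] by linarith
    qed
    finally show ?thesis by simp
  qed (use r in simp)
  then show ?thesis by (simp add: s_def)
qed

section \<open>The action of \<open>L\<close> on pure states\<close>

locale density_preserver =
  fixes L :: "('a::chilbert_space \<Rightarrow> 'a) \<Rightarrow> ('a \<Rightarrow> 'a)"
  assumes additive: "A \<in> finite_rank_sa \<Longrightarrow> B \<in> finite_rank_sa \<Longrightarrow> L (\<lambda>x. A x + B x) = (\<lambda>x. L A x + L B x)"
    and homogeneous: "A \<in> finite_rank_sa \<Longrightarrow> L (\<lambda>x. r *\<^sub>R A x) = (\<lambda>x. r *\<^sub>R L A x)"
    and bij: "bij_betw L (finite_rank_sa \<inter> density_ops) (finite_rank_sa \<inter> density_ops)"
begin

abbreviation "D \<equiv> finite_rank_sa \<inter> density_ops :: ('a \<Rightarrow> 'a) set"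

lemma L_zero: "L (\<lambda>x. 0) = (\<lambda>x. 0)"
  using homogeneous[OF finite_rank_sa_zero, of 0] by simp

lemma L_diff:
  assumes "A \<in> finite_rank_sa" "B \<in> finite_rank_sa"
  shows "L (\<lambda>x. A x - B x) = (\<lambda>x. L A x - L B x)"
  using additive[OF assms(1) finite_rank_sa_scaleR[OF assms(2), of "-1"]] homogeneous[OF assms(2), of "-1"] by simp

lemma L_sum:
  assumes "finite F" "\<And>i. i \<in> F \<Longrightarrow> A i \<in> finite_rank_sa"
  shows "L (\<lambda>x. \<Sum>i\<in>F. A i x) = (\<lambda>x. \<Sum>i\<in>F. L (A i) x)"
  using assms
proof (induction F)
  case (insert i F)
  have "(\<lambda>x. \<Sum>j\<in>F. A j x) \<in> finite_rank_sa" using insert by (intro finite_rank_sa_sum) auto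
  then show ?case using insert by (simp add: additive)
qed (simp add: L_zero)

lemma L_D: "A \<in> D \<Longrightarrow> L A \<in> D"
  using bij by (rule bij_betw_apply)

lemma L_inj: "A \<in> D \<Longrightarrow> B \<in> D \<Longrightarrow> L A = L B \<Longrightarrow> A = B"
  using bij by (meson bij_betw_imp_inj_on inj_onD)

lemma L_surj: "B \<in> D \<Longrightarrow> \<exists>A\<in>D. L A = B"
  using bij by (metis bij_betw_imp_surj_on imageE)

lemma L_convex:
  assumes "A \<in> D" "B \<in> D"
  shows "L (\<lambda>x. t *\<^sub>R A x + (1 - t) *\<^sub>R B x) = (\<lambda>x. t *\<^sub>R L A x + (1 - t) *\<^sub>R L B x)"
proof -
  have m: "A \<in> finite_rank_sa" "B \<in> finite_rank_sa" using assms by auto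
  show ?thesis
    by (simp add: additive[OF finite_rank_sa_scaleR[OF m(1), of t] finite_rank_sa_scaleR[OF m(2), of "1 - t"]] homogeneous m)
qed

text \<open>A proper splitting of the image would pull back, by surjectivity and injectivity on
  states, to a proper splitting of \<open>outer x\<close>; extremality then says that the part lying
  over \<open>outer y\<close> is \<open>outer x\<close> itself.\<close>

lemma L_outer_unit:
  assumes x: "norm x = 1"
  shows "\<exists>y. norm y = 1 \<and> L (outer x) = outer y"
proof -
  note ox = outer_density[OF x]
  show ?thesis
  proof (rule density_split[OF L_D[OF ox]])
    fix y t R assume y: "norm y = 1" and t: "0 < t" "t < 1" and R: "R \<in> D"
      and eq: "L (outer x) = (\<lambda>x. t *\<^sub>R outer y x + (1 - t) *\<^sub>R R x)"
    obtain A B where AB: "A \<in> D" "L A = outer y" "B \<in> D" "L B = R"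
      using L_surj[OF outer_density[OF y]] L_surj[OF R] by blast
    have "outer x = (\<lambda>z. t *\<^sub>R A z + (1 - t) *\<^sub>R B z)"
      by (rule L_inj[OF ox density_convex[OF AB(1,3)]]) (use t in \<open>auto simp: L_convex[OF AB(1,3)] AB eq\<close>)
    then have "A = outer x" using outer_extreme[OF x AB(1,3) t] by blast
    then show ?thesis using AB(2) y by blast
  qed blast
qed

lemma L_outer_unit_surj:
  assumes y: "norm y = 1"
  shows "\<exists>x. norm x = 1 \<and> L (outer x) = outer y"
proof -
  obtain A where A: "A \<in> D" "L A = outer y" using L_surj[OF outer_density[OF y]] by blast
  show ?thesis
  proof (rule density_split[OF A(1)])
    fix x t R assume x: "norm x = 1" and t: "0 < t" "t < 1" and R: "R \<in> D"
      and eq: "A = (\<lambda>z. t *\<^sub>R outer x z + (1 - t) *\<^sub>R R z)"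
    \<comment> \<open>If the preimage \<open>A\<close> splits, so does \<open>outer y\<close>, and
      extremality of \<open>outer y\<close> forces the pure component of \<open>A\<close> to be
      mapped onto it.\<close>
    have "outer y = (\<lambda>z. t *\<^sub>R L (outer x) z + (1 - t) *\<^sub>R L R z)"
      using A(2) unfolding eq L_convex[OF outer_density[OF x] R] by simp
    then have "L (outer x) = outer y"
      by (rule outer_extreme[OF y L_D[OF outer_density[OF x]] L_D[OF R] t])
    then show ?thesis using x by blast
  qed (use A(2) in blast)
qed

lemma L_outer_scaleR: "L (outer x) = outer y \<Longrightarrow> L (outer (r *\<^sub>R x)) = outer (r *\<^sub>R y)"
  unfolding outer_scaleR by (simp add: homogeneous outer_finite_rank_sa)

lemma outer_zero: "outer 0 = (\<lambda>x. 0)"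
  by (simp add: outer_def)

lemma L_outer: "\<exists>y. L (outer x) = outer y"
proof (cases "x = 0")
  case True
  then have "L (outer 0) = outer 0" using L_zero by (simp add: outer_zero)
  then show ?thesis using True by blast
next
  case False
  then obtain y where "L (outer ((1 / norm x) *\<^sub>R x)) = outer y" using L_outer_unit[of "(1 / norm x) *\<^sub>R x"] by auto
  from L_outer_scaleR[OF this, of "norm x"] show ?thesis using False by auto
qed

lemma L_outer_surj: "\<exists>x. L (outer x) = outer y"
proof (cases "y = 0")
  case True
  then have "L (outer 0) = outer 0" using L_zero by (simp add: outer_zero)
  then show ?thesis using True by blast
next
  case False
  then obtain x where "L (outer x) = outer ((1 / norm y) *\<^sub>R y)" using L_outer_unit_surj[of "(1 / norm y) *\<^sub>R y"] by auto
  from L_outer_scaleR[OF this, of "norm y"] show ?thesis using False by auto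
qed

lemma L_outer_norm_unit: "norm x = 1 \<Longrightarrow> L (outer x) = outer y \<Longrightarrow> norm y = 1"
  using L_outer_unit outer_eq_norm by metis

lemma L_outer_norm:
  assumes "L (outer x) = outer y"
  shows "norm y = norm x"
proof (cases "x = 0")
  case True
  then have "outer y = outer 0" using assms L_zero by (simp add: outer_zero)
  then show ?thesis using outer_eq_norm[of y 0] True by simp
next
  case False
  then have "norm ((1 / norm x) *\<^sub>R x) = 1" by simp
  then have "norm ((1 / norm x) *\<^sub>R y) = 1"
    using L_outer_scaleR[OF assms] by (rule L_outer_norm_unit)
  then show ?thesis by (auto simp: divide_simps split: if_splits)
qed

text \<open>The number \<open>s\<close> is determined by transition probability and is characterised
  by minimality, which uses only linear relations between pure states. One inequality pushes such a
  relation forward by \<open>L\<close>, the other pulls one back.\<close>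

lemma transition_unit:
  assumes x: "norm x = 1" and y: "norm y = 1" and x': "L (outer x) = outer x'" and y': "L (outer y) = outer y'"
  shows "cmod (cinner x' y') = cmod (cinner x y)"
proof -
  note ux = L_outer_norm_unit[OF x x'] and uy = L_outer_norm_unit[OF y y']
  note m = outer_finite_rank_sa
  define s where "s = sqrt (1 - (cmod (cinner x y))\<^sup>2)"
  define s' where "s' = sqrt (1 - (cmod (cinner x' y'))\<^sup>2)"
  have le1: "(cmod (cinner x y))\<^sup>2 \<le> 1" "(cmod (cinner x' y'))\<^sup>2 \<le> 1"
    using Cauchy_Schwarz[of x y] Cauchy_Schwarz[of x' y'] x y ux uy by (simp_all add: power_le_one)
  have s0: "s \<ge> 0" "s' \<ge> 0" using le1 by (simp_all add: s_def s'_def)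
  have "s' \<le> s"
  proof -
    obtain v w where vw: "norm v = 1" "norm w = 1"
        "\<And>z. outer x z - outer y z = s *\<^sub>R (outer v z - outer w z)"
      using outer_diff_spectral[OF x y] unfolding s_def by metis
    obtain v' w' where v': "L (outer v) = outer v'" "L (outer w) = outer w'" using L_outer by metis
    have "L (\<lambda>z. outer x z - outer y z) = L (\<lambda>z. s *\<^sub>R (outer v z - outer w z))" using vw(3) by simp
    then have "outer x' z - outer y' z = s *\<^sub>R (outer v' z - outer w' z)" for z
      by (auto simp: L_diff homogeneous finite_rank_sa_diff m x' y' v' dest: fun_cong)
    then show ?thesis
      unfolding s'_def by (rule outer_diff_bound[OF ux uy L_outer_norm_unit[OF vw(1) v'(1)] s0(1)])
  qed
  moreover have "s \<le> s'"
  proof -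
    obtain v' w' where vw: "norm v' = 1" "norm w' = 1"
        "\<And>z. outer x' z - outer y' z = s' *\<^sub>R (outer v' z - outer w' z)"
      using outer_diff_spectral[OF ux uy] unfolding s'_def by metis
    obtain v w where v: "norm v = 1" "L (outer v) = outer v'" and w: "norm w = 1" "L (outer w) = outer w'"
      using L_outer_unit_surj vw(1,2) by metis
    \<comment> \<open>Injectivity is known on states only. Moving the negative terms across gives
      \<open>outer x' + s' outer w' = outer y' + s' outer v'\<close>, and this \<open>t\<close>
      normalises both sides to convex combinations with weights \<open>t\<close> and
      \<open>1 - t = t * s'\<close>.\<close>
    define t where "t = 1 / (1 + s')"
    have t: "0 < t" "t \<le> 1" "1 - t = t * s'" using s0(2) by (auto simp: t_def field_simps)
    have "outer x' z + s' *\<^sub>R outer w' z = outer y' z + s' *\<^sub>R outer v' z" for z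
      using vw(3)[of z] by (simp add: algebra_simps)
    then have e: "t *\<^sub>R outer x' z + (1 - t) *\<^sub>R outer w' z = t *\<^sub>R outer y' z + (1 - t) *\<^sub>R outer v' z" for z
      unfolding t(3) by (simp flip: scaleR_scaleR scaleR_add_right)
    have "(\<lambda>z. t *\<^sub>R outer x z + (1 - t) *\<^sub>R outer w z) = (\<lambda>z. t *\<^sub>R outer y z + (1 - t) *\<^sub>R outer v z)"
    proof (rule L_inj)
      show "L (\<lambda>z. t *\<^sub>R outer x z + (1 - t) *\<^sub>R outer w z) = L (\<lambda>z. t *\<^sub>R outer y z + (1 - t) *\<^sub>R outer v z)"
        by (simp add: L_convex outer_density x y v w x' y' e del: Int_iff)
    qed (intro density_convex outer_density x y v w; use t in simp)+
    from fun_cong[OF this] have "t *\<^sub>R (outer x z + s' *\<^sub>R outer w z) = t *\<^sub>R (outer y z + s' *\<^sub>R outer v z)" for z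
      unfolding t(3) by (simp add: scaleR_add_right)
    then have "outer x z + s' *\<^sub>R outer w z = outer y z + s' *\<^sub>R outer v z" for z
      using t(1) by simp
    then have "outer x z - outer y z = s' *\<^sub>R (outer v z - outer w z)" for z
      by (simp add: algebra_simps)
    then show ?thesis
      unfolding s_def by (rule outer_diff_bound[OF x y v(1) s0(2)])
  qed
  ultimately have "s = s'" by simp
  then show ?thesis using le1 unfolding s_def s'_def by (simp add: power2_eq_iff_nonneg)
qed

lemma transition:
  assumes x': "L (outer x) = outer x'" and y': "L (outer y) = outer y'"
  shows "cmod (cinner x' y') = cmod (cinner x y)"
proof (cases "x = 0 \<or> y = 0")
  case True
  then show ?thesis using L_outer_norm[OF x'] L_outer_norm[OF y'] by auto
next
  case False
  let ?a = "1 / norm x" and ?b = "1 / norm y"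
  have "cmod (cinner (?a *\<^sub>R x') (?b *\<^sub>R y')) = cmod (cinner (?a *\<^sub>R x) (?b *\<^sub>R y))"
    by (rule transition_unit) (use False in \<open>auto intro: L_outer_scaleR x' y'\<close>)
  then show ?thesis using False by (simp add: cinner_simps norm_mult norm_divide field_simps)
qed

end

subsection \<open>The theorem of Wigner\<close>

text \<open>\<open>\<sigma>\<close> is the identity for a unitary and complex conjugation for an antiunitary operator.\<close>

definition semiunitary :: "(complex \<Rightarrow> complex) \<Rightarrow> ('a::complex_inner \<Rightarrow> 'a) \<Rightarrow> bool" where
  "semiunitary \<sigma> V \<longleftrightarrow> (\<sigma> = (\<lambda>c. c) \<or> \<sigma> = cnj) \<and> (\<forall>x y. V (x + y) = V x + V y) \<and>
     (\<forall>c x. V (scaleC c x) = scaleC (\<sigma> c) (V x)) \<and> surj V \<and>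
     (\<forall>x y. cinner (V x) (V y) = \<sigma> (cinner x y))"

lemma sym_outer_inj:
  "cinner f f = 1 \<Longrightarrow> cinner f u = 0 \<Longrightarrow> cinner f v = 0 \<Longrightarrow> sym_outer f u = sym_outer f v \<Longrightarrow> u = v"
  by (metis sym_outer_at)

lemma norm_eq_imp_Re_cinner_eq:
  fixes u v x y :: "'a::complex_inner"
  assumes "norm u = norm x" "norm v = norm y" "norm (u + v) = norm (x + y)"
  shows "Re (cinner u v) = Re (cinner x y)"
  using norm_add_sq[of u v] norm_add_sq[of x y] assms by simp

context density_preserver
begin

text \<open>
  Normalising the phase of a representative of \<open>L (outer (e + x))\<close> by its component along \<open>f\<close>
  yields a map \<open>U\<close> on the orthogonal complement of \<open>e\<close>, which is real linear because
  \<open>L (sym_outer e x) = sym_outer f (U x)\<close>.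
\<close>

lemma orthogonal_part:
  assumes e: "norm e = 1" and f: "L (outer e) = outer f" and x: "cinner e x = 0"
  shows "\<exists>u. cinner f u = 0 \<and> L (outer (e + x)) = outer (f + u)"
proof -
  obtain z where z: "L (outer (e + x)) = outer z" using L_outer by blast
  have ff: "cinner f f = 1" using L_outer_norm[OF f] e by (simp add: cinner_self)
  \<comment> \<open>The transition probability between \<open>e\<close> and \<open>e + x\<close> has
    modulus 1, so a phase turns the \<open>f\<close> component of \<open>z\<close> into exactly 1;
    the remainder is \<open>u\<close>.\<close>
  have "cmod (cinner f z) = 1"
    using transition[OF f z] x e by (simp add: cinner_simps cinner_self)
  moreover from this have nz: "cinner f z \<noteq> 0" by auto
  ultimately have ph: "cmod (cinner f z) = 1" "cnj (cinner f z) * cinner f z = 1" "cmod (cnj (cinner f z)) = 1"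
    using unit_phase[OF nz] by simp_all
  define u where "u = scaleC (cnj (cinner f z)) z - f"
  have "cinner f u = 0" using ph(2) ff by (simp add: u_def cinner_simps)
  moreover have "outer (f + u) = outer z" by (simp add: u_def outer_phase[OF ph(3)])
  ultimately show ?thesis using z by metis
qed

definition orth_map :: "'a \<Rightarrow> 'a \<Rightarrow> 'a \<Rightarrow> 'a" where
  "orth_map e f x = (SOME u. cinner f u = 0 \<and> L (outer (e + x)) = outer (f + u))"

text \<open>Adding the expansions of \<open>L (outer (e + x))\<close> and
  \<open>L (outer (e - x))\<close> cancels the unknown \<open>L (sym_outer e x)\<close>. At
  \<open>f\<close> every pure term vanishes, which leaves \<open>U x + U (- x) = 0\<close>; oddness
  then identifies \<open>outer (U x)\<close> with \<open>L (outer x)\<close>, and the cross term is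
  what remains.\<close>

lemma wigner_real_linear:
  assumes e: "norm e = 1" and f: "L (outer e) = outer f"
  defines "U \<equiv> orth_map e f"
  assumes x: "cinner e x = 0"
  shows "cinner f (U x) = 0" "L (outer x) = outer (U x)" "L (sym_outer e x) = sym_outer f (U x)"
proof -
  have ff: "cinner f f = 1" using L_outer_norm[OF f] e by (simp add: cinner_self)
  have U: "cinner f (U x) = 0 \<and> L (outer (e + x)) = outer (f + U x)" if "cinner e x = 0" for x
    unfolding U_def orth_map_def by (rule someI_ex[OF orthogonal_part[OF e f that]])
  have mx: "cinner e (- x) = 0" using x by (simp add: cinner_minus_right)
  show fU: "cinner f (U x) = 0" using U[OF x] by simp
  have fU': "cinner f (U (- x)) = 0" using U[OF mx] by simp
  obtain x' where x': "L (outer x) = outer x'" using L_outer by blast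
  have "cinner f x' = 0" using transition[OF f x'] x by simp
  note m = outer_finite_rank_sa sym_outer_finite_rank_sa
  have Ladd: "L (outer (e + y)) z = outer f z + L (sym_outer e y) z + L (outer y) z" for y z
  proof -
    have "outer (e + y) = (\<lambda>z. (outer e z + sym_outer e y z) + outer y z)" by (rule ext) (rule outer_add)
    then show ?thesis by (simp add: additive finite_rank_sa_add m f)
  qed
  have Lneg: "L (sym_outer e (- x)) z = - L (sym_outer e x) z" for z
  proof -
    have "sym_outer e (- x) = (\<lambda>z. (-1) *\<^sub>R sym_outer e x z)" by (rule ext) (simp add: sym_outer_simps)
    then show ?thesis using homogeneous[OF m(2), of "-1" e x] by simp
  qed
  have sum: "sym_outer f (U x) z + outer (U x) z + (sym_outer f (U (- x)) z + outer (U (- x)) z) = 2 *\<^sub>R outer x' z" for z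
  proof -
    have "outer f z + sym_outer f (U x) z + outer (U x) z = outer f z + L (sym_outer e x) z + outer x' z"
      using Ladd[of x z] U[OF x] by (simp add: outer_add x')
    moreover have "outer f z + sym_outer f (U (- x)) z + outer (U (- x)) z = outer f z - L (sym_outer e x) z + outer x' z"
      using Ladd[of "- x" z] U[OF mx] by (simp add: outer_add x' outer_uminus Lneg)
    ultimately show ?thesis by (simp add: scaleR_2 algebra_simps)
  qed
  have out0: "outer g f = 0" if "cinner f g = 0" for g
    using that cinner_commute[of g f] by (simp add: outer_def)
  have "U x + U (- x) = 0"
    using sum[of f] by (simp add: out0 fU fU' \<open>cinner f x' = 0\<close> sym_outer_at ff)
  then have "U (- x) = - U x" by (simp add: eq_neg_iff_add_eq_0 add.commute)
  then have "2 *\<^sub>R outer (U x) z = 2 *\<^sub>R outer x' z" for z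
    using sum[of z] by (simp add: sym_outer_simps outer_uminus scaleR_2)
  then have ox: "outer (U x) = outer x'" by auto
  then show oU: "L (outer x) = outer (U x)" using x' by simp
  show "L (sym_outer e x) = sym_outer f (U x)"
  proof
    fix z
    have "outer f z + L (sym_outer e x) z + outer (U x) z = outer f z + sym_outer f (U x) z + outer (U x) z"
      using Ladd[of x z] U[OF x] oU by (simp add: outer_add)
    then show "L (sym_outer e x) z = sym_outer f (U x) z" by simp
  qed
qed

text \<open>\<open>z\<close> only supplies the base vector \<open>e\<close>. \<open>U\<close> is
  first shown to be real linear on the complement of \<open>e\<close>, then linear or conjugate
  linear, and is finally extended by sending \<open>e\<close> to \<open>f\<close>.\<close>

lemma wigner:
  assumes "z \<noteq> (0::'a)"
  shows "\<exists>\<sigma> V. semiunitary \<sigma> V \<and> (\<forall>x. L (outer x) = outer (V x))"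
proof -
  define e where "e = (1 / norm z) *\<^sub>R z"
  have e: "norm e = 1" using assms by (simp add: e_def)
  have ee: "cinner e e = 1" using e by (simp add: cinner_self)
  obtain f where f: "L (outer e) = outer f" using L_outer by blast
  have ff: "cinner f f = 1" using L_outer_norm[OF f] e by (simp add: cinner_self)
  define U where "U = orth_map e f"
  define E where "E = {x. cinner e x = 0}"
  note U = wigner_real_linear[OF e f, folded U_def]
  have UE: "cinner f (U x) = 0" "L (outer x) = outer (U x)" "L (sym_outer e x) = sym_outer f (U x)"
    if "x \<in> E" for x using U[of x] that by (auto simp: E_def)
  have E1: "x + y \<in> E" if "x \<in> E" "y \<in> E" for x y
    using that by (simp add: E_def cinner_simps)
  have E2: "scaleC c x \<in> E" "r *\<^sub>R x \<in> E" if "x \<in> E" for x c r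
    using that by (simp_all add: E_def cinner_simps)
  note E = E1 E2
  note m = sym_outer_finite_rank_sa
  have Uadd: "U (x + y) = U x + U y" if "x \<in> E" "y \<in> E" for x y
  proof (rule sym_outer_inj[OF ff])
    have "sym_outer e (x + y) = (\<lambda>z. sym_outer e x z + sym_outer e y z)"
      by (rule ext) (rule sym_outer_simps)
    then have "L (sym_outer e (x + y)) = (\<lambda>z. sym_outer f (U x) z + sym_outer f (U y) z)"
      using additive[OF m m, of e x e y] UE(3)[OF that(1)] UE(3)[OF that(2)] by simp
    then have "sym_outer f (U (x + y)) = (\<lambda>z. sym_outer f (U x) z + sym_outer f (U y) z)"
      using UE(3)[OF E(1)[OF that]] by simp
    then show "sym_outer f (U (x + y)) = sym_outer f (U x + U y)" by (auto simp: sym_outer_simps)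
  qed (use UE(1) E(1) that in \<open>auto simp: cinner_add_right\<close>)
  have UR: "U (r *\<^sub>R x) = r *\<^sub>R U x" if "x \<in> E" for x and r :: real
  proof (rule sym_outer_inj[OF ff])
    have "sym_outer e (r *\<^sub>R x) = (\<lambda>z. r *\<^sub>R sym_outer e x z)"
      by (rule ext) (rule sym_outer_simps)
    then have "L (sym_outer e (r *\<^sub>R x)) = (\<lambda>z. r *\<^sub>R sym_outer f (U x) z)"
      using homogeneous[OF m, of r e x] UE(3)[OF that] by simp
    then have "sym_outer f (U (r *\<^sub>R x)) = (\<lambda>z. r *\<^sub>R sym_outer f (U x) z)"
      using UE(3)[OF E(3)[OF that]] by simp
    then show "sym_outer f (U (r *\<^sub>R x)) = sym_outer f (r *\<^sub>R U x)" by (auto simp: sym_outer_simps)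
  qed (use UE(1) E(3) that in \<open>auto simp: cinner_scaleR_right\<close>)
  have Unorm: "norm (U x) = norm x" if "x \<in> E" for x using L_outer_norm[OF UE(2)[OF that]] .
  \<comment> \<open>The inner product of \<open>U x\<close> and \<open>U (scaleC \<i> x)\<close> has
    real part 0 and the maximal modulus \<open>norm x\<close> squared. The equality case of
    Cauchy-Schwarz, checked by expanding the norm of a difference, leaves only the factors
    \<open>\<i>\<close> and \<open>- \<i>\<close>.\<close>
  have Ui: "U (scaleC \<i> x) = scaleC \<i> (U x) \<or> U (scaleC \<i> x) = scaleC (- \<i>) (U x)" if x: "x \<in> E" for x
  proof -
    let ?y = "scaleC \<i> x"
    have y: "?y \<in> E" using E(2) x by blast
    have "cmod (cinner (U x) (U ?y)) = cmod (cinner x ?y)" by (rule transition[OF UE(2)[OF x] UE(2)[OF y]])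
    then have ab: "cmod (cinner (U x) (U ?y)) = (norm x)\<^sup>2"
      by (simp add: cinner_scaleC_right norm_mult norm_power cinner_self)
    have re: "Re (cinner (U x) (U ?y)) = Re (cinner x ?y)"
      by (rule norm_eq_imp_Re_cinner_eq) (simp_all add: Unorm x y E(1) flip: Uadd)
    define b where "b = Im (cinner (U x) (U ?y))"
    have c: "cinner (U x) (U ?y) = scaleR b \<i>"
      using re by (simp add: complex_eq_iff b_def cinner_scaleC_right)
    have "b = (norm x)\<^sup>2 \<or> b = - (norm x)\<^sup>2" using ab unfolding c by (auto simp: abs_if split: if_splits)
    moreover have "U ?y = scaleC s (U x)" if s: "s = \<i> \<or> s = - \<i>" "scaleR b \<i> = of_real ((norm x)\<^sup>2) * s" for s :: complex
    proof -
      have "Re (cinner (U ?y) (scaleC s (U x))) = Re (s * cnj (cinner (U x) (U ?y)))"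
        using cinner_commute[of "U ?y" "U x"] by (simp add: cinner_scaleC_right)
      also have "\<dots> = (norm x)\<^sup>2" unfolding c s(2) using s(1) by auto
      finally have "(norm (U ?y - scaleC s (U x)))\<^sup>2 = 0"
        using s(1) by (auto simp: norm_diff_sq norm_scaleC Unorm x y)
      then show ?thesis by simp
    qed
    ultimately show ?thesis by (auto simp: scaleR_conv_of_real)
  qed
  \<comment> \<open>If \<open>x\<close> and \<open>y\<close> violated the two alternatives, then by
    additivity \<open>x + y\<close> could satisfy neither of them, contrary to
    \<open>Ui\<close>.\<close>
  have "(\<forall>x\<in>E. U (scaleC \<i> x) = scaleC \<i> (U x)) \<or> (\<forall>x\<in>E. U (scaleC \<i> x) = scaleC (- \<i>) (U x))"
  proof (rule ccontr)
    assume "\<not> ?thesis"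
    then obtain x y where x: "x \<in> E" "U (scaleC \<i> x) \<noteq> scaleC \<i> (U x)" and y: "y \<in> E" "U (scaleC \<i> y) \<noteq> scaleC (- \<i>) (U y)"
      by blast
    then have x': "U (scaleC \<i> x) = scaleC (- \<i>) (U x)" and y': "U (scaleC \<i> y) = scaleC \<i> (U y)" using Ui by blast+
    have "U (scaleC \<i> (x + y)) = scaleC (- \<i>) (U x) + scaleC \<i> (U y)"
      by (simp add: scaleC_add_right Uadd E x(1) y(1) x' y')
    then show False
      using Ui[OF E(1)[OF x(1) y(1)]] x(2) y(2) x' y' by (auto simp: Uadd x(1) y(1) scaleC_add_right)
  qed
  then obtain \<sigma> where \<sigma>: "\<sigma> = (\<lambda>c. c) \<or> \<sigma> = cnj" "\<And>x. x \<in> E \<Longrightarrow> U (scaleC \<i> x) = scaleC (\<sigma> \<i>) (U x)"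
    by (metis complex_cnj_i)
  have \<sigma>_simps: "\<sigma> (a + b) = \<sigma> a + \<sigma> b" "\<sigma> (a * b) = \<sigma> a * \<sigma> b" "\<sigma> (of_real r) = of_real r"
      "\<sigma> (cnj a) = cnj (\<sigma> a)" "\<sigma> (\<sigma> a) = a" "cmod (\<sigma> a) = cmod a" for a b r
    using \<sigma>(1) by auto
  have UC: "U (scaleC c x) = scaleC (\<sigma> c) (U x)" if x: "x \<in> E" for c x
  proof -
    have cx: "scaleC c x = Re c *\<^sub>R x + Im c *\<^sub>R scaleC \<i> x" for x :: 'a
      by (simp add: scaleR_scaleC scaleC_scaleC flip: scaleC_add_left) (metis complex_eq mult.commute)
    have "U (scaleC c x) = Re c *\<^sub>R U x + Im c *\<^sub>R scaleC (\<sigma> \<i>) (U x)"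
      unfolding cx by (simp add: Uadd UR E x \<sigma>(2))
    also have "\<dots> = scaleC (\<sigma> (of_real (Re c) + of_real (Im c) * \<i>)) (U x)"
      by (simp add: \<sigma>_simps scaleR_scaleC scaleC_scaleC scaleC_add_left)
    also have "of_real (Re c) + of_real (Im c) * \<i> = c" by (simp add: complex_eq_iff)
    finally show ?thesis .
  qed
  \<comment> \<open>\<open>V\<close> maps \<open>e\<close> to \<open>f\<close> and extends
    \<open>U\<close>; applying \<open>\<sigma>\<close> to the coefficient of \<open>e\<close> makes
    both parts semilinear of the same kind.\<close>
  define V where "V = (\<lambda>x. scaleC (\<sigma> (cinner e x)) f + U (x - scaleC (cinner e x) e))"
  have pE: "x - scaleC (cinner e x) e \<in> E" for x by (simp add: E_def cinner_simps ee)
  have Vadd: "V (x + y) = V x + V y" for x y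
  proof -
    have "x + y - scaleC (cinner e (x + y)) e = (x - scaleC (cinner e x) e) + (y - scaleC (cinner e y) e)"
      by (simp add: cinner_simps scaleC_simps)
    then have "U (x + y - scaleC (cinner e (x + y)) e) = U (x - scaleC (cinner e x) e) + U (y - scaleC (cinner e y) e)"
      by (simp only: Uadd[OF pE pE])
    then show ?thesis by (simp add: V_def cinner_add_right \<sigma>_simps scaleC_add_left)
  qed
  have VC: "V (scaleC c x) = scaleC (\<sigma> c) (V x)" for c x
  proof -
    have "scaleC c x - scaleC (cinner e (scaleC c x)) e = scaleC c (x - scaleC (cinner e x) e)"
      by (simp add: cinner_simps scaleC_simps)
    then have "U (scaleC c x - scaleC (cinner e (scaleC c x)) e) = scaleC (\<sigma> c) (U (x - scaleC (cinner e x) e))"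
      by (simp only: UC[OF pE])
    then show ?thesis by (simp add: V_def cinner_scaleC_right \<sigma>_simps scaleC_add_right scaleC_scaleC)
  qed
  have LV: "L (outer x) = outer (V x)" for x
  proof -
    define a where "a = cinner e x"
    define y where "y = x - scaleC a e"
    have y: "y \<in> E" unfolding y_def a_def by (rule pE)
    have x: "x = scaleC a e + y" by (simp add: y_def)
    have Vx: "V x = scaleC (\<sigma> a) f + U y" by (simp add: V_def y_def a_def)
    \<comment> \<open>The scalar of \<open>scaleC a e\<close> is moved onto \<open>y\<close> as
      \<open>cnj a\<close>, which stays in \<open>E\<close>, so that \<open>L\<close> meets only
      terms whose images are known.\<close>
    have "outer x = (\<lambda>z. (((cmod a)\<^sup>2) *\<^sub>R outer e z + sym_outer e (scaleC (cnj a) y) z) + outer y z)"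
      by (rule ext) (simp add: x outer_add outer_scaleC sym_outer_simps)
    then have "L (outer x) = (\<lambda>z. (((cmod a)\<^sup>2) *\<^sub>R outer f z + sym_outer f (scaleC (cnj (\<sigma> a)) (U y)) z) + outer (U y) z)"
      by (simp add: additive homogeneous finite_rank_sa_add finite_rank_sa_scaleR m outer_finite_rank_sa f UE y E UC \<sigma>_simps)
    also have "\<dots> = outer (V x)"
      by (rule ext) (simp add: Vx outer_add outer_scaleC sym_outer_simps \<sigma>_simps)
    finally show ?thesis .
  qed
  have Vnorm: "norm (V x) = norm x" for x by (rule L_outer_norm[OF LV])
  have VRe: "Re (cinner (V x) (V y)) = Re (cinner x y)" for x y
    by (rule norm_eq_imp_Re_cinner_eq) (simp_all add: Vnorm flip: Vadd)
  have "cinner (V x) (V y) = \<sigma> (cinner x y)" for x y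
  proof -
    \<comment> \<open>Replacing \<open>y\<close> by \<open>scaleC \<i> y\<close> recovers the
      imaginary part from the preserved real part.\<close>
    have "Re (\<sigma> \<i> * cinner (V x) (V y)) = Re (\<i> * cinner x y)"
      using VRe[of x "scaleC \<i> y"] by (simp add: VC cinner_scaleC_right)
    then show ?thesis using \<sigma>(1) VRe[of x y] by (auto simp: complex_eq_iff)
  qed
  moreover have "surj V"
  proof (rule surjI)
    fix y
    have "\<exists>x. V x = y"
    proof -
      obtain x where x: "L (outer x) = outer y" using L_outer_surj by blast
      then obtain c where "y = scaleC c (V x)" using outer_eq_imp_parallel[of y "V x"] LV by auto
      then have "V (scaleC (\<sigma> c) x) = y" by (simp add: VC \<sigma>_simps)
      then show ?thesis by blast
    qed
    then show "V (SOME x. V x = y) = y" by (rule someI_ex)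
  qed
  ultimately have "semiunitary \<sigma> V" unfolding semiunitary_def using \<sigma>(1) Vadd VC by blast
  then show ?thesis using LV by blast
qed

end

subsection \<open>Conjugation by a semiunitary operator\<close>

locale semiunitary_conj =
  fixes \<sigma> and V :: "'a::chilbert_space \<Rightarrow> 'a"
  assumes semi: "semiunitary \<sigma> V"
begin

text \<open>\<open>inv V\<close> stands in for the adjoint so that the unitary and the antiunitary
  case can be treated together.\<close>

definition conj :: "('a \<Rightarrow> 'a) \<Rightarrow> 'a \<Rightarrow> 'a" where
  "conj A = (\<lambda>x. V (A (inv V x)))"

lemma \<sigma>_cases: "\<sigma> = (\<lambda>c. c) \<or> \<sigma> = cnj"
  and V_add: "V (x + y) = V x + V y"
  and V_scaleC: "V (scaleC c x) = scaleC (\<sigma> c) (V x)"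
  and V_surj: "surj V"
  and V_cinner: "cinner (V x) (V y) = \<sigma> (cinner x y)"
  using semi unfolding semiunitary_def by blast+

lemma \<sigma>_simps: "\<sigma> (of_real r) = of_real r" "\<sigma> (\<sigma> a) = a" "\<sigma> 0 = 0" "\<sigma> 1 = 1" "\<sigma> a = 0 \<longleftrightarrow> a = 0"
  using \<sigma>_cases by auto

lemma V_scaleR: "V (r *\<^sub>R x) = r *\<^sub>R V x"
  by (simp add: scaleR_scaleC V_scaleC \<sigma>_simps)

lemma V_zero: "V 0 = 0"
  using V_scaleR[of 0 0] by simp

lemma V_diff: "V (x - y) = V x - V y"
  using V_add[of x "- y"] V_scaleR[of "-1" y] by simp

lemma V_sum: "V (\<Sum>i\<in>I. g i) = (\<Sum>i\<in>I. V (g i))"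
  by (induction I rule: infinite_finite_induct) (auto simp: V_zero V_add)

lemma V_norm: "norm (V x) = norm x"
proof -
  have "cinner (V x) (V x) = cinner x x" unfolding V_cinner cinner_self[of x] \<sigma>_simps ..
  then show ?thesis by (simp add: norm_eq_sqrt_cinner)
qed

lemma V_inj: "inj V"
proof (rule injI)
  fix x y assume "V x = V y"
  then have "norm (V (x - y)) = 0" by (simp add: V_diff)
  then show "x = y" by (simp add: V_norm)
qed

lemma V_inv [simp]: "V (inv V x) = x" "inv V (V x) = x"
  by (rule surj_f_inv_f[OF V_surj]) (rule inv_f_f[OF V_inj])

lemma inv_cinner: "cinner (inv V x) y = \<sigma> (cinner x (V y))"
  using V_cinner[of "inv V x" y] by (simp add: \<sigma>_simps)

lemma inv_semiunitary: "semiunitary \<sigma> (inv V)"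
  unfolding semiunitary_def
proof (intro conjI allI)
  show "\<sigma> = (\<lambda>c. c) \<or> \<sigma> = cnj" by (rule \<sigma>_cases)
  show "inv V (x + y) = inv V x + inv V y" for x y by (rule injD[OF V_inj]) (simp add: V_add)
  show "inv V (scaleC c x) = scaleC (\<sigma> c) (inv V x)" for c x
    by (rule injD[OF V_inj]) (simp add: V_scaleC \<sigma>_simps)
  show "surj (inv V)" by (rule inj_imp_surj_inv[OF V_inj])
  show "cinner (inv V x) (inv V y) = \<sigma> (cinner x y)" for x y by (simp add: inv_cinner)
qed

lemma conj_outer: "conj (outer x) = outer (V x)"
proof
  fix z
  have "\<sigma> (cinner x (inv V z)) = cinner (V x) z" using V_cinner[of x "inv V z"] by simp
  then show "conj (outer x) z = outer (V x) z" by (simp add: conj_def outer_def V_scaleC)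
qed

lemma conj_diff: "conj (\<lambda>x. A x - B x) = (\<lambda>x. conj A x - conj B x)"
  by (simp add: conj_def V_diff)

lemma conj_selfadjoint:
  assumes sa: "selfadjoint_op A"
  shows "selfadjoint_op (conj A)"
proof -
  interpret W: semiunitary_conj \<sigma> "inv V" by unfold_locales (rule inv_semiunitary)
  note lin = clinear_simps[OF selfadjoint_opD(2)[OF sa]]
  obtain K where K: "\<And>x. norm (A x) \<le> K * norm x" using bounded_clinear_op_bound[OF selfadjoint_opD(1)[OF sa]] by metis
  have "bounded_clinear_op (conj A)"
  proof (rule bounded_clinear_opI[where K=K])
    show "norm (conj A x) \<le> K * norm x" for x using K[of "inv V x"] by (simp add: conj_def V_norm W.V_norm)
  qed (simp_all add: conj_def W.V_add W.V_scaleC V_add V_scaleC lin \<sigma>_simps)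
  moreover have "cinner (conj A x) y = cinner x (conj A y)" for x y
  proof -
    have "cinner (conj A x) (V (inv V y)) = cinner (V (inv V x)) (conj A y)"
      unfolding conj_def V_cinner by (simp add: selfadjoint_opD(3)[OF sa])
    then show ?thesis by simp
  qed
  ultimately show ?thesis by (simp add: selfadjoint_op_def)
qed

text \<open>The eigenbasis is carried over by \<open>V\<close>. The eigenvalues are real, so
  \<open>\<sigma>\<close> does not change them, and the trace norm is preserved.\<close>

lemma conj_trace_diag:
  assumes "trace_diag A G l"
  shows "trace_diag (conj A) (V ` G) (l \<circ> inv V)"
proof -
  have G: "is_onb G" "\<And>g. g \<in> G \<Longrightarrow> A g = l g *\<^sub>R g" "(\<lambda>g. \<bar>l g\<bar>) summable_on G"
    using assms by (auto simp: trace_diag_def)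
  have "orthonormal (V ` G)"
    using is_onb_orthonormal[OF G(1)] by (auto simp: orthonormal_def V_cinner \<sigma>_simps)
  moreover have "x = 0" if "\<forall>e\<in>V ` G. cinner e x = 0" for x
  proof -
    have "cinner e (inv V x) = 0" if "e \<in> G" for e
      using V_cinner[of e "inv V x"] \<open>\<forall>e\<in>V ` G. cinner e x = 0\<close> that by (simp add: \<sigma>_simps)
    then have "inv V x = 0" using G(1) by (auto simp: is_onb_iff)
    then show ?thesis using V_inv(1)[of x] by (simp add: V_zero)
  qed
  ultimately have "is_onb (V ` G)" by (simp add: is_onb_iff)
  moreover have "(\<lambda>g. \<bar>(l \<circ> inv V) g\<bar>) summable_on V ` G"
    using G(3) by (subst summable_on_reindex) (auto simp: o_def intro: inj_on_subset[OF V_inj])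
  ultimately show ?thesis using G(2) by (auto simp: trace_diag_def conj_def V_scaleR)
qed

lemma conj_trace_class:
  assumes A: "A \<in> trace_class_sa"
  shows "conj A \<in> trace_class_sa" "trace_norm (conj A) = trace_norm A"
proof -
  note sa = trace_class_sa_selfadjoint[OF A]
  obtain G l where diag: "trace_diag A G l" using trace_class_diag[OF A] by blast
  note c = trace_diag_trace_class[OF conj_selfadjoint[OF sa] conj_trace_diag[OF diag]]
  show "conj A \<in> trace_class_sa" by (rule c(1))
  have "(\<Sum>\<^sub>\<infinity>g\<in>V ` G. \<bar>(l \<circ> inv V) g\<bar>) = (\<Sum>\<^sub>\<infinity>g\<in>G. \<bar>l g\<bar>)"
    by (subst infsum_reindex) (auto simp: o_def intro: inj_on_subset[OF V_inj])
  then show "trace_norm (conj A) = trace_norm A"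
    unfolding c(2) trace_diag_trace_class(2)[OF sa diag] .
qed

lemma conj_surj:
  assumes "B \<in> trace_class_sa"
  shows "\<exists>A\<in>trace_class_sa. conj A = B"
proof -
  interpret W: semiunitary_conj \<sigma> "inv V" by unfold_locales (rule inv_semiunitary)
  have "conj (W.conj B) = B" by (simp add: conj_def W.conj_def inv_inv_eq[OF bijI[OF V_inj V_surj]])
  then show ?thesis using W.conj_trace_class(1)[OF assms] by blast
qed

lemma conj_adjoint_form:
  "(unitary_op V \<and> (\<forall>A. conj A = V \<circ> A \<circ> cadjoint V)) \<or>
   (antiunitary_op V \<and> (\<forall>A. conj A = V \<circ> A \<circ> antiadjoint V))"
  using \<sigma>_cases
proof
  assume s: "\<sigma> = (\<lambda>c. c)"
  have "cadjoint V = inv V" by (rule cadjoint_eqI) (simp add: inv_cinner s)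
  moreover have "unitary_op V"
    by (simp add: unitary_op_def clinear_def V_add V_scaleC V_surj V_cinner s)
  ultimately show ?thesis by (simp add: conj_def o_def)
next
  assume s: "\<sigma> = cnj"
  have "antiadjoint V = inv V" by (rule antiadjoint_eqI) (simp add: inv_cinner s)
  moreover have "antiunitary_op V"
    by (simp add: antiunitary_op_def antilinear_def V_add V_scaleC V_surj V_cinner s)
  ultimately show ?thesis by (simp add: conj_def o_def)
qed

end

section \<open>Identification of \<open>L\<close> and of its closure\<close>

lemma (in density_preserver) L_eq_conj:
  assumes V: "semiunitary \<sigma> V" "\<And>x. L (outer x) = outer (V x)" and A: "A \<in> finite_rank_sa"
  shows "L A = semiunitary_conj.conj V A"
proof -
  interpret V: semiunitary_conj \<sigma> V by unfold_locales (rule V(1))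
  obtain E l where E: "trace_diag A E l" "finite {e\<in>E. l e \<noteq> 0}" using finite_rank_sa_diag[OF A] by blast
  define F where "F = {e\<in>E. l e \<noteq> 0}"
  have eq: "A = (\<lambda>x. \<Sum>g\<in>F. l g *\<^sub>R outer g x)"
    by (rule diag_finite_sum[OF finite_rank_sa_selfadjoint[OF A]]) (use E in \<open>auto simp: trace_diag_def F_def\<close>)
  have "L A = (\<lambda>x. \<Sum>g\<in>F. L (\<lambda>x. l g *\<^sub>R outer g x) x)"
    unfolding eq by (rule L_sum) (use E(2) F_def in \<open>auto intro: finite_rank_sa_scaleR outer_finite_rank_sa\<close>)
  also have "\<dots> = (\<lambda>x. \<Sum>g\<in>F. l g *\<^sub>R V.conj (outer g) x)"
    by (simp add: homogeneous outer_finite_rank_sa V(2) V.conj_outer)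
  also have "\<dots> = V.conj A"
    by (simp add: eq V.conj_def V.V_sum V.V_scaleR)
  finally show ?thesis .
qed

text \<open>A graph limit is determined pointwise: trace norm convergence of \<open>X n\<close> to
  \<open>A\<close> and of \<open>L (X n)\<close> to \<open>B\<close> implies pointwise convergence,
  and \<open>L (X n)\<close> is \<open>X n\<close> conjugated by \<open>V\<close>. Conversely,
  finite-rank approximants of \<open>A\<close> are transported isometrically. Closability, domain
  and formula all follow from this description.\<close>

lemma (in density_preserver) closure_graph_eq:
  assumes V: "semiunitary \<sigma> V" "\<And>x. L (outer x) = outer (V x)"
  shows "(A, B) \<in> closure_graph L \<longleftrightarrow> A \<in> trace_class_sa \<and> B = semiunitary_conj.conj V A"
proof -
  interpret V: semiunitary_conj \<sigma> V by unfold_locales (rule V(1))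
  note LV = L_eq_conj[OF V]
  show ?thesis
  proof
    assume "(A, B) \<in> closure_graph L"
    then obtain X where A: "A \<in> trace_class_sa" and B: "B \<in> trace_class_sa" and X: "\<And>n. X n \<in> finite_rank_sa"
      and lA: "(\<lambda>n. trace_norm (\<lambda>x. X n x - A x)) \<longlonglongrightarrow> 0" and lB: "(\<lambda>n. trace_norm (\<lambda>x. L (X n) x - B x)) \<longlonglongrightarrow> 0"
      by (auto simp: closure_graph_def)
    have pointwise: "(\<lambda>n. Y n x) \<longlonglongrightarrow> C x"
      if Y: "\<And>n. Y n \<in> trace_class_sa" "C \<in> trace_class_sa" and l: "(\<lambda>n. trace_norm (\<lambda>x. Y n x - C x)) \<longlonglongrightarrow> 0"
      for Y :: "nat \<Rightarrow> 'a \<Rightarrow> 'a" and C x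
    proof (rule LIM_zero_cancel, rule Lim_null_comparison[OF always_eventually[OF allI]])
      show "norm (Y n x - C x) \<le> trace_norm (\<lambda>x. Y n x - C x) * norm x" for n
        by (rule norm_le_trace_norm[OF trace_class_sa_diff[OF Y(1) Y(2)]])
      show "(\<lambda>n. trace_norm (\<lambda>x. Y n x - C x) * norm x) \<longlonglongrightarrow> 0"
        using tendsto_mult_right[OF l, of "norm x"] by simp
    qed
    have "B x = V.conj A x" for x
    proof -
      have "(\<lambda>n. X n (inv V x) - A (inv V x)) \<longlonglongrightarrow> 0"
        by (rule LIM_zero) (rule pointwise[OF finite_rank_sa_trace_class[OF X] A lA])
      from tendsto_norm_zero[OF this] have "(\<lambda>n. norm (L (X n) x - V.conj A x)) \<longlonglongrightarrow> 0"
        by (simp add: LV X V.conj_def V.V_norm flip: V.V_diff)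
      then have "(\<lambda>n. L (X n) x) \<longlonglongrightarrow> V.conj A x" by (rule LIM_zero_cancel[OF tendsto_norm_zero_cancel])
      moreover have "L (X n) \<in> trace_class_sa" for n
        unfolding LV[OF X] by (rule V.conj_trace_class(1)[OF finite_rank_sa_trace_class[OF X]])
      ultimately show ?thesis using LIMSEQ_unique[OF pointwise[OF _ B lB]] by blast
    qed
    then show "A \<in> trace_class_sa \<and> B = V.conj A" using A by blast
  next
    assume "A \<in> trace_class_sa \<and> B = V.conj A"
    then have A: "A \<in> trace_class_sa" and B: "B = V.conj A" by auto
    obtain X where X: "\<And>n. X n \<in> finite_rank_sa" "(\<lambda>n. trace_norm (\<lambda>x. X n x - A x)) \<longlonglongrightarrow> 0"
      using finite_rank_sa_dense[OF A] by blast
    have "trace_norm (\<lambda>x. L (X n) x - B x) = trace_norm (\<lambda>x. X n x - A x)" for n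
      unfolding B LV[OF X(1)] V.conj_diff[symmetric]
      by (rule V.conj_trace_class(2)[OF trace_class_sa_diff[OF finite_rank_sa_trace_class[OF X(1)] A]])
    then show "(A, B) \<in> closure_graph L"
      using A B X V.conj_trace_class(1)[OF A] by (auto simp: closure_graph_def intro!: exI[of _ X])
  qed
qed

theorem theorem2:
  fixes L :: "('a::chilbert_space \<Rightarrow> 'a) \<Rightarrow> ('a \<Rightarrow> 'a)"
  assumes sep: "separable_space TYPE('a)"
    and dim: "dim_ge_2 TYPE('a)"
    and maps_into: "\<forall>A\<in>finite_rank_sa. L A \<in> trace_class_sa"
    and additive: "\<forall>A\<in>finite_rank_sa. \<forall>B\<in>finite_rank_sa. L (\<lambda>x. A x + B x) = (\<lambda>x. L A x + L B x)"
    and homogeneous: "\<forall>A\<in>finite_rank_sa. \<forall>r::real. L (\<lambda>x. r *\<^sub>R A x) = (\<lambda>x. r *\<^sub>R L A x)"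
    and bij: "bij_betw L (finite_rank_sa \<inter> density_ops) (finite_rank_sa \<inter> density_ops)"
  shows "closable L
    \<and> Domain (closure_graph L) = trace_class_sa
    \<and> op_closure L ` trace_class_sa = trace_class_sa
    \<and> (\<forall>A\<in>trace_class_sa. \<forall>B\<in>trace_class_sa.
         trace_norm (\<lambda>x. op_closure L A x - op_closure L B x) = trace_norm (\<lambda>x. A x - B x))
    \<and> (\<exists>U. (unitary_op U \<and> (\<forall>A\<in>trace_class_sa. op_closure L A = U \<circ> A \<circ> cadjoint U))
         \<or> (antiunitary_op U \<and> (\<forall>A\<in>trace_class_sa. op_closure L A = U \<circ> A \<circ> antiadjoint U)))"
proof -
  interpret density_preserver L
    by unfold_locales (use additive homogeneous bij in auto)
  obtain x y :: 'a where xy: "\<forall>a b. scaleC a x + scaleC b y = 0 \<longrightarrow> a = 0 \<and> b = 0"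
    using dim by (auto simp: dim_ge_2_def)
  \<comment> \<open>The dimension hypothesis supplies the nonzero vector from which the Wigner
    operator is built.\<close>
  have "x \<noteq> 0" using xy[rule_format, of 1 0] by auto
  then obtain \<sigma> V where V: "semiunitary \<sigma> V" "\<And>x. L (outer x) = outer (V x)"
    using wigner by blast
  interpret V: semiunitary_conj \<sigma> V by unfold_locales (rule V(1))
  note graph = closure_graph_eq[OF V]
  have cl: "op_closure L A = V.conj A" if "A \<in> trace_class_sa" for A
    unfolding op_closure_def graph using that by simp
  have "closable L" by (simp add: closable_def graph)
  moreover have "Domain (closure_graph L) = trace_class_sa" by (auto simp: Domain_iff graph)
  moreover have "op_closure L ` trace_class_sa = trace_class_sa"
  proof -
    have "op_closure L ` trace_class_sa = V.conj ` trace_class_sa" by (rule image_cong) (simp_all add: cl)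
    also have "\<dots> = trace_class_sa" using V.conj_trace_class(1) V.conj_surj by blast
    finally show ?thesis .
  qed
  moreover have "trace_norm (\<lambda>x. op_closure L A x - op_closure L B x) = trace_norm (\<lambda>x. A x - B x)"
    if "A \<in> trace_class_sa" "B \<in> trace_class_sa" for A B
    using V.conj_trace_class(2)[OF trace_class_sa_diff[OF that]] by (simp add: cl that V.conj_diff)
  moreover have "(unitary_op V \<and> (\<forall>A\<in>trace_class_sa. op_closure L A = V \<circ> A \<circ> cadjoint V))
      \<or> (antiunitary_op V \<and> (\<forall>A\<in>trace_class_sa. op_closure L A = V \<circ> A \<circ> antiadjoint V))"
    using V.conj_adjoint_form cl by auto
  ultimately show ?thesis by blast
qed

end
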